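(* Let $p$ be an odd prime, let $m\ge 5$ be an odd integer, and let $k$ be a positive integer with $\gcd(m,k)=1$. Let $\mathcal{C}_{(p,m,k)}$ be the cyclic code over $\mathbb{F}_p$ of length $p^m-1$ defined in the context. Then $\mathcal{C}_{(p,m,k)}$ is a cyclic code over $\mathbb{F}_p$ with parameters $$[\,p^m-1,\ 4m,\ (p-1)p^{m-1}-p^{\frac{m+3}{2}}\,]$$ (length, dimension, minimum Hamming distance). Moreover, with the integers $n_{\varepsilon,i,j}$ and $\omega$ given in the context, its weight distribution (number of codewords of each Hamming weight) is the following, all other weights having frequency $0$: - weight $0$: $1$; - weight $(p-1)p^{m-1}$: $\omega+2n_{1,0,0}+2n_{1,2,0}+2n_{1,4,0}$; - weight $(p-1)p^{m-1}-p^{\frac{m-1}{2}}$: $(p-1)n_{(\frac{-1}{p}),0,1}+(p-1)n_{-1,1,1}$; - weight $(p-1)p^{m-1}+p^{\frac{m-1}{2}}$: $(p-1)n_{-(\frac{-1}{p}),0,1}+(p-1)n_{1,1,1}$; - weight $(p-1)p^{m-1}-(p-1)p^{\frac{m-1}{2}}$: $n_{1,1,0}$; - weight $(p-1)p^{m-1}+(p-1)p^{\frac{m-1}{2}}$: $n_{-1,1,0}$; - weight $(p-1)p^{m-1}-p^{\frac{m+1}{2}}$: $(p-1)n_{(\frac{-1}{p}),2,1}+(p-1)n_{-1,3,1}$; - weight $(p-1)p^{m-1}+p^{\frac{m+1}{2}}$: $(p-1)n_{-(\frac{-1}{p}),2,1}+(p-1)n_{1,3,1}$; - weight $(p-1)p^{m-1}-(p-1)p^{\frac{m+1}{2}}$: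 $n_{1,3,0}$; - weight $(p-1)p^{m-1}+(p-1)p^{\frac{m+1}{2}}$: $n_{-1,3,0}$; - weight $(p-1)p^{m-1}-p^{\frac{m+3}{2}}$: $(p-1)n_{(\frac{-1}{p}),4,1}$; - weight $(p-1)p^{m-1}+p^{\frac{m+3}{2}}$: $(p-1)n_{-(\frac{-1}{p}),4,1}$.
   Context: Code. Let $\pi$ be a primitive element of $\mathbb{F}_{p^m}$ and let $\mathrm{Tr}$ be the trace map from $\mathbb{F}_{p^m}$ to $\mathbb{F}_p$. Let $h_0,h_1,h_2,h_3$ be the minimal polynomials over $\mathbb{F}_p$ of $\pi^{-1},\pi^{-2},\pi^{-(p^k+1)},\pi^{-(p^{2k}+1)}$ respectively. $\mathcal{C}_{(p,m,k)}$ is the cyclic code of length $p^m-1$ over $\mathbb{F}_p$ with parity-check polynomial $h=h_0h_1h_2h_3$ (i.e. generator polynomial $(x^{p^m-1}-1)/h(x)$). Equivalently, $\mathcal{C}_{(p,m,k)}=\{\mathbf{c}_{(\alpha,\beta,\gamma,\delta)}:\alpha,\beta,\gamma,\delta\in\mathbb{F}_{p^m}\}$, where $$\mathbf{c}_{(\alpha,\beta,\gamma,\delta)}=\big(\mathrm{Tr}(\alpha\pi^{(p^{2k}+1)t}+\beta\pi^{(p^k+1)t}+\gamma\pi^{2t}+\delta\pi^t)\big)_{t=0}^{p^m-2}.$$ Integers. $(\frac{\cdot}{p})$ is the Legendre symbol. For $\varepsilon\in\{1,-1\}$ define $$n_{\varepsilon,1}=\frac{(p^{m+1}+\varepsilon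 p^{(m+3)/2})(p^{2m}-p^{2m-2}-p^{2m-3}+p^{m-2}+p^{m-3}-1)}{2(p^2-1)},$$ $$n_{\varepsilon,3}=\frac{(p^{m-3}+\varepsilon p^{(m-3)/2})(p^{m-1}-1)(p^m-1)}{2(p^2-1)},$$ $$n_{1,2}=n_{-1,2}=\frac{p^2(p^{m-1}-1)(p^{2m}-p^{2m-2}-p^{2m-3}+p^{m-2}+p^{m-3}-1)}{2(p^2-1)^2},$$ $$n_{1,4}=n_{-1,4}=\frac{(p^m-1)(p^{m-1}-1)(p^{m-3}-1)}{2(p^2-1)(p^4-1)},$$ $$n_{1,0}=n_{-1,0}=\tfrac12(p^m-1)(p^{2m}-p^{2m-1}+p^{2m-4}+p^m-p^{m-1}-p^{m-3}+1)-n_{1,2}-n_{1,4},$$ and $n_i=n_{1,i}+n_{-1,i}$ for $0\le i\le4$. For $\varepsilon=\pm1$ and $j\in\mathbb{F}_p^*$ define: for $i\in\{1,3\}$, $n_{\varepsilon,i,0}=(p^{m-i-1}+\varepsilon(p-1)p^{\frac{m-i-2}{2}})n_{\varepsilon,i}$ and $n_{\varepsilon,i,j}=(p^{m-i-1}-\varepsilon p^{\frac{m-i-2}{2}})n_{\varepsilon,i}$; for $i\in\{0,2,4\}$, $n_{\varepsilon,i,0}=p^{m-i-1}n_{\varepsilon,i}$ and $n_{\varepsilon,i,j}=(p^{m-i-1}+\varepsilon(\frac{-j}{p})p^{\frac{m-i-1}{2}})n_{\varepsilon,i}$. Finally $$\omega=p^m-1+(p^m-p^{m-1})n_1+(p^m-p^{m-2})n_2+(p^m-p^{m-3})n_3+(p^m-p^{m-4})n_4.$$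 *)

theory Defs
  imports
    "HOL-Number_Theory.Number_Theory"
    "Berlekamp_Zassenhaus.Finite_Field"
    "Jordan_Normal_Form.VS_Connect"
begin

text \<open>
  The prime field with \<open>p\<close> elements is \<open>'p mod_ring\<close> with \<open>CARD('p) = p\<close>; its extension of
  degree \<open>m\<close> is any finite field type \<open>'a\<close> with \<open>CARD('a) = p ^ m\<close>. Such a type has
  characteristic \<open>p\<close>, and \<open>prime_embed\<close> is then the unique field embedding. It is not a
  homomorphism for other characteristics.
\<close>

definition prime_embed :: "'p::prime_card mod_ring \<Rightarrow> 'a::field" where
  "prime_embed x = of_int (to_int_mod_ring x)"

definition primitive_element :: "'a::field \<Rightarrow> bool" where
  "primitive_element a \<longleftrightarrow> range (\<lambda>i::nat. a ^ i) = UNIV - {0}"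

definition is_minimal_poly :: "'p::prime_card mod_ring poly \<Rightarrow> 'a::field \<Rightarrow> bool" where
  "is_minimal_poly f x \<longleftrightarrow>
     lead_coeff f = 1 \<and> poly (map_poly prime_embed f) x = 0 \<and>
     (\<forall>g :: 'p mod_ring poly. g \<noteq> 0 \<and> poly (map_poly prime_embed g) x = 0 \<longrightarrow> degree f \<le> degree g)"

definition minimal_poly :: "'a::field \<Rightarrow> 'p::prime_card mod_ring poly" where
  "minimal_poly x = (THE f. is_minimal_poly f x)"


definition hamming_distance :: "'f vec \<Rightarrow> 'f vec \<Rightarrow> nat" where
  "hamming_distance u v = card {i. i < dim_vec u \<and> u $ i \<noteq> v $ i}"

definition hamming_weight :: "'f::zero vec \<Rightarrow> nat" where
  "hamming_weight u = card {i. i < dim_vec u \<and> u $ i \<noteq> 0}"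

definition min_distance :: "'f vec set \<Rightarrow> nat" where
  "min_distance C = Min {hamming_distance u v | u v. u \<in> C \<and> v \<in> C \<and> u \<noteq> v}"

text \<open>Weights are taken as integers so that they can be written with genuine subtraction.\<close>

definition weight_frequency :: "'f::zero vec set \<Rightarrow> int \<Rightarrow> nat" where
  "weight_frequency C w = card {c \<in> C. int (hamming_weight c) = w}"

definition linear_code :: "nat \<Rightarrow> 'f::field vec set \<Rightarrow> bool" where
  "linear_code n C \<longleftrightarrow> VectorSpace.subspace class_ring C (module_vec TYPE('f) n)"

definition code_dim :: "nat \<Rightarrow> 'f::field vec set \<Rightarrow> nat" where
  "code_dim n C = vectorspace.dim class_ring ((module_vec TYPE('f) n)\<lparr>carrier := C\<rparr>)"

definition cyclic_shift :: "'f vec \<Rightarrow> 'f vec" where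
  "cyclic_shift c = vec (dim_vec c) (\<lambda>i. c $ ((i + dim_vec c - 1) mod dim_vec c))"

definition cyclic_code :: "nat \<Rightarrow> 'f::field vec set \<Rightarrow> bool" where
  "cyclic_code n C \<longleftrightarrow> linear_code n C \<and> (\<forall>c \<in> C. cyclic_shift c \<in> C)"

text \<open>
  A vector \<open>(c\<^sub>0, \<dots>, c\<^bsub>n-1\<^esub>)\<close> is identified with \<open>c\<^sub>0 + c\<^sub>1 x + \<dots> + c\<^bsub>n-1\<^esub> x\<^bsup>n-1\<^esup>\<close>. The ideal of
  \<open>F[x]/(x\<^bsup>n\<^esup> - 1)\<close> generated by the divisor \<open>g = (x\<^bsup>n\<^esup> - 1)/h\<close> of \<open>x\<^bsup>n\<^esup> - 1\<close> consists of the
  classes of the multiples of \<open>g\<close> of degree less than \<open>n\<close>.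
\<close>

definition code_of_parity_check :: "nat \<Rightarrow> 'f::field poly \<Rightarrow> 'f vec set" where
  "code_of_parity_check n h =
     {c \<in> carrier_vec n. (monom 1 n - 1) div h dvd Poly (list_of_vec c)}"

definition code_pmk :: "nat \<Rightarrow> nat \<Rightarrow> 'a::field \<Rightarrow> 'p::prime_card mod_ring vec set" where
  "code_pmk m k \<pi> =
     (let p = CARD('p);
          h\<^sub>0 = minimal_poly (inverse \<pi>);
          h\<^sub>1 = minimal_poly (inverse (\<pi> ^ 2));
          h\<^sub>2 = minimal_poly (inverse (\<pi> ^ (p ^ k + 1)));
          h\<^sub>3 = minimal_poly (inverse (\<pi> ^ (p ^ (2 * k) + 1)))
      in code_of_parity_check (p ^ m - 1) (h\<^sub>0 * h\<^sub>1 * h\<^sub>2 * h\<^sub>3))"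


text \<open>
  The numbers \<open>n\<^bsub>\<epsilon>,i\<^esub>\<close>, \<open>n\<^sub>i\<close>, \<open>n\<^bsub>\<epsilon>,i,j\<^esub>\<close> and \<open>\<omega>\<close>, for odd \<open>m \<ge> 5\<close>, \<open>\<epsilon> \<in> {1, -1}\<close> and \<open>i \<le> 4\<close>. For
  \<open>i\<close> even, \<open>n\<^bsub>\<epsilon>,i\<^esub>\<close> does not depend on \<open>\<epsilon>\<close>. Every exponent is then an exact natural number;
  the divisions are performed in the reals. An element \<open>j\<close> of the prime field is represented by
  an integer in \<open>{0..<p}\<close>.
\<close>

definition poly_factor :: "nat \<Rightarrow> nat \<Rightarrow> real" where
  "poly_factor p m =
     real p ^ (2*m) - real p ^ (2*m - 2) - real p ^ (2*m - 3)
       + real p ^ (m - 2) + real p ^ (m - 3) - 1"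

definition n_eps_1 :: "nat \<Rightarrow> nat \<Rightarrow> int \<Rightarrow> real" where
  "n_eps_1 p m \<epsilon> =
     (real p ^ (m + 1) + of_int \<epsilon> * real p ^ ((m + 3) div 2)) * poly_factor p m
       / (2 * (real p ^ 2 - 1))"

definition n_eps_3 :: "nat \<Rightarrow> nat \<Rightarrow> int \<Rightarrow> real" where
  "n_eps_3 p m \<epsilon> =
     (real p ^ (m - 3) + of_int \<epsilon> * real p ^ ((m - 3) div 2))
       * (real p ^ (m - 1) - 1) * (real p ^ m - 1) / (2 * (real p ^ 2 - 1))"

definition n_eps_2 :: "nat \<Rightarrow> nat \<Rightarrow> real" where
  "n_eps_2 p m =
     real p ^ 2 * (real p ^ (m - 1) - 1) * poly_factor p m / (2 * (real p ^ 2 - 1) ^ 2)"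

definition n_eps_4 :: "nat \<Rightarrow> nat \<Rightarrow> real" where
  "n_eps_4 p m =
     (real p ^ m - 1) * (real p ^ (m - 1) - 1) * (real p ^ (m - 3) - 1)
       / (2 * (real p ^ 2 - 1) * (real p ^ 4 - 1))"

definition n_eps_0 :: "nat \<Rightarrow> nat \<Rightarrow> real" where
  "n_eps_0 p m =
     1 / 2 * (real p ^ m - 1)
       * (real p ^ (2*m) - real p ^ (2*m - 1) + real p ^ (2*m - 4)
          + real p ^ m - real p ^ (m - 1) - real p ^ (m - 3) + 1)
     - n_eps_2 p m - n_eps_4 p m"

definition n_eps :: "nat \<Rightarrow> nat \<Rightarrow> int \<Rightarrow> nat \<Rightarrow> real" where
  "n_eps p m \<epsilon> i =
     (if i = 0 then n_eps_0 p m
      else if i = 1 then n_eps_1 p m \<epsilon>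
      else if i = 2 then n_eps_2 p m
      else if i = 3 then n_eps_3 p m \<epsilon>
      else n_eps_4 p m)"

definition n_total :: "nat \<Rightarrow> nat \<Rightarrow> nat \<Rightarrow> real" where
  "n_total p m i = n_eps p m 1 i + n_eps p m (-1) i"

definition n_eps_val :: "nat \<Rightarrow> nat \<Rightarrow> int \<Rightarrow> nat \<Rightarrow> int \<Rightarrow> real" where
  "n_eps_val p m \<epsilon> i j =
     (if odd i then
        (if j = 0
         then real p ^ (m - i - 1) + of_int \<epsilon> * (real p - 1) * real p ^ ((m - i - 2) div 2)
         else real p ^ (m - i - 1) - of_int \<epsilon> * real p ^ ((m - i - 2) div 2))
      else
        (if j = 0
         then real p ^ (m - i - 1)
         else real p ^ (m - i - 1)
                + of_int \<epsilon> * of_int (Legendre (- j) (int p)) * real p ^ ((m - i - 1) div 2)))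
     * n_eps p m \<epsilon> i"

definition omega :: "nat \<Rightarrow> nat \<Rightarrow> real" where
  "omega p m =
     real p ^ m - 1
       + (real p ^ m - real p ^ (m - 1)) * n_total p m 1
       + (real p ^ m - real p ^ (m - 2)) * n_total p m 2
       + (real p ^ m - real p ^ (m - 3)) * n_total p m 3
       + (real p ^ m - real p ^ (m - 4)) * n_total p m 4"

end

theory Submission
  imports Defs
begin

text \<open>
  After substituting \<open>x = \<pi>\<^sup>t\<close>, a codeword is the value table of \<open>Q(x) + Tr(\<delta>x)\<close> for the quadratic form
  \<open>Q(x) = Tr(\<alpha>x\<sigma>\<^sup>2(x) + \<beta>x\<sigma>(x) + \<gamma>x\<^sup>2)\<close>, where \<open>\<sigma>\<close> is the \<open>k\<close>-th power of the Frobenius automorphism,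
  with fixed field \<open>F\<^sub>p\<close>. The radical of \<open>Q\<close> is the kernel of a \<open>\<sigma>\<close>-polynomial of \<open>\<sigma>\<close>-degree 4, so
  \<open>Q \<noteq> 0\<close> has nullity at most 4. The nullity of \<open>Q\<close> and, for even rank, the sign of its exponential sum
  determine the distribution of the weights over \<open>\<delta>\<close>.

  To count the forms of each type, let \<open>\<nu>\<close> be a nonsquare and \<open>T\<^sub>l\<close> the exponential sum of \<open>l Q\<close>. The sums of
  \<open>T\<^sub>1 + T\<^sub>\<nu>\<close>, \<open>T\<^sub>1T\<^sub>-\<^sub>1\<close> and \<open>T\<^sub>1T\<^sub>-\<^sub>\<nu>\<close> over the family, with and without the weight \<open>|rad Q|\<close>, are given by
  numbers of solutions of explicit equations. The nonsquare separates even from odd rank, and together with the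
  total number of forms this gives seven linear equations for the seven unknown counts.

  Nonzero parameters give words of nonzero weight, so the trace words depend injectively on the parameters.
  Counting then shows that the four minimal polynomials are distinct of degree \<open>m\<close> and that the trace words
  are the whole code.
\<close>

subsection \<open>Characters of finite groups\<close>

text \<open>Using all multipliers l of a form, not only l = 1, turns exponential sums into zero
  counts. Since the sum for l Q is the sum for Q times the quadratic character of l to the power of
  the rank, comparing l = 1 with l = -1 and l = \<nu> reads off the parity of the rank. For odd rank
  the sign of the sum is not an extra unknown: as \<delta> varies, both signs give the same
  distribution. This leaves seven classes, nullities 0, 2, 4 without a sign and 1, 3 with one, and
  explains n_{1,i} = n_{-1,i} for even i. The weight |rad Q| replaces higher moments: it counts
  pairs of a form and a radical vector y. For fixed y \<noteq> 0 the scaling x = t y removes y from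
  the equations, which become relations between squares of t - \<sigma> t and t - \<sigma>^2 t.
  Oddness of m enters twice: \<nu> stays a nonsquare in the extension, so x^2 = \<nu> z^2 has only
  the zero solution, and odd rank means even nullity. The zero form has nullity m \<ge> 5 and is
  kept apart from the seven classes.\<close>

lemma sum_character_eq_0:
  fixes \<psi> :: "'g::{ab_group_add,finite} \<Rightarrow> complex"
  assumes hom: "\<And>x y. \<psi> (x + y) = \<psi> x * \<psi> y" and nontriv: "\<psi> a \<noteq> 1"
  shows "(\<Sum>x\<in>UNIV. \<psi> x) = 0"
proof -
  have "(\<Sum>x\<in>UNIV. \<psi> x) = (\<Sum>x\<in>UNIV. \<psi> (x + a))"
    by (rule sum.reindex_bij_witness[of _ "\<lambda>x. x + a" "\<lambda>x. x - a"]) auto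
  also have "\<dots> = (\<Sum>x\<in>UNIV. \<psi> x) * \<psi> a"
    by (simp add: hom sum_distrib_right)
  finally have "(\<Sum>x\<in>UNIV. \<psi> x) * (1 - \<psi> a) = 0"
    by (simp add: algebra_simps)
  then show ?thesis using nontriv by simp
qed

lemma sum_UNIV_shift:
  fixes f :: "'g::{ab_group_add,finite} \<Rightarrow> 'b::comm_monoid_add"
  shows "(\<Sum>x\<in>UNIV. f (x + a)) = (\<Sum>x\<in>UNIV. f x)"
  by (rule sum.reindex_bij_witness[of _ "\<lambda>x. x - a" "\<lambda>x. x + a"]) auto

lemma sum_UNIV_mult:
  fixes f :: "'g::{field,finite} \<Rightarrow> 'b::comm_monoid_add"
  assumes "a \<noteq> 0"
  shows "(\<Sum>x\<in>UNIV. f (a * x)) = (\<Sum>x\<in>UNIV. f x)"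
  by (rule sum.reindex_bij_witness[of _ "\<lambda>x. x / a" "\<lambda>x. a * x"]) (use assms in auto)

definition add_char :: "'p::prime_card mod_ring \<Rightarrow> complex" where
  "add_char c = cis (2 * pi * of_int (to_int_mod_ring c) / of_nat CARD('p))"

text \<open>The two angles differ by an integer multiple of 2 pi. This makes \<open>add_char\<close>
  additive although \<open>to_int_mod_ring\<close> is additive only modulo p.\<close>

lemma cis_mod:
  assumes "N > 0"
  shows "cis (2 * pi * of_int (z mod int N) / of_nat N) = cis (2 * pi * of_int z / of_nat N)"
proof -
  have "of_int z = of_int (z mod int N) + real N * of_int (z div int N)"
    by (metis add.commute mult_div_mod_eq of_int_add of_int_mult of_int_of_nat_eq)
  then have "2 * pi * of_int z / of_nat N
      = 2 * pi * of_int (z mod int N) / of_nat N + 2 * pi * of_int (z div int N)"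
    using assms by (simp add: field_simps)
  then show ?thesis by (simp add: cis_mult[symmetric] cis_multiple_2pi del: cis_mult)
qed

lemma add_char_0 [simp]: "add_char 0 = 1"
  by (simp add: add_char_def)

lemma add_char_add: "add_char (a + b) = add_char a * add_char b"
  for a b :: "'p::prime_card mod_ring"
proof -
  have "to_int_mod_ring (a + b) = (to_int_mod_ring a + to_int_mod_ring b) mod int CARD('p)"
    by (simp add: to_int_mod_ring_add)
  then show ?thesis
    unfolding add_char_def by (simp only: cis_mod[OF zero_less_card_finite]) (simp add: cis_mult add_divide_distrib distrib_left)
qed

lemma cmod_add_char [simp]: "cmod (add_char a) = 1"
  by (simp add: add_char_def)

lemma add_char_nonzero [simp]: "add_char a \<noteq> 0"
  by (metis cmod_add_char norm_zero zero_neq_one)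

lemma add_char_uminus: "add_char (- a) = cnj (add_char a)"
proof -
  have "add_char (-a) * add_char a = 1"
    by (simp flip: add_char_add)
  moreover have "cnj (add_char a) * add_char a = 1"
    by (metis cmod_add_char complex_norm_square mult.commute of_real_1 one_power2)
  ultimately show ?thesis
    by (metis add_char_nonzero mult_right_cancel)
qed

lemma add_char_1_neq_1: "add_char (1 :: 'p::prime_card mod_ring) \<noteq> 1"
proof
  assume "add_char (1 :: 'p mod_ring) = 1"
  then have "cos (2 * pi / real CARD('p)) = 1"
    by (simp add: add_char_def complex_eq_iff)
  then obtain z :: int where z: "2 * pi / real CARD('p) = z * 2 * pi"
    by (auto simp: cos_one_2pi_int)
  have "prime CARD('p)" by (rule prime_card)
  then have 1: "CARD('p) > 1" by (rule prime_gt_1_nat)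
  have "1 = of_int z * real CARD('p)" using z 1 by (simp add: field_simps)
  then have "1 = z * int CARD('p)" by (metis of_int_1 of_int_eq_iff of_int_mult of_int_of_nat_eq)
  then have "int CARD('p) dvd 1" by (metis dvd_triv_right)
  then show False using 1 by simp
qed

lemma sum_add_char_mult:
  "(\<Sum>c\<in>UNIV. add_char (c * a)) = (if a = 0 then of_nat CARD('p) else 0)"
  for a :: "'p::prime_card mod_ring"
proof (cases "a = 0")
  case False
  have "(\<Sum>c\<in>UNIV. add_char (c * a)) = 0"
    by (rule sum_character_eq_0[where a = "inverse a"])
       (use False add_char_1_neq_1 in \<open>auto simp: distrib_right add_char_add\<close>)
  then show ?thesis using False by simp
qed simp

subsection \<open>The quadratic character and the quadratic Gauss sum\<close>

text \<open>Euler's criterion serves as the definition because it makes multiplicativity immediate;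
  that the value 1 singles out the nonzero squares comes from
  \<open>card_square_roots\<close>.\<close>

definition quad_char :: "'p::prime_card mod_ring \<Rightarrow> real" where
  "quad_char c = (if c = 0 then 0 else if c ^ ((CARD('p) - 1) div 2) = 1 then 1 else -1)"

lemma mod_ring_power_card: "x ^ CARD('p) = x" for x :: "'p::prime_card mod_ring"
  using finite_field_power_card_eq_same[of x] by simp

lemma mod_ring_power_card_minus_1:
  "x \<noteq> 0 \<Longrightarrow> x ^ (CARD('p) - 1) = 1" for x :: "'p::prime_card mod_ring"
  using mod_ring_power_card[of x]
  by (metis Suc_pred' mult_cancel_right1 power_Suc zero_less_card_finite mult.commute)

locale odd_prime_card =
  fixes P :: "'p::prime_card itself"
  assumes odd_p: "odd CARD('p)"
begin

lemma quad_char_power: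
  assumes "c \<noteq> (0 :: 'p mod_ring)"
  shows "c ^ ((CARD('p) - 1) div 2) = 1 \<or> c ^ ((CARD('p) - 1) div 2) = -1"
proof -
  have "(c ^ ((CARD('p) - 1) div 2)) ^ 2 = c ^ (CARD('p) - 1)"
    using odd_p by (simp flip: power_mult)
  then show ?thesis using mod_ring_power_card_minus_1[OF assms] by (simp add: power2_eq_1_iff)
qed

lemma mod_ring_neg_1_neq_1: "(-1 :: 'p mod_ring) \<noteq> 1"
proof
  assume "(-1 :: 'p mod_ring) = 1"
  then have "of_nat 2 = (0 :: 'p mod_ring)"
    by (metis add.right_inverse of_nat_numeral one_add_one)
  then have "CARD('p) dvd 2" by (meson of_nat_0_mod_ring_dvd)
  then have "CARD('p) \<le> 2" by (simp add: dvd_imp_le)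
  moreover have "CARD('p) \<ge> 2" using prime_card prime_ge_2_nat by blast
  ultimately show False using odd_p by (simp add: order_antisym)
qed

lemma quad_char_mult: "quad_char (a * b) = quad_char a * quad_char (b :: 'p mod_ring)"
proof (cases "a = 0 \<or> b = 0")
  case False
  then have "a \<noteq> 0" "b \<noteq> 0" by auto
  from quad_char_power[OF this(1)] quad_char_power[OF this(2)] show ?thesis
    using mod_ring_neg_1_neq_1 \<open>a \<noteq> 0\<close> \<open>b \<noteq> 0\<close>
    unfolding quad_char_def power_mult_distrib by auto
qed (auto simp: quad_char_def)

lemma quad_char_cases: "c \<noteq> 0 \<Longrightarrow> quad_char c = 1 \<or> quad_char c = -1"
  by (auto simp: quad_char_def)

lemma quad_char_0 [simp]: "quad_char 0 = 0"
  by (auto simp: quad_char_def)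

lemma quad_char_1 [simp]: "quad_char (1 :: 'p mod_ring) = 1"
  by (auto simp: quad_char_def)

lemma quad_char_square: "c \<noteq> (0 :: 'p mod_ring) \<Longrightarrow> quad_char c ^ 2 = 1"
  using quad_char_cases[of c] by auto

text \<open>Squaring is two-to-one on the units, so there are (p - 1)/2 nonzero squares. They all
  are roots of X^((p-1)/2) - 1, which has no more roots than that, so the two sets agree.\<close>

lemma card_square_roots: "real (card {t. t ^ 2 = c}) = 1 + quad_char (c :: 'p mod_ring)"
proof -
  define h where "h = (CARD('p) - 1) div 2"
  have p3: "CARD('p) = 2 * h + 1" unfolding h_def using odd_p by (auto elim!: oddE)
  have hp: "h > 0" using p3 prime_card[where ?'a = 'p] by (auto simp: prime_nat_iff intro: gr0I)
  have two: "card {t. t ^ 2 = c} = 2" if "c \<noteq> 0" "s ^ 2 = c" for s c :: "'p mod_ring"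
  proof -
    have "{t. t ^ 2 = c} = {s, -s}" using that by (auto simp: power2_eq_iff)
    moreover have "s \<noteq> -s"
    proof
      assume "s = -s"
      then have "2 * s = 0" by simp
      moreover have "(2::'p mod_ring) \<noteq> 0" using mod_ring_neg_1_neq_1
        by (metis add.inverse_unique one_add_one)
      ultimately show False using that by simp
    qed
    ultimately show ?thesis by simp
  qed
  define S :: "'p mod_ring set" where "S = (\<lambda>t. t ^ 2) ` (UNIV - {0})"
  define R :: "'p mod_ring set" where "R = {c. c ^ h = 1}"
  have SR: "S \<subseteq> R"
  proof
    fix c assume "c \<in> S"
    then obtain t where "t \<noteq> 0" "c = t ^ 2" by (auto simp: S_def)
    then have "c ^ h = t ^ (CARD('p) - 1)" by (simp add: p3 flip: power_mult)
    then show "c \<in> R" using mod_ring_power_card_minus_1 \<open>t \<noteq> 0\<close> by (auto simp: R_def)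
  qed
  have "card (UNIV - {0 :: 'p mod_ring}) = (\<Sum>c\<in>S. card {t \<in> UNIV - {0}. t ^ 2 = c})"
    unfolding S_def card_eq_sum by (rule sum.image_gen) simp
  also have "\<dots> = (\<Sum>c\<in>S. 2)"
  proof (rule sum.cong[OF refl])
    fix c assume "c \<in> S"
    then obtain s where s: "s \<noteq> 0" "c = s ^ 2" by (auto simp: S_def)
    have "{t \<in> UNIV - {0}. t ^ 2 = c} = {t. t ^ 2 = c}"
      using s by auto
    moreover have "c \<noteq> 0" using s by simp
    ultimately show "card {t \<in> UNIV - {0}. t ^ 2 = c} = 2" using two[OF _ s(2)[symmetric]] by simp
  qed
  finally have cS: "card S = h" by (simp add: p3 card_Diff_singleton)
  have "R = {c. poly (monom 1 h - 1) c = 0}" by (auto simp: R_def poly_monom)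
  moreover have nz: "monom (1 :: 'p mod_ring) h - 1 \<noteq> 0"
    using hp by (auto simp: monom_eq_1_iff)
  moreover have "degree (monom (1 :: 'p mod_ring) h - 1) \<le> h"
    by (intro degree_diff_le) (auto simp: degree_monom_le)
  ultimately have "card R \<le> h" using card_poly_roots_bound[OF nz] by simp
  then have "S = R" using SR cS by (intro card_seteq) auto
  show ?thesis
  proof (cases "c = 0")
    case True
    then have "{t. t ^ 2 = c} = {0}" by auto
    then show ?thesis using True by simp
  next
    case False
    show ?thesis
    proof (cases "c \<in> R")
      case True
      then obtain s where "c = s ^ 2" using \<open>S = R\<close> by (auto simp: S_def)
      then show ?thesis using two[OF False, of s] True False by (auto simp: quad_char_def R_def h_def)
    next
      case nR: False
      then have "{t. t ^ 2 = c} = {}" using False \<open>S = R\<close> by (auto simp: S_def)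
      then show ?thesis using False nR by (auto simp: quad_char_def R_def h_def)
    qed
  qed
qed

lemma quad_char_eq_1_iff: "c \<noteq> 0 \<Longrightarrow> quad_char c = 1 \<longleftrightarrow> (\<exists>s. c = s ^ 2)"
  for c :: "'p mod_ring"
proof -
  assume "c \<noteq> 0"
  show ?thesis
  proof
    assume "quad_char c = 1"
    then have "card {t. t ^ 2 = c} \<noteq> 0" using card_square_roots[of c] by auto
    then show "\<exists>s. c = s ^ 2" by (metis (mono_tags, lifting) card.empty empty_Collect_eq)
  next
    assume "\<exists>s. c = s ^ 2"
    then obtain s where "c = s ^ 2" by blast
    then show "quad_char c = 1" using \<open>c \<noteq> 0\<close> quad_char_square[of s] by (auto simp: power2_eq_square quad_char_mult)
  qed
qed

lemma sum_quad_char: "(\<Sum>c\<in>UNIV. quad_char (c :: 'p mod_ring)) = 0"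
proof -
  have "(\<Sum>c\<in>UNIV. real (card {t :: 'p mod_ring. t ^ 2 = c})) = real CARD('p mod_ring)"
  proof -
    have "(\<Sum>c\<in>UNIV. card {t :: 'p mod_ring. t ^ 2 = c}) = card (\<Union>c. {t :: 'p mod_ring. t ^ 2 = c})"
      by (rule card_UN_disjoint[symmetric]) auto
    moreover have "(\<Union>c. {t :: 'p mod_ring. t ^ 2 = c}) = UNIV" by auto
    ultimately show ?thesis by (metis of_nat_sum)
  qed
  then show ?thesis by (simp add: card_square_roots sum.distrib)
qed

lemma ex_nonsquare: "\<exists>c :: 'p mod_ring. quad_char c = -1"
proof (rule ccontr)
  assume "\<not> ?thesis"
  then have "quad_char c = (if c = 0 then 0 else 1)" for c :: "'p mod_ring"
    using quad_char_cases by auto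
  then have "(\<Sum>c\<in>UNIV. quad_char (c :: 'p mod_ring)) = real (card (UNIV - {0 :: 'p mod_ring}))"
    by (simp add: sum.If_cases Compl_eq_Diff_UNIV)
  moreover have "card (UNIV - {0 :: 'p mod_ring}) > 0"
    by (metis card_gt_0_iff finite DiffI UNIV_I empty_iff singletonD zero_neq_one)
  ultimately show False by (simp add: sum_quad_char)
qed

definition gauss_sum :: complex where
  "gauss_sum = (\<Sum>c\<in>UNIV. of_real (quad_char c) * add_char (c :: 'p mod_ring))"

lemma gauss_sum_mult:
  "(\<Sum>c\<in>UNIV. of_real (quad_char c) * add_char (c * a)) = of_real (quad_char a) * gauss_sum"
  for a :: "'p mod_ring"
proof (cases "a = 0")
  case True
  then show ?thesis using sum_quad_char by (simp flip: of_real_sum)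
next
  case False
  have "quad_char a * quad_char (a * c) = quad_char c" for c
    using quad_char_square[OF False] by (simp add: quad_char_mult power2_eq_square flip: mult.assoc)
  then have "(\<Sum>c\<in>UNIV. of_real (quad_char c) * add_char (c * a))
    = of_real (quad_char a) * (\<Sum>c\<in>UNIV. of_real (quad_char (a * c)) * add_char (a * c))"
    by (simp add: sum_distrib_left mult.commute flip: of_real_mult mult.assoc)
  also have "\<dots> = of_real (quad_char a) * gauss_sum"
    unfolding gauss_sum_def
    using sum_UNIV_mult[OF False, of "\<lambda>c. of_real (quad_char c) * add_char c"] by simp
  finally show ?thesis .
qed

text \<open>Grouping t by the value c of its square gives multiplicity 1 +
  \<open>quad_char c\<close>; the constant part cancels by orthogonality and the rest is a Gauss
  sum.\<close>

lemma sum_add_char_squares: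
  assumes "a \<noteq> (0 :: 'p mod_ring)"
  shows "(\<Sum>t\<in>UNIV. add_char (a * t ^ 2)) = of_real (quad_char a) * gauss_sum"
proof -
  have "(\<Sum>t\<in>UNIV. add_char (a * t ^ 2)) = (\<Sum>c\<in>UNIV. \<Sum>t | t ^ 2 = c. add_char (a * t ^ 2))"
    by (subst sum.group[where T = UNIV and g = "\<lambda>t. t ^ 2", symmetric]) auto
  also have "\<dots> = (\<Sum>c\<in>UNIV. of_real (1 + quad_char c) * add_char (a * c))"
  proof (rule sum.cong[OF refl])
    fix c :: "'p mod_ring"
    have "(\<Sum>t | t ^ 2 = c. add_char (a * t ^ 2)) = of_real (real (card {t. t ^ 2 = c})) * add_char (a * c)"
      by simp
    then show "(\<Sum>t | t ^ 2 = c. add_char (a * t ^ 2)) = of_real (1 + quad_char c) * add_char (a * c)"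
      by (simp only: card_square_roots)
  qed
  also have "\<dots> = (\<Sum>c\<in>UNIV. add_char (c * a)) + (\<Sum>c\<in>UNIV. of_real (quad_char c) * add_char (c * a))"
    by (simp add: ring_distribs sum.distrib mult.commute)
  also have "\<dots> = of_real (quad_char a) * gauss_sum"
    using assms by (simp add: sum_add_char_mult gauss_sum_mult)
  finally show ?thesis .
qed

text \<open>Conjugation replaces the argument c by -c. The same factor appears when exponential sums
  of odd rank are conjugated, which is why their product with the Gauss sum is real.\<close>

lemma cnj_gauss_sum: "cnj gauss_sum = of_real (quad_char (-1 :: 'p mod_ring)) * gauss_sum"
proof -
  have "cnj gauss_sum = (\<Sum>c\<in>UNIV. of_real (quad_char c) * add_char (c * (-1) :: 'p mod_ring))"
    by (simp add: gauss_sum_def add_char_uminus)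
  then show ?thesis by (simp only: gauss_sum_mult)
qed

text \<open>\<open>gauss_sum_mult\<close> is read backwards to absorb \<open>quad_char a\<close>
  into the inner sum; orthogonality in a then leaves only c = 1.\<close>

lemma gauss_sum_norm: "gauss_sum * cnj gauss_sum = of_nat CARD('p)"
proof -
  have "gauss_sum * cnj gauss_sum = (\<Sum>a\<in>UNIV. of_real (quad_char a) * gauss_sum * add_char (- a :: 'p mod_ring))"
    by (simp add: gauss_sum_def[THEN arg_cong[where f = cnj]] sum_distrib_left add_char_uminus mult_ac)
  also have "\<dots> = (\<Sum>a\<in>UNIV. \<Sum>c\<in>UNIV. of_real (quad_char c) * add_char (a * (c - 1) :: 'p mod_ring))"
    by (simp add: gauss_sum_mult[symmetric] sum_distrib_right right_diff_distrib add_char_add[symmetric] mult.assoc mult.commute[of "a :: 'p mod_ring" for a])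
  also have "\<dots> = (\<Sum>c\<in>UNIV. of_real (quad_char c) * (\<Sum>a\<in>UNIV. add_char (a * (c - 1) :: 'p mod_ring)))"
    by (subst sum.swap) (simp add: sum_distrib_left)
  also have "\<dots> = (\<Sum>c\<in>UNIV. if c = (1 :: 'p mod_ring) then of_nat CARD('p) else 0)"
    by (intro sum.cong) (auto simp: sum_add_char_mult)
  finally show ?thesis by simp
qed

lemma cmod_gauss_sum: "(cmod gauss_sum)\<^sup>2 = real CARD('p)"
  using gauss_sum_norm by (metis complex_norm_square of_real_eq_iff of_real_of_nat_eq of_real_power)

end

subsection \<open>Extensions of prime fields and the trace\<close>

locale prime_field_ext = odd_prime_card P for P :: "'p::prime_card itself" +
  fixes F :: "'a::{field,finite} itself" and m :: nat
  assumes card_F: "CARD('a) = CARD('p) ^ m" and m_pos: "m > 0"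
begin

abbreviation emb :: "'p mod_ring \<Rightarrow> 'a" where "emb \<equiv> prime_embed"

lemma prime_p: "prime CARD('p)" by (rule prime_card)

lemma p_gt_1: "CARD('p) > 1" using prime_p prime_gt_1_nat by blast

lemma CHAR_F: "CHAR('a) = CARD('p)"
proof -
  have "CHAR('a) > 0" by (rule finite_imp_CHAR_pos) simp
  then have "prime CHAR('a)" by (rule prime_CHAR_semidom)
  moreover have "CHAR('a) dvd CARD('p) ^ m" using CHAR_dvd_CARD[where 'a = 'a] card_F by simp
  ultimately show ?thesis using prime_p by (meson prime_dvd_power primes_dvd_imp_eq)
qed

lemma of_int_mod_p: "of_int (x mod int CARD('p)) = (of_int x :: 'a)"
  using of_int_mod_CHAR[of x, where 'a = 'a] by (simp add: CHAR_F)

lemma emb_add: "emb (a + b) = emb a + emb b"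
  by (simp add: prime_embed_def to_int_mod_ring_add of_int_mod_p)

lemma emb_mult: "emb (a * b) = emb a * emb b"
  by (simp add: prime_embed_def to_int_mod_ring_mult of_int_mod_p)

lemma emb_0 [simp]: "emb 0 = 0"
  by (simp add: prime_embed_def)

lemma emb_1 [simp]: "emb 1 = 1"
  by (simp add: prime_embed_def)

lemma emb_uminus: "emb (- a) = - emb a"
  using emb_add[of a "-a"] by (simp add: eq_neg_iff_add_eq_0 add.commute)

lemma emb_diff: "emb (a - b) = emb a - emb b"
  using emb_add[of a "-b"] by (simp add: emb_uminus)

lemma emb_power: "emb (a ^ n) = emb a ^ n"
  by (induction n) (simp_all add: emb_mult)

lemma emb_eq_0_iff [simp]: "emb a = 0 \<longleftrightarrow> a = 0"
proof
  assume "emb a = 0"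
  show "a = 0"
  proof (rule ccontr)
    assume "a \<noteq> 0"
    then have "emb (a * inverse a) = 1" by simp
    then show False using \<open>emb a = 0\<close> by (simp add: emb_mult del: right_inverse)
  qed
qed simp

lemma inj_emb: "inj emb"
proof (rule injI)
  fix a b assume "emb a = emb b"
  then have "emb (a - b) = 0" by (simp add: emb_diff)
  then show "a = b" by simp
qed

lemma emb_eq_iff [simp]: "emb a = emb b \<longleftrightarrow> a = b"
  using inj_emb by (auto dest: injD)

definition frob :: "nat \<Rightarrow> 'a \<Rightarrow> 'a" where
  "frob i x = x ^ (CARD('p) ^ i)"

lemma frob_add: "frob i (x + y) = frob i x + frob i y"
  unfolding frob_def by (rule freshmans_dream') (simp_all add: CHAR_F prime_p)

lemma frob_sum: "frob i (sum f A) = (\<Sum>x\<in>A. frob i (f x))"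
  unfolding frob_def by (rule freshmans_dream_sum') (simp_all add: CHAR_F prime_p)

lemma frob_mult: "frob i (x * y) = frob i x * frob i y"
  by (simp add: frob_def power_mult_distrib)

lemma frob_0 [simp]: "frob i 0 = 0"
  using p_gt_1 by (simp add: frob_def)

lemma frob_1 [simp]: "frob i 1 = 1"
  by (simp add: frob_def)

lemma frob_uminus: "frob i (- x) = - frob i x"
  using frob_add[of i x "-x"] by (simp add: eq_neg_iff_add_eq_0 add.commute)

lemma frob_diff: "frob i (x - y) = frob i x - frob i y"
  using frob_add[of i x "-y"] by (simp add: frob_uminus)

lemma frob_divide: "frob i (x / y) = frob i x / frob i y"
  by (simp add: frob_def power_divide)

lemma frob_power: "frob i (x ^ n) = frob i x ^ n"
  by (simp add: frob_def mult.commute flip: power_mult)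

lemma frob_eq_0_iff [simp]: "frob i x = 0 \<longleftrightarrow> x = 0"
  using p_gt_1 by (simp add: frob_def)

lemma frob_frob: "frob i (frob j x) = frob (i + j) x"
  by (simp add: frob_def power_add mult.commute flip: power_mult)

lemma frob_zero [simp]: "frob 0 x = x"
  by (simp add: frob_def)

lemma frob_m [simp]: "frob m x = x"
proof (cases "x = 0")
  case False
  have "(\<Prod>y\<in>UNIV-{0}. x * y) = x ^ (CARD('a) - 1) * \<Prod>(UNIV-{0})"
    by (simp add: prod.distrib card_Diff_singleton)
  also have "(\<Prod>y\<in>UNIV-{0}. x * y) = (\<Prod>y\<in>UNIV-{0}. y)"
    by (rule prod.reindex_bij_witness[of _ "\<lambda>y. y / x" "\<lambda>y. x * y"]) (use False in auto)
  finally have "x ^ (CARD('a) - 1) = 1" by simp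
  then have "x ^ CARD('a) = x"
    using power_minus_mult[of "CARD('a)" x] by simp
  then show ?thesis by (simp add: frob_def card_F)
qed simp

lemma frob_mult_m: "frob (n * m) x = x"
  by (induction n) (simp_all add: frob_frob[symmetric])

lemma frob_emb [simp]: "frob i (emb c) = emb c"
proof -
  have "c ^ (CARD('p) ^ i) = c"
    by (induction i) (simp_all add: power_mult mod_ring_power_card)
  then show ?thesis by (simp add: frob_def flip: emb_power)
qed

text \<open>The fixed points are roots of X^p - X, hence at most p in number, and the p embedded
  elements are among them.\<close>

lemma range_emb: "range emb = {x. frob 1 x = x}"
proof (rule card_seteq)
  let ?f = "monom 1 CARD('p) - monom (1 :: 'a) 1"
  have nz: "?f \<noteq> 0"
    using p_gt_1 by (auto dest: arg_cong[where f = degree] simp: degree_monom_eq)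
  have "{x. frob 1 x = x} = {x. poly ?f x = 0}" by (simp add: frob_def poly_monom)
  then have "card {x. frob 1 x = x} \<le> degree ?f"
    using card_poly_roots_bound[OF nz] by simp
  also have "\<dots> \<le> CARD('p)"
    by (intro degree_diff_le) (use p_gt_1 in \<open>auto simp: degree_monom_eq\<close>)
  also have "\<dots> = card (range emb)" using inj_emb by (simp add: card_image)
  finally show "card {x. frob 1 x = x} \<le> card (range emb)" .
qed (auto simp: image_iff)

text \<open>By Bezout n a = m b + 1. The power a n of Frobenius fixes x and the power b m is
  trivial, so Frobenius itself fixes x. The case n = 0 forces m = 1.\<close>

lemma frob_fixed:
  assumes "coprime m n" "frob n x = x" shows "x \<in> range emb"
proof (cases "n = 0")
  case True
  then have "m = 1" using assms by simp
  with frob_m[of x] have "frob 1 x = x" by metis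
  then show ?thesis unfolding range_emb by simp
next
  case False
  have "gcd n m = 1" using assms(1) by (simp add: coprime_commute)
  with bezout_nat[OF False, of m] obtain a b where ab: "n * a = m * b + 1" by metis
  have "frob (a * n) x = x"
    using assms(2) by (induction a) (simp_all only: mult_Suc mult_0 frob_frob[symmetric] frob_zero)
  moreover have "frob (a * n) x = frob 1 (frob (b * m) x)"
    using ab by (simp only: frob_frob) (simp add: mult.commute)
  ultimately have "frob 1 x = x" by (simp only: frob_mult_m)
  then show ?thesis unfolding range_emb by simp
qed

definition tr :: "'a \<Rightarrow> 'p mod_ring" where
  "tr x = (THE c. emb c = (\<Sum>i<m. frob i x))"

text \<open>The sum of conjugates lives in the extension, but Frobenius permutes its terms
  cyclically, so it comes from a unique prime field element. This justifies the definite description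
  in \<open>tr\<close>.\<close>

lemma emb_tr: "emb (tr x) = (\<Sum>i<m. frob i x)"
proof -
  have "frob 1 (\<Sum>i<m. frob i x) = (\<Sum>i<m. frob (Suc i) x)"
    by (simp add: frob_sum frob_frob)
  also have "\<dots> = (\<Sum>i<m. frob i x)"
    using sum.lessThan_Suc_shift[of "\<lambda>i. frob i x" m] by simp
  finally obtain c where "emb c = (\<Sum>i<m. frob i x)"
    using range_emb by (metis (mono_tags, lifting) mem_Collect_eq rangeE)
  then show ?thesis unfolding tr_def by (rule theI) (metis emb_eq_iff \<open>emb c = _\<close>)
qed

lemma tr_add: "tr (x + y) = tr x + tr y"
  by (subst emb_eq_iff[symmetric]) (simp only: emb_add emb_tr frob_add sum.distrib)

lemma tr_0 [simp]: "tr 0 = 0"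
  by (subst emb_eq_iff[symmetric]) (simp only: emb_tr frob_0 emb_0 sum.neutral_const)

lemma tr_uminus: "tr (- x) = - tr x"
  using tr_add[of x "-x"] by (simp add: eq_neg_iff_add_eq_0 add.commute)

lemma tr_diff: "tr (x - y) = tr x - tr y"
  using tr_add[of x "-y"] by (simp add: tr_uminus)

lemma tr_emb_mult: "tr (emb c * x) = c * tr x"
  by (subst emb_eq_iff[symmetric]) (simp only: emb_mult emb_tr frob_mult frob_emb sum_distrib_left)

lemma tr_frob: "tr (frob i x) = tr x"
proof (induction i)
  case (Suc i)
  have "tr (frob 1 y) = tr y" for y
  proof -
    have "(\<Sum>i<m. frob (Suc i) y) = (\<Sum>i<m. frob i y)"
      using sum.lessThan_Suc_shift[of "\<lambda>i. frob i y" m] by simp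
    then show ?thesis by (subst emb_eq_iff[symmetric]) (simp add: emb_tr frob_frob)
  qed
  from this[of "frob i x"] Suc show ?case by (simp add: frob_frob)
qed simp

text \<open>The trace is given by a polynomial of degree at most p^(m-1), nonzero because its
  coefficient at X is 1; it cannot vanish at all p^m points.\<close>

lemma ex_tr_nonzero: "\<exists>x. tr x \<noteq> 0"
proof (rule ccontr)
  assume "\<not> ?thesis"
  then have z: "tr x = 0" for x by simp
  let ?f = "(\<Sum>i<m. monom (1::'a) (CARD('p) ^ i))"
  have "coeff ?f 1 = (\<Sum>i<m. if i = 0 then 1 else 0)"
    unfolding coeff_sum using p_gt_1 by (intro sum.cong) auto
  also have "\<dots> = 1" using m_pos by simp
  finally have nz: "?f \<noteq> 0" by auto
  have "degree ?f \<le> CARD('p) ^ (m - 1)"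
  proof (rule degree_sum_le)
    fix i assume "i \<in> {..<m}"
    then have "CARD('p) ^ i \<le> CARD('p) ^ (m - 1)" using p_gt_1 by (intro power_increasing) auto
    then show "degree (monom (1::'a) (CARD('p) ^ i)) \<le> CARD('p) ^ (m - 1)"
      by (simp add: degree_monom_eq)
  qed simp
  moreover have "{x. poly ?f x = 0} = UNIV"
    using z emb_tr by (auto simp: poly_sum poly_monom frob_def simp flip: emb_tr)
  ultimately have "CARD('a) \<le> CARD('p) ^ (m - 1)"
    using card_poly_roots_bound[OF nz] by simp
  then have "m \<le> m - 1" unfolding card_F using p_gt_1 by simp
  then show False using m_pos by simp
qed

lemma tr_nondegenerate: "(\<And>x. tr (a * x) = 0) \<Longrightarrow> a = 0"
  by (metis ex_tr_nonzero nonzero_mult_div_cancel_left times_divide_eq_right)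

lemma sum_add_char_tr:
  assumes "c \<noteq> 0"
  shows "(\<Sum>x\<in>UNIV. add_char (c * tr (a * x))) = (if a = 0 then of_nat CARD('a) else 0)"
proof (cases "a = 0")
  case False
  then obtain x where x: "tr (a * x) \<noteq> 0" using tr_nondegenerate by blast
  \<comment> \<open>Scaled so that \<open>c * tr (a * y)\<close> is 1, where \<open>add_char\<close>
    is known to be nontrivial.\<close>
  define y where "y = emb (inverse (c * tr (a * x))) * x"
  have "c * tr (a * y) = c * tr (emb (inverse (c * tr (a * x))) * (a * x))"
    unfolding y_def by (simp add: mult_ac)
  then have "c * tr (a * y) = 1" using x assms by (simp add: tr_emb_mult mult.assoc)
  then have "(\<Sum>x\<in>UNIV. add_char (c * tr (a * x))) = 0"
    by (intro sum_character_eq_0[where a = y])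
       (simp_all add: distrib_left tr_add add_char_add add_char_1_neq_1)
  then show ?thesis using False by simp
qed simp

end

subsection \<open>Exponential sums of quadratic forms\<close>

lemma card_eq_sum_of_bool: "of_nat (card {x. R x}) = (\<Sum>x\<in>UNIV. of_bool (R x))"
  for R :: "'g::finite \<Rightarrow> bool"
  by (simp add: of_bool_def sum.If_cases)

lemma real_square_root_cases:
  assumes "cnj z = z" "(cmod z)\<^sup>2 = v\<^sup>2"
  obtains s :: real where "s = 1 \<or> s = -1" "z = of_real (s * v)"
proof -
  obtain x where x: "z = of_real x" using assms(1) by (metis Reals_cnj_iff Reals_cases)
  then have "x ^ 2 = v ^ 2" using assms(2) by simp
  then have "x = v \<or> x = - v" by (simp add: power2_eq_iff)
  then show ?thesis using that[of 1] that[of "-1"] x by auto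
qed

text \<open>\<open>L\<close> represents the polar form of \<open>Q\<close> through the trace
  pairing, B(x, y) = \<open>tr (x * L y)\<close>. Its kernel is therefore the radical of
  \<open>Q\<close>.\<close>

locale quad_form = prime_field_ext P F m
  for P :: "'p::prime_card itself" and F :: "'a::{field,finite} itself" and m +
  fixes Q :: "'a \<Rightarrow> 'p mod_ring" and L :: "'a \<Rightarrow> 'a"
  assumes Q_add: "Q (x + y) = Q x + Q y + tr (x * L y)"
    and Q_scale: "Q (emb c * x) = c ^ 2 * Q x"
    and L_add: "L (x + y) = L x + L y"
begin

lemma two_nonzero: "(2 :: 'p mod_ring) \<noteq> 0"
  using mod_ring_neg_1_neq_1 by (metis add.inverse_unique one_add_one)

lemma Q_0 [simp]: "Q 0 = 0"
  using Q_scale[of 0 0] by simp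

lemma L_0 [simp]: "L 0 = 0"
  using L_add[of 0 0] by (metis add_cancel_right_right)

lemma L_diff: "L (x - y) = L x - L y"
  using L_add[of "x - y" y] by (simp add: algebra_simps)

lemma form_sym: "tr (x * L y) = tr (y * L x)"
  using Q_add[of x y] Q_add[of y x] by (simp add: add.commute)

lemma form_diag: "tr (x * L x) = 2 * Q x"
proof -
  have "emb (1 + 1) * x = x + x" by (simp only: emb_add emb_1) (simp add: algebra_simps)
  then have "Q (x + x) = (1 + 1) ^ 2 * Q x" by (metis Q_scale)
  then show ?thesis using Q_add[of x x] by (simp add: power2_eq_square algebra_simps)
qed

lemma Q_eq_0_of_L: "L u = 0 \<Longrightarrow> Q u = 0"
  using form_diag[of u] two_nonzero by simp

text \<open>Diagonalization in disguise: split off a vector \<open>w\<close> with \<open>Q w \<noteq> 0\<close>; the sum over \<open>W\<close> is then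
  a Gauss sum times the sum over the orthogonal complement of \<open>w\<close> in \<open>W\<close>.\<close>

lemma subspace_sum:
  assumes "0 \<in> W" and "\<And>x y. x \<in> W \<Longrightarrow> y \<in> W \<Longrightarrow> x + y \<in> W"
    and "\<And>c x. x \<in> W \<Longrightarrow> emb c * x \<in> W"
  shows "\<exists>r. real CARD('p) ^ r * (cmod (\<Sum>x\<in>W. add_char (Q x)))\<^sup>2 = real (card W) ^ 2 \<and>
    (\<forall>l. l \<noteq> 0 \<longrightarrow> (\<Sum>x\<in>W. add_char (l * Q x)) = of_real (quad_char l) ^ r * (\<Sum>x\<in>W. add_char (Q x)))"
  using assms
proof (induction "card W" arbitrary: W rule: less_induct)
  case (less W)
  show ?case
  proof (cases "\<forall>x\<in>W. Q x = 0")
    \<comment> \<open>A totally singular \<open>W\<close> contributes rank 0: every summand is 1.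
      Each vector split off below raises \<open>r\<close> by one, so \<open>r\<close> ends up as the
      rank.\<close>
    case True
    then show ?thesis by (intro exI[of _ 0]) simp
  next
    case False
    then obtain w where w: "w \<in> W" "Q w \<noteq> 0" by blast
    define W' where "W' = {x \<in> W. tr (x * L w) = 0}"
    define f where "f = (\<lambda>(t, x). emb t * w + x)"
    have fst_f: "tr (f (t, x) * L w) = t * (2 * Q w)" if "x \<in> W'" for t x
      using that by (simp add: f_def W'_def distrib_right tr_add mult.assoc tr_emb_mult form_diag)
    have bij: "bij_betw f (UNIV \<times> W') W"
      unfolding bij_betw_def
    proof (intro conjI inj_onI equalityI subsetI)
      fix a b assume a: "a \<in> UNIV \<times> W'" and b: "b \<in> UNIV \<times> W'" and eq: "f a = f b"
      obtain t x u y where ab: "a = (t, x)" "b = (u, y)" by fastforce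
      then have "x \<in> W'" "y \<in> W'" using a b by auto
      then have "t * (2 * Q w) = u * (2 * Q w)" using fst_f eq ab by metis
      moreover have "2 * Q w \<noteq> 0" using w two_nonzero by (metis mult_eq_0_iff)
      ultimately have "t = u" by (metis mult_right_cancel)
      then show "a = b" using eq ab by (simp add: f_def)
    next
      fix y assume "y \<in> f ` (UNIV \<times> W')"
      then show "y \<in> W" using less.prems w by (auto simp: f_def W'_def)
    next
      fix y assume y: "y \<in> W"
      define t where "t = tr (y * L w) / (2 * Q w)"
      have "y + emb (- t) * w \<in> W" using y w less.prems by blast
      moreover have "tr ((y + emb (- t) * w) * L w) = 0"
        using w two_nonzero by (simp add: distrib_right tr_add mult.assoc tr_emb_mult form_diag t_def)
      ultimately have "y + emb (- t) * w \<in> W'" by (simp add: W'_def)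
      moreover have "y = f (t, y + emb (- t) * w)" by (simp add: f_def emb_uminus)
      ultimately show "y \<in> f ` (UNIV \<times> W')" by blast
    qed
    have Qf: "Q (f (t, x)) = Q w * t ^ 2 + Q x" if "x \<in> W'" for t x
    proof -
      have "tr (emb t * w * L x) = t * tr (x * L w)" by (simp add: mult.assoc tr_emb_mult form_sym[of w x])
      then show ?thesis using that by (simp add: f_def Q_add Q_scale W'_def mult.commute[of "Q w"])
    qed
    have split: "(\<Sum>x\<in>W. add_char (l * Q x)) = of_real (quad_char (l * Q w)) * gauss_sum * (\<Sum>x\<in>W'. add_char (l * Q x))"
      if "l \<noteq> 0" for l
    proof -
      have "(\<Sum>x\<in>W. add_char (l * Q x)) = (\<Sum>z\<in>UNIV \<times> W'. add_char (l * Q (f z)))"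
        by (rule sum.reindex_bij_betw[OF bij, symmetric])
      also have "\<dots> = (\<Sum>t\<in>UNIV. \<Sum>x\<in>W'. add_char (l * Q (f (t, x))))"
        by (simp add: sum.cartesian_product)
      also have "\<dots> = (\<Sum>t\<in>UNIV. \<Sum>x\<in>W'. add_char (l * Q w * t ^ 2) * add_char (l * Q x))"
        by (intro sum.cong refl) (simp add: Qf distrib_left add_char_add mult.assoc)
      also have "\<dots> = (\<Sum>t\<in>UNIV. add_char (l * Q w * t ^ 2)) * (\<Sum>x\<in>W'. add_char (l * Q x))"
        by (rule sum_product[symmetric])
      also have "(\<Sum>t\<in>UNIV. add_char (l * Q w * t ^ 2)) = of_real (quad_char (l * Q w)) * gauss_sum"
        by (rule sum_add_char_squares) (use that w in simp)
      finally show ?thesis .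
    qed
    have cW: "card W = CARD('p) * card W'"
      using bij_betw_same_card[OF bij] by (simp add: card_cartesian_product)
    have W'0: "0 \<in> W'" using less.prems by (simp add: W'_def)
    then have "card W' > 0" by (auto simp: card_gt_0_iff)
    then have "card W' < card W" using cW p_gt_1 by simp
    moreover have "x + y \<in> W'" if "x \<in> W'" "y \<in> W'" for x y
      using that less.prems by (simp add: W'_def distrib_right tr_add)
    moreover have "emb c * x \<in> W'" if "x \<in> W'" for x c
      using that less.prems by (simp add: W'_def mult.assoc tr_emb_mult)
    ultimately obtain r where
      r1: "real CARD('p) ^ r * (cmod (\<Sum>x\<in>W'. add_char (Q x)))\<^sup>2 = real (card W') ^ 2" and
      r2: "\<And>l. l \<noteq> 0 \<Longrightarrow> (\<Sum>x\<in>W'. add_char (l * Q x)) = of_real (quad_char l) ^ r * (\<Sum>x\<in>W'. add_char (Q x))"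
      using less.hyps[of W'] W'0 by blast
    have one: "(\<Sum>x\<in>W. add_char (Q x)) = of_real (quad_char (Q w)) * gauss_sum * (\<Sum>x\<in>W'. add_char (Q x))"
      using split[of 1] by simp
    have cq: "\<bar>quad_char (Q w)\<bar> = 1" using quad_char_cases[OF w(2)] by auto
    have "real CARD('p) ^ Suc r * (cmod (\<Sum>x\<in>W. add_char (Q x)))\<^sup>2 =
        real CARD('p) * (cmod gauss_sum)\<^sup>2 * (real CARD('p) ^ r * (cmod (\<Sum>x\<in>W'. add_char (Q x)))\<^sup>2)"
      unfolding one norm_mult by (simp add: power_mult_distrib cq)
    also have "\<dots> = real (card W) ^ 2"
      unfolding r1 cmod_gauss_sum cW by (simp add: power2_eq_square)
    finally have "real CARD('p) ^ Suc r * (cmod (\<Sum>x\<in>W. add_char (Q x)))\<^sup>2 = real (card W) ^ 2" .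
    moreover have "(\<Sum>x\<in>W. add_char (l * Q x)) = of_real (quad_char l) ^ Suc r * (\<Sum>x\<in>W. add_char (Q x))"
      if "l \<noteq> 0" for l
      using that by (simp add: split r2 one quad_char_mult)
    ultimately show ?thesis by blast
  qed
qed

definition ker :: "'a set" where "ker = {u. L u = 0}"

text \<open>The multiplier \<open>l\<close> acts on the linear term too, so that summing over all
  \<open>l\<close> detects the zeros of \<open>Q x + tr (d * x)\<close>.\<close>

definition esum :: "'p mod_ring \<Rightarrow> 'a \<Rightarrow> complex" where
  "esum l d = (\<Sum>x\<in>UNIV. add_char (l * (Q x + tr (d * x))))"

text \<open>After the shift x = u + y the exponent is linear in y, with coefficient proportional to
  \<open>L u\<close>. Summation over y kills every u outside the radical, and on the radical
  \<open>Q\<close> vanishes.\<close>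

lemma esum_norm:
  assumes "l \<noteq> 0"
  shows "esum l d * cnj (esum l d) = of_nat CARD('a) * (\<Sum>u\<in>ker. add_char (l * tr (d * u)))"
proof -
  define q where "q x = l * (Q x + tr (d * x))" for x
  have step: "q (u + y) - q y = q u + l * tr (L u * y)" for u y
    using form_sym[of u y] by (simp add: q_def Q_add tr_add algebra_simps)
  have "esum l d * cnj (esum l d) = (\<Sum>y\<in>UNIV. \<Sum>x\<in>UNIV. add_char (q x - q y))"
    by (simp add: esum_def q_def[symmetric] sum_product add_char_uminus add_char_add diff_conv_add_uminus
        del: add_uminus_conv_diff) (rule sum.swap)
  also have "\<dots> = (\<Sum>y\<in>UNIV. \<Sum>u\<in>UNIV. add_char (q (u + y) - q y))"
    by (rule sum.cong[OF refl], rule sum_UNIV_shift[symmetric])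
  also have "\<dots> = (\<Sum>u\<in>UNIV. \<Sum>y\<in>UNIV. add_char (q u) * add_char (l * tr (L u * y)))"
    by (subst sum.swap) (simp add: step add_char_add)
  also have "\<dots> = (\<Sum>u\<in>UNIV. add_char (q u) * (if L u = 0 then of_nat CARD('a) else 0))"
    by (simp only: sum_distrib_left[symmetric] sum_add_char_tr[OF assms])
  also have "\<dots> = (\<Sum>u\<in>ker. add_char (q u) * of_nat CARD('a))"
    by (rule sum.mono_neutral_cong_right) (auto simp: ker_def)
  also have "\<dots> = (\<Sum>u\<in>ker. of_nat CARD('a) * add_char (l * tr (d * u)))"
    by (intro sum.cong) (auto simp: q_def ker_def Q_eq_0_of_L)
  finally show ?thesis by (simp add: sum_distrib_left)
qed

lemma cmod_esum_0:
  assumes "l \<noteq> 0" shows "(cmod (esum l 0))\<^sup>2 = real CARD('a) * real (card ker)"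
proof -
  have "complex_of_real ((cmod (esum l 0))\<^sup>2) = of_real (real CARD('a) * real (card ker))"
    using esum_norm[OF assms, of 0] unfolding complex_norm_square by simp
  then show ?thesis by (simp only: of_real_eq_iff)
qed

text \<open>Completing the square: for d = \<open>L y\<close> the linear term is absorbed by the
  translation of x by y.\<close>

lemma esum_range: "esum l (L y) = add_char (- (l * Q y)) * esum l 0"
proof -
  have "add_char (l * (Q x + tr (L y * x))) = add_char (- (l * Q y)) * add_char (l * Q (x + y))" for x
    unfolding add_char_add[symmetric] by (simp add: Q_add algebra_simps)
  then have "esum l (L y) = add_char (- (l * Q y)) * (\<Sum>x\<in>UNIV. add_char (l * Q (x + y)))"
    by (simp add: esum_def sum_distrib_left)
  also have "(\<Sum>x\<in>UNIV. add_char (l * Q (x + y))) = esum l 0"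
    unfolding esum_def using sum_UNIV_shift[of "\<lambda>x. add_char (l * Q x)" y] by simp
  finally show ?thesis .
qed

lemma card_fibre: "card {y. L y = L y0} = card ker"
  by (rule bij_betw_same_card[of "\<lambda>y. y - y0"], rule bij_betwI[where g = "\<lambda>y. y + y0"])
     (auto simp: ker_def L_diff L_add)

lemma sum_over_range: "(\<Sum>y\<in>UNIV. f (L y)) = of_nat (card ker) * (\<Sum>d\<in>range L. f d)"
  for f :: "'a \<Rightarrow> 'b::comm_semiring_1"
proof -
  have "(\<Sum>y\<in>UNIV. f (L y)) = (\<Sum>d\<in>range L. \<Sum>y | L y = d. f (L y))"
    using sum.image_gen[of UNIV "\<lambda>y. f (L y)" L] by simp
  also have "\<dots> = (\<Sum>d\<in>range L. of_nat (card ker) * f d)"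
    by (rule sum.cong) (auto simp: card_fibre)
  finally show ?thesis by (simp add: sum_distrib_left)
qed

lemma card_range_ker: "card ker * card (range L) = CARD('a)"
  using sum_over_range[of "\<lambda>_. 1 :: nat"] by simp

text \<open>A Parseval argument. The squared norms over all d add up to q^2. On
  \<open>range L\<close> each is q |ker|, and there are q / |ker| such d, so this already exhausts
  the total.\<close>

lemma esum_not_range:
  assumes "l \<noteq> 0" "d \<notin> range L" shows "esum l d = 0"
proof -
  have "complex_of_real (\<Sum>d\<in>UNIV. (cmod (esum l d))\<^sup>2)
      = (\<Sum>d\<in>UNIV. of_nat CARD('a) * (\<Sum>u\<in>ker. add_char (l * tr (u * d))))"
    by (simp only: of_real_sum complex_norm_square esum_norm[OF assms(1)] mult.commute[of _ "_ :: 'a"])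
  also have "\<dots> = of_nat CARD('a) * (\<Sum>u\<in>ker. \<Sum>d\<in>UNIV. add_char (l * tr (u * d)))"
    by (simp only: sum_distrib_left[symmetric], subst sum.swap) simp
  also have "\<dots> = of_nat CARD('a) * (\<Sum>u\<in>ker. if u = 0 then of_nat CARD('a) else 0)"
    by (simp only: sum_add_char_tr[OF assms(1)])
  also have "\<dots> = of_real (real CARD('a) ^ 2)" by (simp add: ker_def power2_eq_square)
  finally have tot: "(\<Sum>d\<in>UNIV. (cmod (esum l d))\<^sup>2) = real CARD('a) ^ 2"
    by (simp only: of_real_eq_iff)
  have "(\<Sum>d\<in>range L. (cmod (esum l d))\<^sup>2) = (\<Sum>d\<in>range L. real CARD('a) * real (card ker))"
    by (intro sum.cong) (auto simp: esum_range norm_mult cmod_esum_0[OF assms(1)])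
  also have "\<dots> = real CARD('a) * real (card ker * card (range L))" by simp
  finally have "(\<Sum>d\<in>range L. (cmod (esum l d))\<^sup>2) = real CARD('a) ^ 2"
    by (simp only: card_range_ker power2_eq_square)
  then have "(\<Sum>d\<in>UNIV - range L. (cmod (esum l d))\<^sup>2) = 0"
    using sum.subset_diff[of "range L" UNIV "\<lambda>d. (cmod (esum l d))\<^sup>2"] tot by simp
  then show ?thesis using assms(2) by (subst (asm) sum_nonneg_eq_0_iff) auto
qed

definition nullity :: nat where "nullity = (THE i. card ker = CARD('p) ^ i)"

text \<open>The exponent \<open>r\<close> supplied by \<open>subspace_sum\<close> for the whole
  space is the rank: comparing its norm identity with \<open>cmod_esum_0\<close> gives p^r |ker| =
  q. In particular |ker| is a power of p, as the definition of \<open>nullity\<close>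
  presupposes.\<close>

lemma nullity: "card ker = CARD('p) ^ nullity" "nullity \<le> m"
  and esum_twist: "l \<noteq> 0 \<Longrightarrow> esum l 0 = of_real (quad_char l) ^ (m - nullity) * esum 1 0"
proof -
  obtain r where
    r1: "real CARD('p) ^ r * (cmod (\<Sum>x\<in>UNIV. add_char (Q x)))\<^sup>2 = real CARD('a) ^ 2" and
    r2: "\<And>l. l \<noteq> 0 \<Longrightarrow> (\<Sum>x\<in>UNIV. add_char (l * Q x)) = of_real (quad_char l) ^ r * (\<Sum>x\<in>UNIV. add_char (Q x))"
    using subspace_sum[of UNIV] by auto
  have "real CARD('p) ^ r * real (card ker) = real CARD('a)"
    using r1 cmod_esum_0[of 1] by (simp add: esum_def power2_eq_square)
  then have pr: "CARD('p) ^ r * card ker = CARD('p) ^ m"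
    unfolding card_F by (metis of_nat_eq_iff of_nat_mult of_nat_power)
  have "card ker > 0" by (auto simp: card_gt_0_iff ker_def intro: exI[of _ 0])
  then have "CARD('p) ^ r \<le> CARD('p) ^ m" using pr by (metis One_nat_def Suc_leI mult_le_mono2 mult.right_neutral)
  then have rm: "r \<le> m" using p_gt_1 by simp
  then have "CARD('p) ^ m = CARD('p) ^ r * CARD('p) ^ (m - r)" by (simp flip: power_add)
  then have kr: "card ker = CARD('p) ^ (m - r)" using pr p_gt_1 by simp
  have n: "nullity = m - r"
    unfolding nullity_def by (rule the_equality) (use kr p_gt_1 in auto)
  then show "card ker = CARD('p) ^ nullity" "nullity \<le> m" using kr by auto
  show "esum l 0 = of_real (quad_char l) ^ (m - nullity) * esum 1 0" if "l \<noteq> 0"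
    using r2[OF that] n rm by (simp add: esum_def)
qed

text \<open>Deviation of the number of zeros from equidistribution, scaled by p. It determines the
  weight of a word through p * weight = (p - 1) q - excess.\<close>

definition excess :: "'a \<Rightarrow> real" where
  "excess d = real CARD('p) * real (card {x. Q x + tr (d * x) = 0}) - real CARD('a)"

lemma sum_esum:
  "(\<Sum>l\<in>UNIV. add_char (- (l * j)) * esum l d)
    = of_nat CARD('p) * of_nat (card {x. Q x + tr (d * x) = j})"
proof -
  have "(\<Sum>l\<in>UNIV. add_char (- (l * j)) * esum l d)
      = (\<Sum>x\<in>UNIV. \<Sum>l\<in>UNIV. add_char (l * (Q x + tr (d * x) - j)))"
    unfolding esum_def sum_distrib_left add_char_add[symmetric]
    by (subst sum.swap) (simp add: algebra_simps)
  also have "\<dots> = (\<Sum>x\<in>UNIV. of_nat CARD('p) * of_bool (Q x + tr (d * x) = j))"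
    unfolding sum_add_char_mult right_minus_eq
    by (rule sum.cong[OF refl]) (simp split: split_of_bool)
  finally show ?thesis by (simp only: sum_distrib_left[symmetric] card_eq_sum_of_bool)
qed

lemma esum_0 [simp]: "esum 0 d = of_nat CARD('a)"
  by (simp add: esum_def)

lemma excess_eq: "of_real (excess d) = (\<Sum>l\<in>UNIV - {0}. esum l d)"
proof -
  have "(\<Sum>l\<in>UNIV. esum l d) = esum 0 d + (\<Sum>l\<in>UNIV - {0}. esum l d)"
    by (rule sum.remove) auto
  then show ?thesis using sum_esum[of 0 d] by (simp add: excess_def) (metis add_diff_cancel_left')
qed

lemma card_level:
  "of_real (real CARD('p) * real (card {x. Q x = j}) - real CARD('a))
    = (\<Sum>l\<in>UNIV - {0}. add_char (- (l * j)) * esum l 0)"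
proof -
  have "(\<Sum>l\<in>UNIV. add_char (- (l * j)) * esum l 0)
      = esum 0 0 + (\<Sum>l\<in>UNIV - {0}. add_char (- (l * j)) * esum l 0)"
    by (subst sum.remove[of UNIV 0]) auto
  then show ?thesis using sum_esum[of j 0] by simp
qed

lemma sum_add_char_nonzero:
  "(\<Sum>l\<in>UNIV - {0}. add_char (- (l * j))) = (if j = 0 then of_nat CARD('p) - 1 else - 1)"
  for j :: "'p mod_ring"
proof -
  have "(\<Sum>l\<in>UNIV. add_char (- (l * j))) = 1 + (\<Sum>l\<in>UNIV - {0}. add_char (- (l * j)))"
    by (subst sum.remove[of UNIV 0]) auto
  moreover have "(\<Sum>l\<in>UNIV. add_char (- (l * j))) = (if j = 0 then of_nat CARD('p) else 0)"
    using sum_add_char_mult[of "-j"] by simp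
  ultimately show ?thesis by (auto simp: algebra_simps eq_neg_iff_add_eq_0)
qed

lemma cnj_esum_1: "cnj (esum 1 0) = esum (-1) 0"
  by (simp add: esum_def add_char_uminus)

text \<open>Outside \<open>range L\<close> the excess is 0, and every d in the range is
  \<open>L y\<close> for exactly |ker| values y. The count over d thus becomes a count over y, where
  the excess depends on \<open>Q y\<close> only. The additional term at v = 0 counts the d outside
  the range, times |ker|.\<close>

lemma excess_dist:
  "real (card ker) * real (card {d. excess d = v})
    = real (card {y. excess (L y) = v}) + of_bool (v = 0) * (real CARD('a) * real (card ker) - real CARD('a))"
proof -
  define A where "A = {d \<in> range L. excess d = v}"
  have "excess d = 0" if "d \<notin> range L" for d
    using excess_eq[of d] esum_not_range[OF _ that] by simp
  then have "{d. excess d = v} = A \<union> (if v = 0 then - range L else {})" by (auto simp: A_def)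
  then have "card {d. excess d = v} = card A + (if v = 0 then card (- range L) else 0)"
    by (simp only:) (subst card_Un_disjoint, auto simp: A_def)
  moreover have "real (card ker) * real (card (- range L)) = real CARD('a) * real (card ker) - real CARD('a)"
  proof -
    have "real (card (- range L)) = real CARD('a) - real (card (range L))"
      by (simp add: Compl_eq_Diff_UNIV card_Diff_subset of_nat_diff card_mono)
    moreover have "real (card ker) * real (card (range L)) = real CARD('a)"
      using card_range_ker by (metis of_nat_mult)
    ultimately show ?thesis by (simp add: right_diff_distrib)
  qed
  moreover have "real (card {y. excess (L y) = v}) = real (card ker) * real (card A)"
  proof -
    have "(\<Sum>d\<in>range L. of_bool (excess d = v)) = real (card A)"
      by (simp add: A_def of_bool_def sum.If_cases Int_def)
    then show ?thesis
      using sum_over_range[of "\<lambda>d. of_bool (excess d = v) :: real"]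
      by (simp only: card_eq_sum_of_bool)
  qed
  ultimately show ?thesis by (simp add: algebra_simps)
qed

text \<open>An even power of the character is 1, so all multipliers give the same sum. The
  multiplier -1 gives the conjugate, so the sum is real, and its norm fixes it up to sign.\<close>

lemma even_rank_esum:
  assumes "even (m - nullity)"
  obtains s :: real where "s = 1 \<or> s = -1"
    "\<And>l. l \<noteq> 0 \<Longrightarrow> esum l 0 = of_real (s * real CARD('p) ^ ((m + nullity) div 2))"
proof -
  have tw: "esum l 0 = esum 1 0" if "l \<noteq> 0" for l
  proof -
    obtain k where "m - nullity = 2 * k" using assms by (rule evenE)
    then have "quad_char l ^ (m - nullity) = 1" using quad_char_square[OF that] by (simp add: power_mult)
    then show ?thesis using esum_twist[OF that] by (simp flip: of_real_power)
  qed
  have "even (m + nullity)" using assms nullity(2) by auto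
  then have nrm: "(cmod (esum 1 0))\<^sup>2 = (real CARD('p) ^ ((m + nullity) div 2))\<^sup>2"
    unfolding cmod_esum_0[OF one_neq_zero] by (simp add: card_F nullity(1) power_add flip: power_mult)
  have "cnj (esum 1 0) = esum 1 0" using tw[of "-1"] cnj_esum_1 by simp
  from this nrm obtain s where "s = 1 \<or> s = -1" "esum 1 0 = of_real (s * real CARD('p) ^ ((m + nullity) div 2))"
    by (rule real_square_root_cases)
  then show ?thesis using that tw by metis
qed

text \<open>Here the sum need not be real. The Gauss sum acquires the same factor
  \<open>quad_char (-1)\<close> under conjugation, so the product is real; it also adds a factor p
  to the squared norm, whence the exponent (m + nullity + 1)/2.\<close>

lemma odd_rank_esum:
  assumes "odd (m - nullity)"
  obtains s :: real where "s = 1 \<or> s = -1"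
    "\<And>l. l \<noteq> 0 \<Longrightarrow> esum l 0 = of_real (quad_char l) * esum 1 0"
    "esum 1 0 * gauss_sum = of_real (s * real CARD('p) ^ ((m + nullity + 1) div 2))"
proof -
  have tw: "esum l 0 = of_real (quad_char l) * esum 1 0" if "l \<noteq> 0" for l
  proof -
    obtain k where "m - nullity = 2 * k + 1" using assms by (rule oddE)
    then have "quad_char l ^ (m - nullity) = quad_char l" using quad_char_square[OF that] by (simp add: power_mult)
    then show ?thesis using esum_twist[OF that] by (simp flip: of_real_power)
  qed
  have "odd (m + nullity)" using assms nullity(2) by auto
  then obtain k where "m + nullity = 2 * k + 1" by (rule oddE)
  then have "(m + nullity + 1) div 2 * 2 = m + nullity + 1" by simp
  then have e: "(real CARD('p) ^ ((m + nullity + 1) div 2))\<^sup>2 = real CARD('p) ^ (m + nullity + 1)"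
    by (simp only: power_mult[symmetric])
  have nrm: "(cmod (esum 1 0 * gauss_sum))\<^sup>2 = (real CARD('p) ^ ((m + nullity + 1) div 2))\<^sup>2"
    unfolding e norm_mult power_mult_distrib cmod_gauss_sum cmod_esum_0[OF one_neq_zero]
    by (simp add: card_F nullity(1) power_add)
  have "cnj (esum 1 0 * gauss_sum) = esum 1 0 * gauss_sum"
  proof -
    have "quad_char (-1 :: 'p mod_ring) * quad_char (-1 :: 'p mod_ring) = 1"
      using quad_char_square[of "-1"] by (simp add: power2_eq_square)
    then have "complex_of_real (quad_char (-1 :: 'p mod_ring)) * of_real (quad_char (-1 :: 'p mod_ring)) = 1"
      by (metis of_real_1 of_real_mult)
    then show ?thesis using tw[of "-1"] cnj_esum_1 cnj_gauss_sum by simp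
  qed
  from this nrm obtain s where "s = 1 \<or> s = -1" "esum 1 0 * gauss_sum = of_real (s * real CARD('p) ^ ((m + nullity + 1) div 2))"
    by (rule real_square_root_cases)
  then show ?thesis using that tw by blast
qed

text \<open>The identity is multiplied by p |ker| so that no division occurs.\<close>

lemma even_rank_excess_dist:
  fixes G :: real
  assumes G: "\<And>l. l \<noteq> 0 \<Longrightarrow> esum l 0 = of_real G"
  shows "real CARD('p) * (real (card ker) * real (card {d. excess d = v})) =
    of_bool (v = 0) * (real CARD('p) * (real CARD('a) * real (card ker) - real CARD('a))) +
    of_bool (v = (real CARD('p) - 1) * G) * (real CARD('a) + (real CARD('p) - 1) * G) +
    of_bool (v = - G) * ((real CARD('p) - 1) * (real CARD('a) - G))"
proof -
  \<comment> \<open>One function with two roles: \<open>w j\<close> is the excess at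
    \<open>L y\<close> whenever \<open>Q y = j\<close>, and by \<open>card_level\<close> it is also
    p times the size of the level set of j, minus q. The frequency of a value thus depends on the
    value itself.\<close>
  define w :: "'p mod_ring \<Rightarrow> real" where "w j = (if j = 0 then real CARD('p) - 1 else - 1) * G" for j
  have lev: "(\<Sum>l\<in>UNIV - {0}. add_char (- (l * j)) * esum l 0) = of_real (w j)" for j
  proof -
    have "(\<Sum>l\<in>UNIV - {0}. add_char (- (l * j)) * esum l 0)
        = (\<Sum>l\<in>UNIV - {0}. add_char (- (l * j))) * of_real G"
      unfolding sum_distrib_right by (rule sum.cong) (auto simp: G)
    then show ?thesis by (simp add: sum_add_char_nonzero w_def)
  qed
  have "of_real (excess (L y)) = complex_of_real (w (Q y))" for y
    using lev[of "Q y"] by (simp add: excess_eq esum_range)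
  then have ex: "excess (L y) = w (Q y)" for y using of_real_eq_iff by blast
  have "complex_of_real (real CARD('p) * real (card {x. Q x = j}) - real CARD('a)) = of_real (w j)" for j
    unfolding card_level by (rule lev)
  then have cl: "real CARD('p) * real (card {x. Q x = j}) = real CARD('a) + w j" for j
    by (metis add_diff_cancel_left' diff_add_cancel of_real_eq_iff add.commute)
  have "card {y. Q y \<noteq> 0} = card (UNIV - {y. Q y = 0})" by (intro arg_cong[where f = card]) auto
  then have c2: "real (card {y. Q y \<noteq> 0}) = real CARD('a) - real (card {y. Q y = 0})"
    by (simp add: card_Diff_subset of_nat_diff card_mono)
  have "real (card {y. excess (L y) = v}) = (\<Sum>y\<in>UNIV. of_bool (w (Q y) = v))"
    by (simp only: ex card_eq_sum_of_bool)
  also have "\<dots> = (\<Sum>y\<in>UNIV. of_bool (v = (real CARD('p) - 1) * G) * of_bool (Q y = 0) + of_bool (v = - G) * of_bool (Q y \<noteq> 0))"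
    by (rule sum.cong) (auto simp: w_def)
  also have "\<dots> = of_bool (v = (real CARD('p) - 1) * G) * real (card {y. Q y = 0}) + of_bool (v = - G) * real (card {y. Q y \<noteq> 0})"
    by (simp only: sum.distrib sum_distrib_left[symmetric] card_eq_sum_of_bool)
  finally have "real CARD('p) * real (card {y. excess (L y) = v}) =
      of_bool (v = (real CARD('p) - 1) * G) * (real CARD('p) * real (card {y. Q y = 0}))
      + of_bool (v = - G) * (real CARD('p) * real CARD('a) - real CARD('p) * real (card {y. Q y = 0}))"
    by (simp only: c2 distrib_left right_diff_distrib mult.left_commute)
  then show ?thesis unfolding excess_dist cl distrib_left by (simp add: w_def algebra_simps)
qed

text \<open>The sign \<open>s\<close> drops out of the result. The excess is s G times the character
  of -Q(y), so the value G occurs where the character is s, and those level sets have size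
  proportional to q + s * s * G = q + G; likewise for -G.\<close>

lemma odd_rank_excess_dist:
  fixes G :: real
  assumes tw: "\<And>l. l \<noteq> 0 \<Longrightarrow> esum l 0 = of_real (quad_char l) * esum 1 0"
    and G: "esum 1 0 * gauss_sum = of_real (s * G)" "s = 1 \<or> s = -1"
  shows "real CARD('p) * (real (card ker) * real (card {d. excess d = v})) =
    of_bool (v = 0) * (real CARD('p) * (real CARD('a) * real (card ker) - real CARD('a)) + real CARD('a)) +
    of_bool (v = G) * ((real CARD('p) - 1) / 2 * (real CARD('a) + G)) +
    of_bool (v = - G) * ((real CARD('p) - 1) / 2 * (real CARD('a) - G))"
proof -
  define w :: "'p mod_ring \<Rightarrow> real" where "w j = quad_char (- j) * (s * G)" for j
  have lev: "(\<Sum>l\<in>UNIV - {0}. add_char (- (l * j)) * esum l 0) = of_real (w j)" for j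
  proof -
    have "(\<Sum>l\<in>UNIV - {0}. add_char (- (l * j)) * esum l 0)
        = (\<Sum>l\<in>UNIV - {0}. of_real (quad_char l) * add_char (l * (- j))) * esum 1 0"
      unfolding sum_distrib_right
    proof (rule sum.cong[OF refl])
      fix l :: "'p mod_ring" assume "l \<in> UNIV - {0}"
      then show "add_char (- (l * j)) * esum l 0 = of_real (quad_char l) * add_char (l * (- j)) * esum 1 0"
        using tw[of l] by simp
    qed
    also have "(\<Sum>l\<in>UNIV - {0}. of_real (quad_char l) * add_char (l * (- j)))
        = (\<Sum>l\<in>UNIV. complex_of_real (quad_char l) * add_char (l * (- j)))"
      by (rule sum.mono_neutral_left) auto
    also have "\<dots> * esum 1 0 = of_real (quad_char (- j)) * (esum 1 0 * gauss_sum)"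
      unfolding gauss_sum_mult by (simp add: mult_ac)
    finally show ?thesis by (simp add: G w_def)
  qed
  have "of_real (excess (L y)) = complex_of_real (w (Q y))" for y
    using lev[of "Q y"] by (simp add: excess_eq esum_range)
  then have ex: "excess (L y) = w (Q y)" for y using of_real_eq_iff by blast
  have "complex_of_real (real CARD('p) * real (card {x. Q x = j}) - real CARD('a)) = of_real (w j)" for j
    unfolding card_level by (rule lev)
  then have cl: "real CARD('p) * real (card {x. Q x = j}) = real CARD('a) + w j" for j
    by (metis add_diff_cancel_left' diff_add_cancel of_real_eq_iff add.commute)
  define S where "S u = {j :: 'p mod_ring. quad_char (- j) = u}" for u
  have cS: "real (card (S u)) = (real CARD('p) - 1) / 2" if "u = 1 \<or> u = -1" for u
  proof -
    \<comment> \<open>For u = 1 or u = -1 this holds at c = 0 too, where both sides are 0. Summed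
      over c it shows that squares and nonsquares are equally frequent.\<close>
    have "2 * of_bool (quad_char c = u) = quad_char c ^ 2 + u * quad_char c" for c :: "'p mod_ring"
      using that by (auto simp: quad_char_def)
    then have "(\<Sum>c\<in>UNIV. 2 * of_bool (quad_char (c :: 'p mod_ring) = u)) = (\<Sum>c\<in>UNIV. quad_char (c :: 'p mod_ring) ^ 2) + u * (\<Sum>c\<in>UNIV. quad_char (c :: 'p mod_ring))"
      by (simp only: sum.distrib[symmetric] sum_distrib_left)
    also have "(\<Sum>c\<in>UNIV. quad_char (c :: 'p mod_ring) ^ 2) = (\<Sum>c\<in>UNIV - {0 :: 'p mod_ring}. 1)"
      by (rule sum.mono_neutral_cong_right) (auto simp: quad_char_square)
    also have "(\<Sum>c\<in>UNIV - {0 :: 'p mod_ring}. 1 :: real) = real (CARD('p) - 1)"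
      by (simp add: card_Diff_singleton)
    finally have "2 * real (card {c :: 'p mod_ring. quad_char c = u}) = real (CARD('p) - 1)"
      by (simp only: sum_quad_char card_eq_sum_of_bool sum_distrib_left mult_zero_right add_0_right)
    moreover have "card (S u) = card {c :: 'p mod_ring. quad_char c = u}"
      unfolding S_def by (rule bij_betw_same_card[of uminus], rule bij_betwI[where g = uminus]) auto
    ultimately show ?thesis using p_gt_1 by (simp add: of_nat_diff)
  qed
  have cc: "real CARD('p) * real (card {y. quad_char (- Q y) = u}) = (real CARD('p) - 1) / 2 * (real CARD('a) + u * (s * G))"
    if "u = 1 \<or> u = -1" for u
  proof -
    have "card {y. quad_char (- Q y) = u} = card (\<Union>j\<in>S u. {y. Q y = j})"
      by (rule arg_cong[where f = card]) (auto simp: S_def)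
    also have "\<dots> = (\<Sum>j\<in>S u. card {y. Q y = j})" by (rule card_UN_disjoint) auto
    finally have "real CARD('p) * real (card {y. quad_char (- Q y) = u}) = (\<Sum>j\<in>S u. real CARD('p) * real (card {y. Q y = j}))"
      by (simp add: sum_distrib_left)
    also have "\<dots> = (\<Sum>j\<in>S u. real CARD('a) + u * (s * G))"
      by (rule sum.cong) (auto simp: cl w_def S_def)
    finally show ?thesis using cS[OF that] by simp
  qed
  have "real (card {y. excess (L y) = v}) = (\<Sum>y\<in>UNIV. of_bool (w (Q y) = v))"
    by (simp only: ex card_eq_sum_of_bool)
  also have "\<dots> = (\<Sum>y\<in>UNIV. of_bool (v = 0) * of_bool (Q y = 0) + of_bool (v = G) * of_bool (quad_char (- Q y) = s)
      + of_bool (v = - G) * of_bool (quad_char (- Q y) = - s))"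
  proof (rule sum.cong[OF refl])
    fix y
    have "Q y \<noteq> 0 \<Longrightarrow> quad_char (- Q y) = 1 \<or> quad_char (- Q y) = - 1" using quad_char_cases[of "- Q y"] by simp
    then show "of_bool (w (Q y) = v) = of_bool (v = 0) * of_bool (Q y = 0) + of_bool (v = G) * of_bool (quad_char (- Q y) = s)
      + of_bool (v = - G) * (of_bool (quad_char (- Q y) = - s) :: real)"
      using G(2) by (cases "Q y = 0") (auto simp: w_def)
  qed
  also have "\<dots> = of_bool (v = 0) * real (card {y. Q y = 0}) + of_bool (v = G) * real (card {y. quad_char (- Q y) = s})
      + of_bool (v = - G) * real (card {y. quad_char (- Q y) = - s})"
    by (simp only: sum.distrib sum_distrib_left[symmetric] card_eq_sum_of_bool)
  finally have "real CARD('p) * real (card {y. excess (L y) = v}) =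
      of_bool (v = 0) * (real CARD('p) * real (card {y. Q y = 0}))
      + of_bool (v = G) * (real CARD('p) * real (card {y. quad_char (- Q y) = s}))
      + of_bool (v = - G) * (real CARD('p) * real (card {y. quad_char (- Q y) = - s}))"
    by (simp add: algebra_simps)
  also have "real CARD('p) * real (card {y. quad_char (- Q y) = s}) = (real CARD('p) - 1) / 2 * (real CARD('a) + G)"
    using G(2) cc[of s] by auto
  also have "real CARD('p) * real (card {y. quad_char (- Q y) = - s}) = (real CARD('p) - 1) / 2 * (real CARD('a) - G)"
    using G(2) cc[of "- s"] by auto
  finally show ?thesis unfolding excess_dist cl distrib_left by (simp add: w_def algebra_simps)
qed

end

subsection \<open>A three-parameter family of quadratic forms\<close>

lemma (in prime_field_ext) card_frob_fixed:
  assumes "coprime m n" shows "card {x. frob n x = x} = CARD('p)"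
proof -
  have "{x. frob n x = x} = range emb" using frob_fixed[OF assms] by auto
  then show ?thesis using inj_emb by (simp add: card_image)
qed

lemma card_preimage_le:
  fixes h :: "'a::finite \<Rightarrow> 'b::finite"
  assumes "\<And>w. card {z. h z = w} \<le> n"
  shows "card {z. h z \<in> S} \<le> n * card S"
proof -
  have "{z. h z \<in> S} = (\<Union>w\<in>S. {z. h z = w})" by auto
  then have "card {z. h z \<in> S} \<le> (\<Sum>w\<in>S. card {z. h z = w})" by (simp add: card_UN_le)
  also have "\<dots> \<le> (\<Sum>w\<in>S. n)" by (rule sum_mono) (rule assms)
  finally show ?thesis by (simp add: mult.commute)
qed

locale form_family = prime_field_ext P F m
  for P :: "'p::prime_card itself" and F :: "'a::{field,finite} itself" and m +
  fixes k :: nat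
  assumes coprime_mk: "coprime m k" and odd_m: "odd m" and m_ge: "m \<ge> 5"
begin

lemma m_cases: obtains l where "m = 2 * l + 5"
proof -
  obtain j where "m = 2 * j + 1" using odd_m by (rule oddE)
  then have "m = 2 * (j - 2) + 5" using m_ge by simp
  then show ?thesis using that by blast
qed

text \<open>The exponents add up to k m, and the m-th Frobenius power is trivial. This provides
  inverse powers of \<sigma> with natural exponents.\<close>

lemma frob_twist: "frob (j * k) (frob ((m - j) * k) x) = x" if "j \<le> m"
proof -
  have "j * k + (m - j) * k = (j + (m - j)) * k" by (simp only: add_mult_distrib)
  then have "j * k + (m - j) * k = k * m" using that by simp
  then show ?thesis by (simp only: frob_frob frob_mult_m)
qed

text \<open>Substituting \<open>y = u z\<close> for a nonzero root \<open>u\<close> makes the coefficients sum to zero; summation by parts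
  then exhibits a factor \<open>\<sigma> z - z\<close>, whose kernel is the prime field.\<close>

lemma card_skew_roots:
  fixes a :: "nat \<Rightarrow> 'a"
  assumes "\<exists>j\<le>d. a j \<noteq> 0"
  shows "card {y. (\<Sum>j\<le>d. a j * frob (j * k) y) = 0} \<le> CARD('p) ^ d"
  using assms
proof (induction d arbitrary: a)
  case 0
  then have "{y. (\<Sum>j\<le>0. a j * frob (j * k) y) = 0} = {0}" by auto
  then show ?case by simp
next
  case (Suc d)
  let ?R = "{y. (\<Sum>j\<le>Suc d. a j * frob (j * k) y) = 0}"
  show ?case
  proof (cases "?R \<subseteq> {0}")
    case True
    then have "card ?R \<le> 1" using card_mono[of "{0}" ?R] by simp
    then show ?thesis using p_gt_1 by (meson le_trans nat_one_le_power one_le_power less_imp_le)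
  next
    case False
    then obtain u where u: "u \<noteq> 0" "(\<Sum>j\<le>Suc d. a j * frob (j * k) u) = 0" by blast
    define a' where "a' j = a j * frob (j * k) u" for j
    define b where "b j = - (\<Sum>i\<le>j. a' i)" for j
    have tot: "(\<Sum>j\<le>Suc d. a' j) = 0" using u(2) by (simp add: a'_def)
    \<comment> \<open>Abel summation; \<open>b\<close> is the negative of the partial sums. At n =
      Suc d the boundary term vanishes because the coefficients \<open>a'\<close> sum to
      zero.\<close>
    have parts: "(\<Sum>j\<le>n. a' j * x j) = (\<Sum>j<n. b j * (x (Suc j) - x j)) + (\<Sum>i\<le>n. a' i) * x n" for x :: "nat \<Rightarrow> 'a" and n
      by (induction n) (simp_all add: b_def algebra_simps)
    have fac: "(\<Sum>j\<le>Suc d. a j * frob (j * k) (u * z)) = (\<Sum>j\<le>d. b j * frob (j * k) (frob k z - z))" for z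
    proof -
      have "(\<Sum>j\<le>Suc d. a j * frob (j * k) (u * z)) = (\<Sum>j\<le>Suc d. a' j * frob (j * k) z)"
        by (rule sum.cong) (auto simp: a'_def frob_mult)
      also have "\<dots> = (\<Sum>j<Suc d. b j * (frob (Suc j * k) z - frob (j * k) z))"
        unfolding parts[of "\<lambda>j. frob (j * k) z"] tot by simp
      also have "\<dots> = (\<Sum>j\<le>d. b j * frob (j * k) (frob k z - z))"
        by (rule sum.cong) (auto simp: frob_diff frob_frob add.commute)
      finally show ?thesis .
    qed
    have "\<exists>j\<le>d. b j \<noteq> 0"
    proof (rule ccontr)
      assume "\<not> ?thesis"
      then have z: "(\<Sum>i\<le>j. a' i) = 0" if "j \<le> d" for j using that by (simp add: b_def)
      have "a' j = 0" if "j \<le> Suc d" for j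
      proof (cases j)
        case 0 then show ?thesis using z[of 0] by simp
      next
        case (Suc i)
        then have "(\<Sum>i\<le>j. a' i) = 0" using z[of j] tot that by (cases "j = Suc d") auto
        then show ?thesis using z[of i] Suc that by simp
      qed
      then have "a j = 0" if "j \<le> Suc d" for j using that u(1) by (simp add: a'_def)
      then show False using Suc.prems by blast
    qed
    then have IH: "card {y. (\<Sum>j\<le>d. b j * frob (j * k) y) = 0} \<le> CARD('p) ^ d" by (rule Suc.IH)
    \<comment> \<open>A nonempty fibre is a coset of the fixed field of \<sigma>, which has p
      elements since m and k are coprime. This is the factor p gained per degree.\<close>
    have fib: "card {z. frob k z - z = w} \<le> CARD('p)" for w
    proof (cases "\<exists>z. frob k z - z = w")
      case True
      then obtain z0 where z0: "frob k z0 - z0 = w" by blast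
      have "card {z. frob k z - z = w} = card {x. frob k x = x}"
        by (rule bij_betw_same_card[of "\<lambda>z. z - z0"], rule bij_betwI[where g = "\<lambda>z. z + z0"])
           (use z0 in \<open>auto simp: frob_diff frob_add algebra_simps\<close>)
      then show ?thesis using card_frob_fixed[OF coprime_mk] by simp
    qed simp
    have "card ?R = card {z. frob k z - z \<in> {y. (\<Sum>j\<le>d. b j * frob (j * k) y) = 0}}"
      by (rule bij_betw_same_card[of "\<lambda>y. y / u"], rule bij_betwI[where g = "\<lambda>z. u * z"])
         (use u(1) in \<open>auto simp del: sum.atMost_Suc simp add: fac[symmetric]\<close>)
    also have "\<dots> \<le> CARD('p) * card {y. (\<Sum>j\<le>d. b j * frob (j * k) y) = 0}"
      by (rule card_preimage_le) (rule fib)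
    also have "\<dots> \<le> CARD('p) ^ Suc d" using IH by simp
    finally show ?thesis .
  qed
qed

definition Qf :: "'a \<times> 'a \<times> 'a \<Rightarrow> 'a \<Rightarrow> 'p mod_ring" where
  "Qf c x = (case c of (al, be, ga) \<Rightarrow> tr (al * (frob (2 * k) x * x) + be * (frob k x * x) + ga * x ^ 2))"

text \<open>The operator representing the polar form of x -> tr(a \<sigma>^j(x) x): a \<sigma>^j
  plus its adjoint, where \<sigma>^(-j) is written as \<sigma>^(m-j).\<close>

definition adj :: "nat \<Rightarrow> 'a \<Rightarrow> 'a \<Rightarrow> 'a" where
  "adj j a y = a * frob (j * k) y + frob ((m - j) * k) (a * y)"

definition Lf :: "'a \<times> 'a \<times> 'a \<Rightarrow> 'a \<Rightarrow> 'a" where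
  "Lf c y = (case c of (al, be, ga) \<Rightarrow> adj 2 al y + adj 1 be y + 2 * ga * y)"

lemma tr_adj:
  assumes "j \<le> m"
  shows "tr (x * adj j a y) = tr (a * (frob (j * k) y * x)) + tr (a * (frob (j * k) x * y))"
proof -
  have "tr (x * frob ((m - j) * k) (a * y)) = tr (frob (j * k) (x * frob ((m - j) * k) (a * y)))"
    by (rule tr_frob[symmetric])
  also have "\<dots> = tr (frob (j * k) x * (a * y))" by (simp only: frob_mult[of "j * k" x] frob_twist[OF assms])
  finally show ?thesis by (simp add: adj_def distrib_left tr_add mult_ac)
qed

sublocale fam: quad_form P F m "Qf c" "Lf c" for c
proof
  obtain al be ga where c: "c = (al, be, ga)" by (cases c)
  show "Qf c (x + y) = Qf c x + Qf c y + tr (x * Lf c y)" for x y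
  proof -
    have "tr (x * Lf c y) = tr (x * adj 2 al y) + tr (x * adj 1 be y) + tr (ga * (2 * x * y))"
      by (simp add: c Lf_def distrib_left tr_add mult_ac)
    then show ?thesis using m_ge
      by (simp add: c Qf_def tr_adj frob_add tr_add power2_eq_square algebra_simps)
  qed
  show "Qf c (emb a * x) = a\<^sup>2 * Qf c x" for a x
  proof -
    have "Qf c (emb a * x) = tr (emb (a\<^sup>2) * (al * (frob (2 * k) x * x) + be * (frob k x * x) + ga * x ^ 2))"
      by (simp add: c Qf_def frob_mult emb_power emb_mult power2_eq_square algebra_simps)
    then show ?thesis by (simp only: tr_emb_mult) (simp add: c Qf_def)
  qed
  show "Lf c (x + y) = Lf c x + Lf c y" for x y
    by (simp add: c Lf_def adj_def frob_add algebra_simps)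
qed

lemma two_nonzero_F: "(2 :: 'a) \<noteq> 0"
proof -
  have "emb (1 + 1) = 1 + 1" by (simp only: emb_add emb_1)
  then have "emb 2 = 2" by (simp only: one_add_one)
  then show ?thesis using fam.two_nonzero emb_eq_0_iff by metis
qed

text \<open>Applying \<sigma>^2 to \<open>Lf c y\<close> clears the negative powers of \<sigma> and
  leaves a \<sigma>-polynomial of \<sigma>-degree 4 with the same kernel. Its first three
  coefficients already vanish together only for the zero form.\<close>

lemma card_ker_le: assumes "c \<noteq> (0, 0, 0)" shows "card (fam.ker c) \<le> CARD('p) ^ 4"
proof -
  obtain al be ga where c: "c = (al, be, ga)" by (cases c)
  define a where "a j = [al, frob k be, 2 * frob (2 * k) ga, frob (2 * k) be, frob (2 * k) al] ! j" for j
  have "frob (2 * k) (Lf c y) = (\<Sum>j\<le>4. a j * frob (j * k) y)" for y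
  proof -
    have t2: "frob (2 * k) (frob ((m - 2) * k) x) = x" for x using frob_twist[of 2 x] m_ge by simp
    have t1: "frob (2 * k) (frob ((m - 1) * k) x) = frob k x" for x
      using frob_twist[of 1 x] m_ge frob_frob[of k k "frob ((m - 1) * k) x"] by (simp add: mult_2)
    have 2: "frob (2 * k) 2 = 2" using frob_emb[of "2 * k" "1 + 1"] by (simp only: emb_add emb_1) simp
    have "frob (2 * k) (Lf c y) = frob (2 * k) (al * frob (2 * k) y) + al * y
        + (frob (2 * k) (be * frob (1 * k) y) + frob k (be * y)) + frob (2 * k) (2 * ga * y)"
      by (simp only: c Lf_def adj_def prod.case frob_add t1 t2)
    also have "\<dots> = (\<Sum>j\<le>4. a j * frob (j * k) y)"
      by (simp only: frob_mult 2) (simp add: a_def numeral_eq_Suc frob_frob algebra_simps)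
    finally show ?thesis .
  qed
  then have "fam.ker c = {y. (\<Sum>j\<le>4. a j * frob (j * k) y) = 0}"
    unfolding fam.ker_def by (metis frob_eq_0_iff)
  moreover have "\<exists>j\<le>4. a j \<noteq> 0"
  proof (rule ccontr)
    assume "\<not> ?thesis"
    then have "a 0 = 0" "a 1 = 0" "a 2 = 0" by auto
    then show False using assms two_nonzero_F by (simp add: a_def c)
  qed
  ultimately show ?thesis using card_skew_roots[of 4 a] by (simp only:)
qed

lemma sum_triple_product:
  "(\<Sum>c\<in>UNIV. case c of (al, be, ga) \<Rightarrow> f al * g be * h ga)
    = (\<Sum>al\<in>UNIV. f al) * (\<Sum>be\<in>UNIV. g be) * (\<Sum>ga\<in>UNIV. h (ga :: 'a) :: complex)"
  for f g :: "'a \<Rightarrow> complex"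
proof -
  have "(\<Sum>al\<in>UNIV. \<Sum>be\<in>UNIV. \<Sum>ga\<in>UNIV. f al * g be * h ga)
      = (\<Sum>al\<in>UNIV. f al) * (\<Sum>be\<in>UNIV. g be) * (\<Sum>ga\<in>UNIV. h ga)"
    by (simp only: sum_distrib_left[symmetric] sum_distrib_right[symmetric])
  then show ?thesis by (simp only: sum.cartesian_product UNIV_Times_UNIV)
qed

lemma sum_add_char_tr_1: "(\<Sum>x\<in>UNIV. add_char (tr (x * a))) = of_nat CARD('a) * of_bool (a = 0)"
  using sum_add_char_tr[of 1 a] by (simp add: mult.commute)

text \<open>The exponent is linear in the three parameters, so orthogonality forces each of the
  three coefficients to vanish.\<close>

lemma sum_family_two_point:
  "(\<Sum>c\<in>UNIV. add_char (l1 * Qf c x + l2 * Qf c z))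
    = of_nat CARD('a) ^ 3 * of_bool (emb l1 * (frob (2 * k) x * x) + emb l2 * (frob (2 * k) z * z) = 0 \<and>
        emb l1 * (frob k x * x) + emb l2 * (frob k z * z) = 0 \<and> emb l1 * x ^ 2 + emb l2 * z ^ 2 = 0)"
proof -
  define A where "A = emb l1 * (frob (2 * k) x * x) + emb l2 * (frob (2 * k) z * z)"
  define B where "B = emb l1 * (frob k x * x) + emb l2 * (frob k z * z)"
  define G where "G = emb l1 * x ^ 2 + emb l2 * z ^ 2"
  have "l1 * Qf (al, be, ga) x + l2 * Qf (al, be, ga) z = tr (al * A) + tr (be * B) + tr (ga * G)" for al be ga
    by (simp add: Qf_def A_def B_def G_def tr_emb_mult[symmetric] tr_add[symmetric] algebra_simps)
  then have "add_char (l1 * Qf c x + l2 * Qf c z)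
      = (case c of (al, be, ga) \<Rightarrow> add_char (tr (al * A)) * add_char (tr (be * B)) * add_char (tr (ga * G)))" for c
    by (cases c) (simp only: prod.case add_char_add)
  then have "(\<Sum>c\<in>UNIV. add_char (l1 * Qf c x + l2 * Qf c z))
      = (\<Sum>c\<in>UNIV. case c of (al, be, ga) \<Rightarrow> add_char (tr (al * A)) * add_char (tr (be * B)) * add_char (tr (ga * G)))"
    by (simp only:)
  also have "\<dots> = of_nat CARD('a) ^ 3 * of_bool (A = 0 \<and> B = 0 \<and> G = 0)"
    unfolding sum_triple_product sum_add_char_tr_1 by (auto simp: power3_eq_cube)
  finally show ?thesis unfolding A_def B_def G_def .
qed

text \<open>For \<open>y \<noteq> 0\<close>, \<open>L y = 0\<close> determines \<open>\<gamma>\<close> from \<open>\<alpha>\<close> and \<open>\<beta>\<close>; the remaining sum over \<open>\<alpha>, \<beta>\<close> is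
  governed by the squares \<open>(t - \<sigma> t)\<^sup>2\<close>, which makes the higher moments computable.\<close>

lemma sum_family_radical_two_point:
  assumes y: "y \<noteq> 0"
  shows "(\<Sum>c | Lf c y = 0. add_char (l1 * Qf c (t * y) + l2 * Qf c (u * y)))
    = of_nat CARD('a) ^ 2 *
      of_bool (emb l1 * (t - frob (2 * k) t) ^ 2 + emb l2 * (u - frob (2 * k) u) ^ 2 = 0 \<and>
        emb l1 * (t - frob k t) ^ 2 + emb l2 * (u - frob k u) ^ 2 = 0)"
proof -
  define ga where "ga al be = - (adj 2 al y + adj 1 be y) / (2 * y)" for al be
  have ga: "Lf (al, be, g) y = 0 \<longleftrightarrow> g = ga al be" for al be g
    using y two_nonzero_F by (auto simp: Lf_def ga_def field_simps eq_neg_iff_add_eq_0)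
  \<comment> \<open>With \<gamma> eliminated, \<open>D 2 w\<close> and \<open>D 1 w\<close> are the
    coefficients of \<alpha> and \<beta> in the form at \<open>w * y\<close>. The eliminated term
    contributes -(w^2 + \<sigma>^j(w)^2)/2 to the product w \<sigma>^j(w), which completes the
    square.\<close>
  define D where "D j w = - (y * frob (j * k) y) * (w - frob (j * k) w) ^ 2 / 2" for j w
  have red: "tr (a * (frob (j * k) (w * y) * (w * y))) + tr (- adj j a y / (2 * y) * (w * y) ^ 2) = tr (a * D j w)"
    if "j \<le> m" for a j w
  proof -
    have "- adj j a y / (2 * y) * (w * y) ^ 2 = (- (w ^ 2 * y / 2)) * adj j a y"
      using y by (simp add: field_simps power2_eq_square)
    then have "tr (- adj j a y / (2 * y) * (w * y) ^ 2)
        = tr (a * (frob (j * k) y * (- (w ^ 2 * y / 2)))) + tr (a * (frob (j * k) (- (w ^ 2 * y / 2)) * y))"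
      by (simp only: tr_adj[OF that])
    moreover have "frob (j * k) (- (w ^ 2 * y / 2)) = - (frob (j * k) w ^ 2 * frob (j * k) y / 2)"
    proof -
      have "frob (j * k) 2 = 2" using frob_emb[of "j * k" "1 + 1"] by (simp only: emb_add emb_1) simp
      then show ?thesis by (simp add: frob_uminus frob_divide frob_mult frob_power)
    qed
    moreover have "frob (j * k) w * frob (j * k) y * (w * y) - frob (j * k) y * (w\<^sup>2 * y / 2)
        - frob (j * k) w ^ 2 * frob (j * k) y / 2 * y = D j w"
    proof -
      have "(4 :: 'a) = 2 * 2" by simp
      then have "(4 :: 'a) \<noteq> 0" using two_nonzero_F by (metis mult_eq_0_iff)
      then show ?thesis using two_nonzero_F by (simp add: D_def field_simps power2_eq_square)
    qed
    ultimately show ?thesis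
      by (simp add: tr_add[symmetric] frob_mult distrib_left[symmetric])
         (simp add: algebra_simps)
  qed
  have Q: "Qf (al, be, ga al be) (w * y) = tr (al * D 2 w) + tr (be * D 1 w)" for al be w
  proof -
    have "ga al be * (w * y) ^ 2 = - adj 2 al y / (2 * y) * (w * y) ^ 2 + - adj 1 be y / (2 * y) * (w * y) ^ 2"
      by (simp add: ga_def diff_divide_distrib left_diff_distrib)
    then have "Qf (al, be, ga al be) (w * y)
       = (tr (al * (frob (2 * k) (w * y) * (w * y))) + tr (- adj 2 al y / (2 * y) * (w * y) ^ 2))
       + (tr (be * (frob (1 * k) (w * y) * (w * y))) + tr (- adj 1 be y / (2 * y) * (w * y) ^ 2))"
      by (simp only: Qf_def prod.case tr_add mult_1) (simp only: ac_simps)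
    then show ?thesis using m_ge by (simp only: red)
  qed
  have comb: "emb l1 * D j t + emb l2 * D j u
      = - (y * frob (j * k) y) / 2 * (emb l1 * (t - frob (j * k) t) ^ 2 + emb l2 * (u - frob (j * k) u) ^ 2)" for j
    by (simp add: D_def field_simps)
  then have comb0: "emb l1 * D j t + emb l2 * D j u = 0
      \<longleftrightarrow> emb l1 * (t - frob (j * k) t) ^ 2 + emb l2 * (u - frob (j * k) u) ^ 2 = 0" for j
    using y two_nonzero_F by simp
  have "(\<Sum>c | Lf c y = 0. add_char (l1 * Qf c (t * y) + l2 * Qf c (u * y)))
      = (\<Sum>(al, be)\<in>UNIV. add_char (l1 * Qf (al, be, ga al be) (t * y) + l2 * Qf (al, be, ga al be) (u * y)))"
    by (rule sum.reindex_bij_witness[of _ "\<lambda>(al, be). (al, be, ga al be)" "\<lambda>(al, be, _). (al, be)"])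
       (auto simp: ga)
  also have "\<dots> = (\<Sum>al\<in>UNIV. \<Sum>be\<in>UNIV. add_char (tr (al * (emb l1 * D 2 t + emb l2 * D 2 u)))
      * add_char (tr (be * (emb l1 * D 1 t + emb l2 * D 1 u))))"
    unfolding UNIV_Times_UNIV[symmetric] sum.cartesian_product[symmetric]
  proof (intro sum.cong refl)
    fix al be
    have "l1 * Qf (al, be, ga al be) (t * y) + l2 * Qf (al, be, ga al be) (u * y)
        = tr (al * (emb l1 * D 2 t + emb l2 * D 2 u)) + tr (be * (emb l1 * D 1 t + emb l2 * D 1 u))"
      by (simp add: Q tr_emb_mult[symmetric] tr_add[symmetric] algebra_simps)
    then show "add_char (l1 * Qf (al, be, ga al be) (t * y) + l2 * Qf (al, be, ga al be) (u * y))
      = add_char (tr (al * (emb l1 * D 2 t + emb l2 * D 2 u))) * add_char (tr (be * (emb l1 * D 1 t + emb l2 * D 1 u)))"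
      by (simp add: add_char_add)
  qed
  also have "\<dots> = (\<Sum>al\<in>UNIV. add_char (tr (al * (emb l1 * D 2 t + emb l2 * D 2 u))))
      * (\<Sum>be\<in>UNIV. add_char (tr (be * (emb l1 * D 1 t + emb l2 * D 1 u))))"
    by (rule sum_product[symmetric])
  also have "\<dots> = of_nat CARD('a) ^ 2 * of_bool (emb l1 * D 2 t + emb l2 * D 2 u = 0 \<and> emb l1 * D 1 t + emb l2 * D 1 u = 0)"
    unfolding sum_add_char_tr_1 by (auto simp: power2_eq_square)
  finally show ?thesis unfolding comb0 by simp
qed

subsection \<open>Moments of the exponential sums\<close>

text \<open>A square root w would satisfy \<sigma>w = w or \<sigma>w = -w for the plain Frobenius
  \<sigma>. The first puts w into the prime field; the second, iterated m times with m odd, gives w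
  = -w.\<close>

lemma emb_nonsquare:
  assumes "quad_char \<nu> = -1" shows "emb \<nu> \<noteq> w ^ 2"
proof
  assume w: "emb \<nu> = w ^ 2"
  have "(frob 1 w) ^ 2 = w ^ 2" using frob_emb[of 1 \<nu>] unfolding w by (simp only: frob_power)
  then consider "frob 1 w = w" | "frob 1 w = - w" by (auto simp: power2_eq_iff)
  then show False
  proof cases
    case 1
    then obtain s where "w = emb s" using range_emb by (metis (mono_tags, lifting) mem_Collect_eq rangeE)
    then have "emb \<nu> = emb (s ^ 2)" using w by (simp add: emb_power)
    then have \<nu>: "\<nu> = s ^ 2" by (simp only: emb_eq_iff)
    then have "\<nu> \<noteq> 0" using assms by auto
    then show False using \<nu> quad_char_eq_1_iff[of \<nu>] assms by auto
  next
    case 2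
    have "frob n w = (- 1) ^ n * w" for n
    proof (induction n)
      case (Suc n)
      have "frob (Suc n) w = frob n (frob 1 w)" by (simp add: frob_frob)
      then show ?case using Suc by (simp only: 2 frob_uminus) simp
    qed simp
    from this[of m] have "w = - w" using odd_m by simp
    then have "2 * w = 0" by (metis add.right_inverse mult_2)
    then have "w = 0" using two_nonzero_F by simp
    then have "\<nu> = 0" using w by simp
    then show False using assms by simp
  qed
qed

lemma square_eq_nonsquare_mult:
  assumes "quad_char \<nu> = -1" "emb 1 * x ^ 2 + emb (- \<nu>) * z ^ 2 = 0" shows "x = 0 \<and> z = 0"
proof (cases "z = 0")
  case False
  have "emb \<nu> = (x / z) ^ 2" using assms(2) False by (simp add: emb_uminus field_simps)
  then show ?thesis using emb_nonsquare[OF assms(1)] by blast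
qed (use assms in auto)

lemma four_nonzero_F: "(4 :: 'a) \<noteq> 0"
proof -
  have "(4 :: 'a) = 2 * 2" by simp
  then show ?thesis using two_nonzero_F by (metis mult_eq_0_iff)
qed

lemma card_pairs_eq_sum_of_bool:
  "of_nat (card {(x, z). R x z}) = (\<Sum>x\<in>UNIV. \<Sum>z\<in>UNIV. of_bool (R x z) :: complex)"
  for R :: "'a \<Rightarrow> 'a \<Rightarrow> bool"
proof -
  have "(\<Sum>x\<in>UNIV. \<Sum>z\<in>UNIV. of_bool (R x z) :: complex) = (\<Sum>w\<in>UNIV. of_bool (case w of (x, z) \<Rightarrow> R x z))"
    by (simp only: sum.cartesian_product UNIV_Times_UNIV) (rule sum.cong, auto)
  then show ?thesis by (simp only: card_eq_sum_of_bool)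
qed

text \<open>The change of variables to t + u and t - u is bijective because 2 is invertible;
  inclusion-exclusion does the rest. It is applied to S = {0} and to the prime field.\<close>

lemma card_diff_or_sum:
  "real (card {(t, u). t - u \<in> S \<or> t + u \<in> S}) = 2 * real (card S) * real CARD('a) - real (card S) ^ 2"
  for S :: "'a set"
proof -
  have h: "(x + y) / 2 + (x - y) / 2 = x" "(x + y) / 2 - (x - y) / 2 = y" for x y :: 'a
    using two_nonzero_F four_nonzero_F by (simp_all add: field_simps)
  have "card {(t, u). t - u \<in> S \<or> t + u \<in> S} = card (S \<times> UNIV \<union> (UNIV \<times> S :: ('a \<times> 'a) set))"
    by (rule bij_betw_same_card[of "\<lambda>(t, u). (t + u, t - u)"],
        rule bij_betwI[where g = "\<lambda>(a, b). ((a + b) / 2, (a - b) / 2)"])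
       (use two_nonzero_F in \<open>auto simp: h mult_2[symmetric]\<close>)
  also have "\<dots> + card (S \<times> UNIV \<inter> (UNIV \<times> S :: ('a \<times> 'a) set)) = card (S \<times> (UNIV :: 'a set)) + card ((UNIV :: 'a set) \<times> S)"
    by (rule card_Un_Int[symmetric]) auto
  finally have "card {(t, u). t - u \<in> S \<or> t + u \<in> S} + card S * card S = 2 * card S * CARD('a)"
    by (simp add: Times_Int_Times card_cartesian_product mult.commute)
  from arg_cong[OF this, of real] show ?thesis by (simp add: power2_eq_square)
qed

lemma esum_pair: "fam.esum c l1 0 * fam.esum c l2 0 = (\<Sum>x\<in>UNIV. \<Sum>z\<in>UNIV. add_char (l1 * Qf c x + l2 * Qf c z))"
  by (simp add: fam.esum_def sum_product add_char_add)

lemma moment_pair: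
  "(\<Sum>c\<in>UNIV. fam.esum c l1 0 * fam.esum c l2 0) = of_nat CARD('a) ^ 3 *
    of_nat (card {(x, z). emb l1 * (frob (2 * k) x * x) + emb l2 * (frob (2 * k) z * z) = 0 \<and>
        emb l1 * (frob k x * x) + emb l2 * (frob k z * z) = 0 \<and> emb l1 * x ^ 2 + emb l2 * z ^ 2 = 0})"
proof -
  have "(\<Sum>c\<in>UNIV. fam.esum c l1 0 * fam.esum c l2 0)
      = (\<Sum>x\<in>UNIV. \<Sum>z\<in>UNIV. \<Sum>c\<in>UNIV. add_char (l1 * Qf c x + l2 * Qf c z))"
    unfolding esum_pair by (subst sum.swap, intro sum.cong refl, rule sum.swap)
  then show ?thesis
    by (simp only: sum_family_two_point sum_distrib_left[symmetric] card_pairs_eq_sum_of_bool)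
qed

text \<open>The weight is expanded as a sum over radical vectors y. The term y = 0 is the unweighted
  moment; for each of the q - 1 others the substitution x = t y, z = u y leads to a count that no
  longer involves y.\<close>

lemma moment_pair_radical:
  "(\<Sum>c\<in>UNIV. fam.esum c l1 0 * fam.esum c l2 0 * of_nat (card (fam.ker c)))
    = (\<Sum>c\<in>UNIV. fam.esum c l1 0 * fam.esum c l2 0) + (of_nat CARD('a) - 1) * (of_nat CARD('a) ^ 2 *
    of_nat (card {(t, u). emb l1 * (t - frob (2 * k) t) ^ 2 + emb l2 * (u - frob (2 * k) u) ^ 2 = 0 \<and>
        emb l1 * (t - frob k t) ^ 2 + emb l2 * (u - frob k u) ^ 2 = 0}))" (is "_ = _ + _ * ?R")
proof -
  define f where "f c = fam.esum c l1 0 * fam.esum c l2 0" for c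
  have "(\<Sum>c\<in>UNIV. f c * of_nat (card (fam.ker c))) = (\<Sum>c\<in>UNIV. \<Sum>y\<in>UNIV. f c * of_bool (Lf c y = 0))"
    by (simp only: fam.ker_def card_eq_sum_of_bool sum_distrib_left)
  also have "\<dots> = (\<Sum>y\<in>UNIV. \<Sum>c\<in>UNIV. f c * of_bool (Lf c y = 0))" by (rule sum.swap)
  also have "\<dots> = (\<Sum>y\<in>UNIV. \<Sum>c | Lf c y = 0. f c)"
    by (intro sum.cong refl sum.mono_neutral_cong_right) auto
  also have "\<dots> = (\<Sum>c | Lf c 0 = 0. f c) + (\<Sum>y\<in>UNIV - {0}. \<Sum>c | Lf c y = 0. f c)"
    by (rule sum.remove) auto
  also have "(\<Sum>c | Lf c 0 = 0. f c) = (\<Sum>c\<in>UNIV. f c)" by simp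
  also have "(\<Sum>y\<in>UNIV - {0}. \<Sum>c | Lf c y = 0. f c) = (\<Sum>y\<in>UNIV - {0 :: 'a}. ?R)"
  proof (rule sum.cong[OF refl])
    fix y :: 'a assume "y \<in> UNIV - {0}"
    then have y: "y \<noteq> 0" by simp
    have sc: "(\<Sum>x\<in>UNIV. g x) = (\<Sum>t\<in>UNIV. g (t * y))" for g :: "'a \<Rightarrow> complex"
      using sum_UNIV_mult[OF y, of g] by (simp add: mult.commute)
    have "f c = (\<Sum>t\<in>UNIV. \<Sum>u\<in>UNIV. add_char (l1 * Qf c (t * y) + l2 * Qf c (u * y)))" for c
      unfolding f_def esum_pair by (rule trans[OF sc], rule sum.cong[OF refl], rule sc)
    then have "(\<Sum>c | Lf c y = 0. f c)
        = (\<Sum>t\<in>UNIV. \<Sum>u\<in>UNIV. \<Sum>c | Lf c y = 0. add_char (l1 * Qf c (t * y) + l2 * Qf c (u * y)))"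
      by (simp only:) (subst sum.swap, intro sum.cong refl, rule sum.swap)
    then show "(\<Sum>c | Lf c y = 0. f c) = ?R"
      by (simp only: sum_family_radical_two_point[OF y] sum_distrib_left[symmetric] card_pairs_eq_sum_of_bool)
  qed
  finally show ?thesis unfolding f_def by (simp add: card_Diff_singleton of_nat_diff)
qed

lemma frob_k_fixed: "frob k x = x \<Longrightarrow> x \<in> range emb"
  by (rule frob_fixed[OF coprime_mk])

lemma card_range_emb: "card (range emb) = CARD('p)"
  using inj_emb by (simp add: card_image)

text \<open>A pair moment with second multiplier 0: that factor is the constant q, and the second
  point is unconstrained, so q cancels on both sides.\<close>

lemma moment_single:
  assumes "l \<noteq> 0" shows "(\<Sum>c\<in>UNIV. fam.esum c l 0) = of_nat CARD('a) ^ 3"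
proof -
  have "{(x, z). emb l * (frob (2 * k) x * x) + emb 0 * (frob (2 * k) z * z) = 0 \<and>
        emb l * (frob k x * x) + emb 0 * (frob k z * z) = 0 \<and> emb l * x ^ 2 + emb 0 * z ^ 2 = 0}
      = {0 :: 'a} \<times> (UNIV :: 'a set)" using assms by auto
  then have "(\<Sum>c\<in>UNIV. fam.esum c l 0) * of_nat CARD('a) = of_nat CARD('a) ^ 3 * of_nat CARD('a)"
    using moment_pair[of l 0] by (simp add: card_cartesian_product sum_distrib_right)
  then show ?thesis by simp
qed

lemma moment_single_radical:
  assumes "l \<noteq> 0"
  shows "(\<Sum>c\<in>UNIV. fam.esum c l 0 * of_nat (card (fam.ker c)))
    = of_nat CARD('a) ^ 3 + (of_nat CARD('a) - 1) * of_nat CARD('a) ^ 2 * of_nat CARD('p)"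
proof -
  have eq: "{(t, u). emb l * (t - frob (2 * k) t) ^ 2 + emb 0 * (u - frob (2 * k) u) ^ 2 = 0 \<and>
        emb l * (t - frob k t) ^ 2 + emb 0 * (u - frob k u) ^ 2 = 0} = range emb \<times> (UNIV :: 'a set)"
  proof (intro equalityI subsetI)
    fix a assume "a \<in> {(t, u). emb l * (t - frob (2 * k) t) ^ 2 + emb 0 * (u - frob (2 * k) u) ^ 2 = 0 \<and>
        emb l * (t - frob k t) ^ 2 + emb 0 * (u - frob k u) ^ 2 = 0}"
    then obtain t u where a: "a = (t, u)" and "emb l * (t - frob k t) ^ 2 = 0" by auto
    then have "t - frob k t = 0" using assms by simp
    then have "t \<in> range emb" using frob_k_fixed by simp
    then show "a \<in> range emb \<times> UNIV" using a by simp
  qed auto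
  have L: "(\<Sum>c\<in>UNIV. fam.esum c l 0 * fam.esum c 0 0 * of_nat (card (fam.ker c)))
      = (\<Sum>c\<in>UNIV. fam.esum c l 0 * of_nat (card (fam.ker c))) * of_nat CARD('a)"
    unfolding sum_distrib_right by (rule sum.cong) (simp_all add: mult_ac)
  have R: "(\<Sum>c\<in>UNIV. fam.esum c l 0 * fam.esum c 0 0) = of_nat CARD('a) ^ 3 * of_nat CARD('a)"
    by (simp only: fam.esum_0 sum_distrib_right[symmetric] moment_single[OF assms])
  have "(\<Sum>c\<in>UNIV. fam.esum c l 0 * of_nat (card (fam.ker c))) * of_nat CARD('a)
    = of_nat CARD('a) ^ 3 * of_nat CARD('a)
      + (of_nat CARD('a) - 1) * (of_nat CARD('a) ^ 2 * (of_nat CARD('p) * of_nat CARD('a)))"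
    using moment_pair_radical[of l 0] unfolding L R eq card_cartesian_product card_range_emb of_nat_mult .
  also have "\<dots> = (of_nat CARD('a) ^ 3 + (of_nat CARD('a) - 1) * of_nat CARD('a) ^ 2 * of_nat CARD('p)) * of_nat CARD('a)"
    by (simp only: distrib_right mult.assoc)
  finally show ?thesis by simp
qed

text \<open>x^2 = z^2 means z = x or z = -x, and then the two equations involving \<sigma> hold as
  well. The names refer to the binary forms: x^2 - z^2 splits, while x^2 - \<nu> z^2 in the elliptic
  case is anisotropic.\<close>

lemma moment_hyperbolic:
  "(\<Sum>c\<in>UNIV. fam.esum c 1 0 * fam.esum c (-1) 0) = of_nat CARD('a) ^ 3 * (2 * of_nat CARD('a) - 1)"
proof -
  have "{(x, z). emb 1 * (frob (2 * k) x * x) + emb (-1) * (frob (2 * k) z * z) = 0 \<and>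
        emb 1 * (frob k x * x) + emb (-1) * (frob k z * z) = 0 \<and> emb 1 * x ^ 2 + emb (-1) * z ^ 2 = 0}
      = {(t, u). t - u \<in> {0} \<or> t + u \<in> {0 :: 'a}}"
    by (auto simp: emb_uminus power2_eq_iff add_eq_0_iff2 frob_uminus)
  then have "(\<Sum>c\<in>UNIV. fam.esum c 1 0 * fam.esum c (-1) 0)
      = of_nat CARD('a) ^ 3 * complex_of_real (real (card {(t, u). t - u \<in> {0} \<or> t + u \<in> {0 :: 'a}}))"
    by (simp only: moment_pair of_real_of_nat_eq)
  then show ?thesis unfolding card_diff_or_sum by simp
qed

text \<open>As \<sigma> is additive, the difference of the squares of t - \<sigma> t and u -
  \<sigma> u factors through t - u and t + u. The equation for \<sigma> says that one of these lies
  in the prime field; the one for \<sigma>^2 then follows.\<close>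

lemma moment_hyperbolic_radical:
  "(\<Sum>c\<in>UNIV. fam.esum c 1 0 * fam.esum c (-1) 0 * of_nat (card (fam.ker c)))
    = (\<Sum>c\<in>UNIV. fam.esum c 1 0 * fam.esum c (-1) 0) + (of_nat CARD('a) - 1) * (of_nat CARD('a) ^ 2 *
      (2 * of_nat CARD('p) * of_nat CARD('a) - of_nat CARD('p) ^ 2))"
proof -
  have fac: "(t - frob n t) ^ 2 - (u - frob n u) ^ 2 = ((t - u) - frob n (t - u)) * ((t + u) - frob n (t + u))" for t u :: 'a and n
    by (simp add: frob_diff frob_add power2_eq_square algebra_simps)
  have fx: "a - frob k a = 0 \<longleftrightarrow> a \<in> range emb" for a using frob_k_fixed by auto
  have fx2: "a \<in> range emb \<Longrightarrow> a - frob (2 * k) a = 0" for a by auto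
  have "(emb 1 * (t - frob (2 * k) t) ^ 2 + emb (-1) * (u - frob (2 * k) u) ^ 2 = 0 \<and>
        emb 1 * (t - frob k t) ^ 2 + emb (-1) * (u - frob k u) ^ 2 = 0) \<longleftrightarrow> (t - u \<in> range emb \<or> t + u \<in> range emb)" for t u
  proof -
    have "emb 1 * (t - frob n t) ^ 2 + emb (-1) * (u - frob n u) ^ 2 = ((t - u) - frob n (t - u)) * ((t + u) - frob n (t + u))" for n
      unfolding fac[symmetric] by (simp add: emb_uminus)
    then show ?thesis using fx fx2 by (metis mult_eq_0_iff)
  qed
  then have eq: "{(t, u). emb 1 * (t - frob (2 * k) t) ^ 2 + emb (-1) * (u - frob (2 * k) u) ^ 2 = 0 \<and>
        emb 1 * (t - frob k t) ^ 2 + emb (-1) * (u - frob k u) ^ 2 = 0}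
      = {(t, u). t - u \<in> range emb \<or> t + u \<in> range emb}" by simp
  show ?thesis
    using arg_cong[OF card_diff_or_sum[of "range emb"], of complex_of_real]
    unfolding moment_pair_radical eq card_range_emb by simp
qed

lemma moment_elliptic:
  assumes "quad_char \<nu> = -1"
  shows "(\<Sum>c\<in>UNIV. fam.esum c 1 0 * fam.esum c (- \<nu>) 0) = of_nat CARD('a) ^ 3"
proof -
  have "{(x, z). emb 1 * (frob (2 * k) x * x) + emb (- \<nu>) * (frob (2 * k) z * z) = 0 \<and>
        emb 1 * (frob k x * x) + emb (- \<nu>) * (frob k z * z) = 0 \<and> emb 1 * x ^ 2 + emb (- \<nu>) * z ^ 2 = 0}
      = {(0, 0)}"
  proof (intro equalityI subsetI)
    fix a assume "a \<in> {(x, z). emb 1 * (frob (2 * k) x * x) + emb (- \<nu>) * (frob (2 * k) z * z) = 0 \<and>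
        emb 1 * (frob k x * x) + emb (- \<nu>) * (frob k z * z) = 0 \<and> emb 1 * x ^ 2 + emb (- \<nu>) * z ^ 2 = 0}"
    then obtain x z where a: "a = (x, z)" and e: "emb 1 * x ^ 2 + emb (- \<nu>) * z ^ 2 = 0" by blast
    show "a \<in> {(0, 0)}" using square_eq_nonsquare_mult[OF assms e] a by simp
  qed auto
  then show ?thesis by (simp only: moment_pair) simp
qed

lemma moment_elliptic_radical:
  assumes "quad_char \<nu> = -1"
  shows "(\<Sum>c\<in>UNIV. fam.esum c 1 0 * fam.esum c (- \<nu>) 0 * of_nat (card (fam.ker c)))
    = of_nat CARD('a) ^ 3 + (of_nat CARD('a) - 1) * (of_nat CARD('a) ^ 2 * of_nat CARD('p) ^ 2)"
proof -
  have "{(t, u). emb 1 * (t - frob (2 * k) t) ^ 2 + emb (- \<nu>) * (u - frob (2 * k) u) ^ 2 = 0 \<and>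
        emb 1 * (t - frob k t) ^ 2 + emb (- \<nu>) * (u - frob k u) ^ 2 = 0} = range emb \<times> range emb"
  proof (intro equalityI subsetI)
    fix a assume "a \<in> {(t, u). emb 1 * (t - frob (2 * k) t) ^ 2 + emb (- \<nu>) * (u - frob (2 * k) u) ^ 2 = 0 \<and>
        emb 1 * (t - frob k t) ^ 2 + emb (- \<nu>) * (u - frob k u) ^ 2 = 0}"
    then obtain t u where a: "a = (t, u)" and e: "emb 1 * (t - frob k t) ^ 2 + emb (- \<nu>) * (u - frob k u) ^ 2 = 0" by blast
    have "t - frob k t = 0 \<and> u - frob k u = 0" by (rule square_eq_nonsquare_mult[OF assms e])
    then show "a \<in> range emb \<times> range emb" using frob_k_fixed a by simp
  qed auto
  then show ?thesis
    using inj_emb by (simp only: moment_pair_radical moment_elliptic[OF assms] card_cartesian_product card_range_emb)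
      (simp add: power2_eq_square)
qed

subsection \<open>Counting forms by nullity and type\<close>

text \<open>Half of T_1 + T_\<nu>: for even rank both sums agree and are real, for odd rank they
  cancel. Hence the default 0.\<close>

definition Gval :: "'a \<times> 'a \<times> 'a \<Rightarrow> real" where
  "Gval c = (if even (m - fam.nullity c) then Re (fam.esum c 1 0) else 0)"

definition kerc :: "'a \<times> 'a \<times> 'a \<Rightarrow> real" where
  "kerc c = real (card (fam.ker c))"

lemma kerc_eq: "kerc c = real CARD('p) ^ fam.nullity c"
  by (simp add: kerc_def fam.nullity(1))

lemma Gval_even: "even (m - fam.nullity c) \<Longrightarrow> l \<noteq> 0 \<Longrightarrow> fam.esum c l 0 = of_real (Gval c)"
  and Gval_even_cases: "even (m - fam.nullity c) \<Longrightarrow>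
    Gval c = real CARD('p) ^ ((m + fam.nullity c) div 2) \<or> Gval c = - (real CARD('p) ^ ((m + fam.nullity c) div 2))"
proof -
  assume e: "even (m - fam.nullity c)"
  obtain s :: real where s: "s = 1 \<or> s = -1"
    "\<And>l. l \<noteq> 0 \<Longrightarrow> fam.esum c l 0 = of_real (s * real CARD('p) ^ ((m + fam.nullity c) div 2))"
    using fam.even_rank_esum[OF e] by blast
  have G: "Gval c = s * real CARD('p) ^ ((m + fam.nullity c) div 2)"
    using e s(2)[of 1] by (simp add: Gval_def)
  then show "l \<noteq> 0 \<Longrightarrow> fam.esum c l 0 = of_real (Gval c)" using s(2) by simp
  show "Gval c = real CARD('p) ^ ((m + fam.nullity c) div 2) \<or> Gval c = - (real CARD('p) ^ ((m + fam.nullity c) div 2))"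
    using G s(1) by auto
qed

text \<open>The multiplier -1 conjugates the sum, so the product is its squared norm.\<close>

lemma hyperbolic_value: "fam.esum c 1 0 * fam.esum c (-1) 0 = of_real (real CARD('a) * kerc c)"
proof -
  have "complex_of_real (real CARD('a) * kerc c) = of_real ((cmod (fam.esum c 1 0))\<^sup>2)"
    by (simp only: fam.cmod_esum_0[OF one_neq_zero] kerc_def)
  then show ?thesis by (simp only: complex_norm_square fam.cnj_esum_1)
qed

text \<open>Compared with the multiplier -1, the extra nonsquare contributes (-1) to the power of
  the rank; this sign separates the two parities.\<close>

lemma elliptic_value:
  assumes "quad_char \<nu> = -1"
  shows "fam.esum c 1 0 * fam.esum c (- \<nu>) 0 = of_real ((- 1) ^ (m - fam.nullity c) * (real CARD('a) * kerc c))"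
proof -
  have "\<nu> \<noteq> 0" using assms by auto
  then have "fam.esum c (- \<nu>) 0 = of_real (quad_char (- \<nu>)) ^ (m - fam.nullity c) * fam.esum c 1 0"
    by (intro fam.esum_twist) simp
  moreover have "quad_char (- \<nu>) = - quad_char (- 1 :: 'p mod_ring)"
    using quad_char_mult[of "- 1" \<nu>] assms by simp
  moreover have "fam.esum c (- 1) 0 = of_real (quad_char (- 1 :: 'p mod_ring)) ^ (m - fam.nullity c) * fam.esum c 1 0"
    by (intro fam.esum_twist) simp
  ultimately have "fam.esum c (- \<nu>) 0 = (- 1) ^ (m - fam.nullity c) * fam.esum c (- 1) 0"
    by (simp add: power_minus[of "complex_of_real _"])
  then show ?thesis using hyperbolic_value[of c] by (simp add: mult_ac)
qed

lemma Gval_value: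
  assumes "quad_char \<nu> = -1"
  shows "fam.esum c 1 0 + fam.esum c \<nu> 0 = of_real (2 * Gval c)"
proof (cases "even (m - fam.nullity c)")
  case True
  have "\<nu> \<noteq> 0" using assms by auto
  then show ?thesis using Gval_even[OF True] by simp
next
  case False
  have "\<nu> \<noteq> 0" using assms by auto
  then have "fam.esum c \<nu> 0 = of_real (quad_char \<nu>) ^ (m - fam.nullity c) * fam.esum c 1 0"
    by (intro fam.esum_twist)
  then show ?thesis using False assms by (simp add: Gval_def)
qed

lemma card_triples: "real (card (UNIV :: ('a \<times> 'a \<times> 'a) set)) = real CARD('a) ^ 3"
  by (simp add: power3_eq_cube)

lemma sum_kerc: "(\<Sum>c\<in>UNIV. kerc c) = real CARD('a) ^ 2 * (2 * real CARD('a) - 1)"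
proof -
  have "complex_of_real (\<Sum>c\<in>UNIV. real CARD('a) * kerc c) = of_real (real CARD('a) ^ 3 * (2 * real CARD('a) - 1))"
    using moment_hyperbolic by (simp add: hyperbolic_value)
  then have "real CARD('a) * (\<Sum>c\<in>UNIV. kerc c) = real CARD('a) * (real CARD('a) ^ 2 * (2 * real CARD('a) - 1))"
    by (simp only: of_real_eq_iff sum_distrib_left[symmetric]) (simp add: power3_eq_cube power2_eq_square)
  then show ?thesis by simp
qed

lemma sum_kerc_signed: "(\<Sum>c\<in>UNIV. (- 1) ^ (m - fam.nullity c) * kerc c) = real CARD('a) ^ 2"
proof -
  obtain \<nu> :: "'p mod_ring" where \<nu>: "quad_char \<nu> = -1" using ex_nonsquare by blast
  have "complex_of_real (\<Sum>c\<in>UNIV. (- 1) ^ (m - fam.nullity c) * (real CARD('a) * kerc c)) = of_real (real CARD('a) ^ 3)"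
    unfolding of_real_sum elliptic_value[OF \<nu>, symmetric] moment_elliptic[OF \<nu>] by simp
  then have "real CARD('a) * (\<Sum>c\<in>UNIV. (- 1) ^ (m - fam.nullity c) * kerc c) = real CARD('a) * real CARD('a) ^ 2"
    by (simp only: of_real_eq_iff sum_distrib_left mult.left_commute) (simp add: power3_eq_cube power2_eq_square)
  then show ?thesis by simp
qed

lemma sum_kerc_square:
  "(\<Sum>c\<in>UNIV. kerc c ^ 2) = real CARD('a) ^ 2 * (2 * real CARD('a) - 1)
    + (real CARD('a) - 1) * (real CARD('a) * (2 * real CARD('p) * real CARD('a) - real CARD('p) ^ 2))"
proof -
  have "complex_of_real (\<Sum>c\<in>UNIV. real CARD('a) * kerc c ^ 2) =
      (\<Sum>c\<in>UNIV. fam.esum c 1 0 * fam.esum c (-1) 0 * of_nat (card (fam.ker c)))"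
    unfolding of_real_sum hyperbolic_value by (rule sum.cong) (simp_all add: kerc_def power2_eq_square)
  also have "\<dots> = of_real (real CARD('a) ^ 3 * (2 * real CARD('a) - 1)
    + (real CARD('a) - 1) * (real CARD('a) ^ 2 * (2 * real CARD('p) * real CARD('a) - real CARD('p) ^ 2)))"
    unfolding moment_hyperbolic_radical moment_hyperbolic by simp
  finally have "real CARD('a) * (\<Sum>c\<in>UNIV. kerc c ^ 2) = real CARD('a) * (real CARD('a) ^ 2 * (2 * real CARD('a) - 1)
    + (real CARD('a) - 1) * (real CARD('a) * (2 * real CARD('p) * real CARD('a) - real CARD('p) ^ 2)))"
    unfolding of_real_eq_iff sum_distrib_left[symmetric] by (simp add: power3_eq_cube power2_eq_square algebra_simps)
  then show ?thesis by simp
qed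

lemma sum_kerc_square_signed:
  "(\<Sum>c\<in>UNIV. (- 1) ^ (m - fam.nullity c) * kerc c ^ 2)
    = real CARD('a) ^ 2 + (real CARD('a) - 1) * (real CARD('a) * real CARD('p) ^ 2)"
proof -
  obtain \<nu> :: "'p mod_ring" where \<nu>: "quad_char \<nu> = -1" using ex_nonsquare by blast
  have "complex_of_real (\<Sum>c\<in>UNIV. real CARD('a) * ((- 1) ^ (m - fam.nullity c) * kerc c ^ 2)) =
      (\<Sum>c\<in>UNIV. fam.esum c 1 0 * fam.esum c (- \<nu>) 0 * of_nat (card (fam.ker c)))"
    unfolding of_real_sum elliptic_value[OF \<nu>] by (rule sum.cong) (simp_all add: kerc_def power2_eq_square)
  also have "\<dots> = of_real (real CARD('a) ^ 3 + (real CARD('a) - 1) * (real CARD('a) ^ 2 * real CARD('p) ^ 2))"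
    unfolding moment_elliptic_radical[OF \<nu>] by simp
  finally have "real CARD('a) * (\<Sum>c\<in>UNIV. (- 1) ^ (m - fam.nullity c) * kerc c ^ 2)
      = real CARD('a) * (real CARD('a) ^ 2 + (real CARD('a) - 1) * (real CARD('a) * real CARD('p) ^ 2))"
    unfolding of_real_eq_iff sum_distrib_left[symmetric] by (simp add: power3_eq_cube power2_eq_square algebra_simps)
  then show ?thesis by simp
qed

lemma sum_Gval: "(\<Sum>c\<in>UNIV. Gval c) = real CARD('a) ^ 3"
proof -
  obtain \<nu> :: "'p mod_ring" where \<nu>: "quad_char \<nu> = -1" using ex_nonsquare by blast
  then have "\<nu> \<noteq> 0" by auto
  have "complex_of_real (\<Sum>c\<in>UNIV. 2 * Gval c) = of_real (2 * real CARD('a) ^ 3)"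
    unfolding of_real_sum Gval_value[OF \<nu>, symmetric] sum.distrib
    by (simp add: moment_single[OF one_neq_zero] moment_single[OF \<open>\<nu> \<noteq> 0\<close>])
  then show ?thesis unfolding of_real_eq_iff sum_distrib_left[symmetric] by simp
qed

lemma sum_Gval_kerc:
  "(\<Sum>c\<in>UNIV. Gval c * kerc c) = real CARD('a) ^ 3 + (real CARD('a) - 1) * real CARD('a) ^ 2 * real CARD('p)"
proof -
  obtain \<nu> :: "'p mod_ring" where \<nu>: "quad_char \<nu> = -1" using ex_nonsquare by blast
  then have "\<nu> \<noteq> 0" by auto
  have "complex_of_real (\<Sum>c\<in>UNIV. 2 * Gval c * kerc c)
      = (\<Sum>c\<in>UNIV. fam.esum c 1 0 * of_nat (card (fam.ker c)) + fam.esum c \<nu> 0 * of_nat (card (fam.ker c)))"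
    unfolding of_real_sum of_real_mult[of "2 * _"] Gval_value[OF \<nu>, symmetric]
    by (simp only: kerc_def of_real_of_nat_eq distrib_right)
  also have "\<dots> = of_real (2 * (real CARD('a) ^ 3 + (real CARD('a) - 1) * real CARD('a) ^ 2 * real CARD('p)))"
    unfolding sum.distrib moment_single_radical[OF one_neq_zero] moment_single_radical[OF \<open>\<nu> \<noteq> 0\<close>] by simp
  finally show ?thesis unfolding of_real_eq_iff mult.assoc sum_distrib_left[symmetric] by simp
qed

text \<open>The second component is the sign of the sum for even rank and 0 for odd rank. It is
  obtained by dividing out the absolute value p^((m + nullity)/2).\<close>

definition form_class :: "'a \<times> 'a \<times> 'a \<Rightarrow> nat \<times> real" where
  "form_class c = (fam.nullity c, Gval c / real CARD('p) ^ ((m + fam.nullity c) div 2))"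

definition class_card :: "nat \<Rightarrow> real \<Rightarrow> real" where
  "class_card i s = real (card {c. c \<noteq> (0, 0, 0) \<and> form_class c = (i, s)})"

definition form_classes :: "(nat \<times> real) set" where
  "form_classes = {(0, 0), (1, 1), (1, -1), (2, 0), (3, 1), (3, -1), (4, 0)}"

lemma form_class_mem:
  assumes "c \<noteq> (0, 0, 0)" shows "form_class c \<in> form_classes"
proof -
  have "CARD('p) ^ fam.nullity c \<le> CARD('p) ^ 4"
    using card_ker_le[OF assms] fam.nullity(1)[of c] by simp
  then have "fam.nullity c \<le> 4" using p_gt_1 by simp
  moreover have "Gval c / real CARD('p) ^ ((m + fam.nullity c) div 2) = 0" if "even (fam.nullity c)"
    using that odd_m fam.nullity(2)[of c] by (simp add: Gval_def)
  moreover have "Gval c / real CARD('p) ^ ((m + fam.nullity c) div 2) \<in> {1, -1}" if "odd (fam.nullity c)"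
  proof -
    have "even (m - fam.nullity c)" using that odd_m by simp
    from Gval_even_cases[OF this] show ?thesis using p_gt_1 by auto
  qed
  moreover have "fam.nullity c = 0 \<or> fam.nullity c = 1 \<or> fam.nullity c = 2 \<or> fam.nullity c = 3 \<or> fam.nullity c = 4"
    using calculation(1) by linarith
  ultimately show ?thesis unfolding form_class_def form_classes_def by auto
qed

text \<open>The zero form lies outside the seven classes, so its values are recorded here to be
  subtracted from every moment.\<close>

lemma zero_form: "Qf (0, 0, 0) x = 0" "Lf (0, 0, 0) x = 0" "fam.esum (0, 0, 0) l 0 = of_nat CARD('a)"
  "kerc (0, 0, 0) = real CARD('a)" "fam.nullity (0, 0, 0) = m" "Gval (0, 0, 0) = real CARD('a)"
proof -
  show Q: "Qf (0, 0, 0) x = 0" for x by (simp add: Qf_def)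
  show L: "Lf (0, 0, 0) x = 0" for x by (simp add: Lf_def adj_def)
  show E: "fam.esum (0, 0, 0) l 0 = of_nat CARD('a)" for l by (simp add: fam.esum_def Q)
  have k: "fam.ker (0, 0, 0) = UNIV" by (simp add: fam.ker_def L)
  then show "kerc (0, 0, 0) = real CARD('a)" by (simp add: kerc_def)
  have "CARD('p) ^ m = CARD('p) ^ fam.nullity (0, 0, 0)"
    using fam.nullity(1)[of "(0, 0, 0)"] k card_F by simp
  then show n: "fam.nullity (0, 0, 0) = m" using p_gt_1 by simp
  show "Gval (0, 0, 0) = real CARD('a)" using E[of 1] n by (simp add: Gval_def)
qed

lemma sum_by_class:
  assumes "\<And>c i s. c \<noteq> (0, 0, 0) \<Longrightarrow> form_class c = (i, s) \<Longrightarrow> f c = g i s"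
  shows "(\<Sum>c\<in>UNIV. f c) = f (0, 0, 0) + (class_card 0 0 * g 0 0 + class_card 1 1 * g 1 1 + class_card 1 (-1) * g 1 (-1)
     + class_card 2 0 * g 2 0 + class_card 3 1 * g 3 1 + class_card 3 (-1) * g 3 (-1) + class_card 4 0 * g 4 (0 :: real) :: real)"
proof -
  have img: "form_class ` (UNIV - {(0, 0, 0)}) \<subseteq> form_classes"
    by (intro image_subsetI form_class_mem) simp
  have fin: "finite form_classes" by (simp add: form_classes_def)
  have "(\<Sum>c\<in>UNIV. f c) = f (0, 0, 0) + (\<Sum>c\<in>UNIV - {(0, 0, 0)}. f c)" by (rule sum.remove) auto
  also have "(\<Sum>c\<in>UNIV - {(0, 0, 0)}. f c) = (\<Sum>j\<in>form_classes. \<Sum>c | c \<in> UNIV - {(0, 0, 0)} \<and> form_class c = j. f c)"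
    by (rule sum.group[OF _ fin img, symmetric]) simp
  also have "\<dots> = (\<Sum>j\<in>form_classes. class_card (fst j) (snd j) * g (fst j) (snd j))"
  proof (rule sum.cong[OF refl])
    fix j :: "nat \<times> real"
    have "(\<Sum>c | c \<in> UNIV - {(0, 0, 0)} \<and> form_class c = j. f c) = (\<Sum>c | c \<noteq> (0, 0, 0) \<and> form_class c = j. g (fst j) (snd j))"
      using assms by (intro sum.cong) auto
    then show "(\<Sum>c | c \<in> UNIV - {(0, 0, 0)} \<and> form_class c = j. f c) = class_card (fst j) (snd j) * g (fst j) (snd j)"
      by (simp add: class_card_def)
  qed
  also have "\<dots> = class_card 0 0 * g 0 0 + class_card 1 1 * g 1 1 + class_card 1 (-1) * g 1 (-1)
     + class_card 2 0 * g 2 0 + class_card 3 1 * g 3 1 + class_card 3 (-1) * g 3 (-1) + class_card 4 0 * g 4 0"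
    by (simp add: form_classes_def)
  finally show ?thesis .
qed

lemma form_classD:
  assumes "form_class c = (i, s)"
  shows "fam.nullity c = i" "kerc c = real CARD('p) ^ i" "Gval c = s * real CARD('p) ^ ((m + i) div 2)"
  using assms p_gt_1 by (auto simp: form_class_def kerc_eq)

text \<open>Every right-hand side is a moment minus the contribution of the zero form.
  \<open>h\<close> is the size of the sum at nullity 1; at nullity 3 it is p h.\<close>

lemma class_equations:
  defines "p \<equiv> real CARD('p)" and "q \<equiv> real CARD('a)" and "h \<equiv> real CARD('p) ^ ((m + 1) div 2)"
    and "N \<equiv> class_card"
  shows "N 0 0 + N 1 1 + N 1 (-1) + N 2 0 + N 3 1 + N 3 (-1) + N 4 0 = q ^ 3 - 1"
    and "N 0 0 + (N 1 1 + N 1 (-1)) * p + N 2 0 * p ^ 2 + (N 3 1 + N 3 (-1)) * p ^ 3 + N 4 0 * p ^ 4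
      = q ^ 2 * (2 * q - 1) - q"
    and "- N 0 0 + (N 1 1 + N 1 (-1)) * p - N 2 0 * p ^ 2 + (N 3 1 + N 3 (-1)) * p ^ 3 - N 4 0 * p ^ 4 = q ^ 2 - q"
    and "N 0 0 + (N 1 1 + N 1 (-1)) * p ^ 2 + N 2 0 * p ^ 4 + (N 3 1 + N 3 (-1)) * p ^ 6 + N 4 0 * p ^ 8
      = q ^ 2 * (2 * q - 1) + (q - 1) * (q * (2 * p * q - p ^ 2)) - q ^ 2"
    and "- N 0 0 + (N 1 1 + N 1 (-1)) * p ^ 2 - N 2 0 * p ^ 4 + (N 3 1 + N 3 (-1)) * p ^ 6 - N 4 0 * p ^ 8
      = q ^ 2 + (q - 1) * (q * p ^ 2) - q ^ 2"
    and "(N 1 1 - N 1 (-1)) * h + (N 3 1 - N 3 (-1)) * (p * h) = q ^ 3 - q"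
    and "(N 1 1 - N 1 (-1)) * (p * h) + (N 3 1 - N 3 (-1)) * (p ^ 4 * h) = q ^ 3 + (q - 1) * q ^ 2 * p - q ^ 2"
proof -
  obtain l where l: "m = 2 * l + 5" by (rule m_cases)
  have par: "(- 1 :: real) ^ (m - 0) = -1" "(- 1 :: real) ^ (m - 1) = 1" "(- 1 :: real) ^ (m - 2) = -1"
    "(- 1 :: real) ^ (m - 3) = 1" "(- 1 :: real) ^ (m - 4) = -1"
    by (simp_all add: l minus_one_power_iff)
  have "(m + 3) div 2 = Suc ((m + 1) div 2)" by (simp add: l)
  then have hp: "p ^ ((m + 1) div 2) = h" "p ^ ((m + 3) div 2) = p * h"
    by (simp_all add: h_def p_def)
  have d1: "kerc c = p ^ i" if "c \<noteq> (0, 0, 0)" "form_class c = (i, s)" for c i s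
    using form_classD(2)[OF that(2)] by (simp add: p_def)
  have d2: "(- 1) ^ (m - fam.nullity c) * kerc c = (- 1) ^ (m - i) * p ^ i"
    if "c \<noteq> (0, 0, 0)" "form_class c = (i, s)" for c i s
    using form_classD(1)[OF that(2)] d1[OF that] by simp
  have d3: "kerc c ^ 2 = p ^ (2 * i)" if "c \<noteq> (0, 0, 0)" "form_class c = (i, s)" for c i s
    using d1[OF that] by (simp add: power_mult[symmetric] mult.commute)
  have d4: "(- 1) ^ (m - fam.nullity c) * kerc c ^ 2 = (- 1) ^ (m - i) * p ^ (2 * i)"
    if "c \<noteq> (0, 0, 0)" "form_class c = (i, s)" for c i s
    using form_classD(1)[OF that(2)] d3[OF that] by simp
  have d5: "Gval c = s * p ^ ((m + i) div 2)" if "c \<noteq> (0, 0, 0)" "form_class c = (i, s)" for c i s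
    using form_classD(3)[OF that(2)] by (simp add: p_def)
  have d6: "Gval c * kerc c = s * p ^ ((m + i) div 2) * p ^ i" if "c \<noteq> (0, 0, 0)" "form_class c = (i, s)" for c i s
    using d5[OF that] d1[OF that] by simp
  show "N 0 0 + N 1 1 + N 1 (-1) + N 2 0 + N 3 1 + N 3 (-1) + N 4 0 = q ^ 3 - 1"
    using sum_by_class[of "\<lambda>_. 1" "\<lambda>_ _. 1", OF refl] card_triples by (simp add: N_def q_def)
  show "N 0 0 + (N 1 1 + N 1 (-1)) * p + N 2 0 * p ^ 2 + (N 3 1 + N 3 (-1)) * p ^ 3 + N 4 0 * p ^ 4
      = q ^ 2 * (2 * q - 1) - q"
    using sum_by_class[of kerc "\<lambda>i _. p ^ i", OF d1, unfolded sum_kerc zero_form] unfolding N_def q_def power_0 power_one_right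
    by (simp add: distrib_right)
  show "- N 0 0 + (N 1 1 + N 1 (-1)) * p - N 2 0 * p ^ 2 + (N 3 1 + N 3 (-1)) * p ^ 3 - N 4 0 * p ^ 4 = q ^ 2 - q"
    using sum_by_class[of "\<lambda>c. (- 1) ^ (m - fam.nullity c) * kerc c" "\<lambda>i _. (- 1) ^ (m - i) * p ^ i", OF d2, unfolded sum_kerc_signed zero_form par] unfolding N_def q_def power_0 power_one_right
    by (simp add: distrib_right)
  show "N 0 0 + (N 1 1 + N 1 (-1)) * p ^ 2 + N 2 0 * p ^ 4 + (N 3 1 + N 3 (-1)) * p ^ 6 + N 4 0 * p ^ 8
      = q ^ 2 * (2 * q - 1) + (q - 1) * (q * (2 * p * q - p ^ 2)) - q ^ 2"
    using sum_by_class[of "\<lambda>c. kerc c ^ 2" "\<lambda>i _. p ^ (2 * i)", OF d3, unfolded sum_kerc_square zero_form] unfolding N_def q_def p_def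
    by (simp add: distrib_right)
  show "- N 0 0 + (N 1 1 + N 1 (-1)) * p ^ 2 - N 2 0 * p ^ 4 + (N 3 1 + N 3 (-1)) * p ^ 6 - N 4 0 * p ^ 8
      = q ^ 2 + (q - 1) * (q * p ^ 2) - q ^ 2"
    using sum_by_class[of "\<lambda>c. (- 1) ^ (m - fam.nullity c) * kerc c ^ 2" "\<lambda>i _. (- 1) ^ (m - i) * p ^ (2 * i)", OF d4, unfolded sum_kerc_square_signed zero_form par] unfolding N_def q_def p_def
    by (simp add: distrib_right)
  show "(N 1 1 - N 1 (-1)) * h + (N 3 1 - N 3 (-1)) * (p * h) = q ^ 3 - q"
    using sum_by_class[of Gval "\<lambda>i s. s * p ^ ((m + i) div 2)", OF d5, unfolded sum_Gval zero_form hp] unfolding N_def q_def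
    by (simp add: left_diff_distrib)
  show "(N 1 1 - N 1 (-1)) * (p * h) + (N 3 1 - N 3 (-1)) * (p ^ 4 * h) = q ^ 3 + (q - 1) * q ^ 2 * p - q ^ 2"
    using sum_by_class[of "\<lambda>c. Gval c * kerc c" "\<lambda>i s. s * p ^ ((m + i) div 2) * p ^ i", OF d6, unfolded sum_Gval_kerc zero_form hp] unfolding N_def q_def
    by (simp add: p_def numeral_eq_Suc algebra_simps)
qed

end

text \<open>Writing m = 2 l + 5 and x = P^l turns all powers that occur into monomials in x and P,
  so every step is a polynomial identity. \<open>A\<close> and \<open>C\<close> are the sizes at
  nullity 1 and 3 summed over the sign, \<open>D1\<close> and \<open>D3\<close> the differences over
  the sign; \<open>f\<close> is \<open>poly_factor\<close>.\<close>

lemma class_system_solution: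
  fixes P x q h A C D1 D3 B0 B2 B4 :: real
  assumes P: "P > 1" and x: "x > 0" and q: "q = x ^ 2 * P ^ 5" and h: "h = x * P ^ 3"
    and e1: "B0 + A + B2 + C + B4 = q ^ 3 - 1"
    and e2: "B0 + A * P + B2 * P ^ 2 + C * P ^ 3 + B4 * P ^ 4 = q ^ 2 * (2 * q - 1) - q"
    and e3: "- B0 + A * P - B2 * P ^ 2 + C * P ^ 3 - B4 * P ^ 4 = q ^ 2 - q"
    and e4: "B0 + A * P ^ 2 + B2 * P ^ 4 + C * P ^ 6 + B4 * P ^ 8
      = q ^ 2 * (2 * q - 1) + (q - 1) * (q * (2 * P * q - P ^ 2)) - q ^ 2"
    and e5: "- B0 + A * P ^ 2 - B2 * P ^ 4 + C * P ^ 6 - B4 * P ^ 8 = q ^ 2 + (q - 1) * (q * P ^ 2) - q ^ 2"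
    and e6: "D1 * h + D3 * (P * h) = q ^ 3 - q"
    and e7: "D1 * (P * h) + D3 * (P ^ 4 * h) = q ^ 3 + (q - 1) * q ^ 2 * P - q ^ 2"
  defines "f \<equiv> x ^ 4 * P ^ 10 - x ^ 4 * P ^ 8 - x ^ 4 * P ^ 7 + x ^ 2 * P ^ 3 + x ^ 2 * P ^ 2 - 1"
  shows "C = x ^ 2 * P ^ 2 * (x ^ 2 * P ^ 4 - 1) * (x ^ 2 * P ^ 5 - 1) / (P ^ 2 - 1)"
    and "A = x ^ 2 * P ^ 6 * f / (P ^ 2 - 1)"
    and "D3 = x * P * (x ^ 2 * P ^ 4 - 1) * (x ^ 2 * P ^ 5 - 1) / (P ^ 2 - 1)"
    and "D1 = x * P ^ 4 * f / (P ^ 2 - 1)"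
    and "B4 = (x ^ 2 * P ^ 5 - 1) * (x ^ 2 * P ^ 4 - 1) * (x ^ 2 * P ^ 2 - 1) / ((P ^ 2 - 1) * (P ^ 4 - 1))"
    and "B2 = P ^ 2 * (x ^ 2 * P ^ 4 - 1) * f / (P ^ 2 - 1) ^ 2"
    and "B0 = (x ^ 2 * P ^ 5 - 1) * (x ^ 4 * P ^ 10 - x ^ 4 * P ^ 9 + x ^ 4 * P ^ 6
      + x ^ 2 * P ^ 5 - x ^ 2 * P ^ 4 - x ^ 2 * P ^ 2 + 1) - B2 - B4"
proof -
  let ?Y = "(x ^ 2 * P ^ 5 - 1) * (x ^ 4 * P ^ 10 - x ^ 4 * P ^ 9 + x ^ 4 * P ^ 6
      + x ^ 2 * P ^ 5 - x ^ 2 * P ^ 4 - x ^ 2 * P ^ 2 + 1)"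
  let ?a = "x ^ 2 * P ^ 4 - 1" and ?b = "x ^ 2 * P ^ 5 - 1" and ?c = "x ^ 2 * P ^ 2 - 1" and ?d = "P ^ 2 - 1" and ?e = "P ^ 4 - 1"
  have "P ^ 2 > 1" "P ^ 4 > 1" by (rule one_less_power[OF P], simp)+
  then have nz: "P \<noteq> 0" "x \<noteq> 0" "P ^ 2 - 1 \<noteq> 0" "P ^ 4 - 1 \<noteq> 0"
    using P x by linarith+
  \<comment> \<open>Adding a plain and a signed equation isolates odd nullity; subtracting them, as
    for \<open>b1\<close> and \<open>b2\<close> below, isolates even nullity.\<close>
  have a1: "A * P + C * P ^ 3 = q ^ 3 - q" using e2 e3 by Groebner_Basis.algebra
  have a2: "A * P ^ 2 + C * P ^ 6 = (q - 1) * q ^ 2 * (1 + P)" using e4 e5 by Groebner_Basis.algebra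
  \<comment> \<open>\<open>a2\<close> minus P times \<open>a1\<close> eliminates \<open>A\<close>
    and leaves the coefficient P^6 - P^4.\<close>
  have "P ^ 4 * (C * ?d) = P ^ 4 * (x ^ 2 * P ^ 2 * ?a * ?b)"
    using a1 a2 q by Groebner_Basis.algebra
  then have c: "C * ?d = x ^ 2 * P ^ 2 * ?a * ?b"
    using nz by (simp only: mult_left_cancel power_eq_0_iff simp_thms)
  then show C: "C = x ^ 2 * P ^ 2 * ?a * ?b / ?d"
    using nz by (simp only: eq_divide_eq simp_thms if_True if_False)
  have "P * (A * ?d) = P * (x ^ 2 * P ^ 6 * f)"
    using a1 c q unfolding f_def by Groebner_Basis.algebra
  then have a: "A * ?d = x ^ 2 * P ^ 6 * f" using nz by (simp only: mult_left_cancel simp_thms)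
  then show "A = x ^ 2 * P ^ 6 * f / ?d"
    using nz by (simp only: eq_divide_eq simp_thms if_True if_False)
  \<comment> \<open>\<open>e7\<close> minus P times \<open>e6\<close> eliminates \<open>D1\<close>;
    the coefficient left is h (P^4 - P^2) = x P^5 (P^2 - 1).\<close>
  have "(x * P ^ 5) * (D3 * ?d) = (x * P ^ 5) * (x * P * ?a * ?b)"
    using e6 e7 q h by Groebner_Basis.algebra
  then have d: "D3 * ?d = x * P * ?a * ?b"
    using nz by (simp only: mult_left_cancel mult_eq_0_iff power_eq_0_iff simp_thms)
  then show "D3 = x * P * ?a * ?b / ?d"
    using nz by (simp only: eq_divide_eq simp_thms if_True if_False)
  have "(x * P ^ 3) * (D1 * ?d) = (x * P ^ 3) * (x * P ^ 4 * f)"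
    using e6 d q h unfolding f_def by Groebner_Basis.algebra
  then have "D1 * ?d = x * P ^ 4 * f"
    using nz by (simp only: mult_left_cancel mult_eq_0_iff power_eq_0_iff simp_thms)
  then show "D1 = x * P ^ 4 * f / ?d"
    using nz by (simp only: eq_divide_eq simp_thms if_True if_False)
  have b1: "B0 + B2 * P ^ 2 + B4 * P ^ 4 = q ^ 3 - q ^ 2" using e2 e3 by Groebner_Basis.algebra
  have b2: "B0 + B2 * P ^ 4 + B4 * P ^ 8 = q ^ 3 - q ^ 2 + (q - 1) * q * (P * q - P ^ 2)"
    using e4 e5 by Groebner_Basis.algebra
  have "?d * (A + C) = ?d * (q ^ 3 - 1 - ?Y)"
    using a c q unfolding f_def by Groebner_Basis.algebra
  then have ac: "A + C = q ^ 3 - 1 - ?Y"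
    using nz by (simp only: mult_left_cancel simp_thms)
  define Y where "Y = ?Y"
  have y: "B0 = Y - B2 - B4" using e1 ac unfolding Y_def by simp
  then show "B0 = ?Y - B2 - B4" unfolding Y_def .
  have u1: "B2 * ?d + B4 * ?e = q ^ 3 - q ^ 2 - Y"
    using b1 unfolding y by (simp add: algebra_simps)
  have u2: "B2 * ?e + B4 * (P ^ 8 - 1) = q ^ 3 - q ^ 2 + (q - 1) * q * (P * q - P ^ 2) - Y"
    using b2 unfolding y by (simp add: algebra_simps)
  \<comment> \<open>P^4 - 1 = (P^2 + 1)(P^2 - 1), so this combination of \<open>u1\<close> and
    \<open>u2\<close> eliminates \<open>B2\<close>.\<close>
  have "P ^ 2 * (B4 * (?d * ?e))
      = (B2 * ?e + B4 * (P ^ 8 - 1)) - (P ^ 2 + 1) * (B2 * ?d + B4 * ?e)"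
    by Groebner_Basis.algebra
  also have "\<dots> = P ^ 2 * (?b * ?a * ?c)"
    unfolding u1 u2 q Y_def by Groebner_Basis.algebra
  finally have "P ^ 2 * (B4 * (?d * ?e)) = P ^ 2 * (?b * ?a * ?c)" .
  then have b4: "B4 * (?d * ?e) = ?b * ?a * ?c"
    using nz by (simp only: mult_left_cancel power_eq_0_iff simp_thms)
  then show "B4 = ?b * ?a * ?c / (?d * ?e)"
    using nz by (simp only: eq_divide_eq mult_eq_0_iff simp_thms if_True if_False)
  have "B2 * ?d ^ 2
      = ?d * (B2 * ?d + B4 * ?e) - B4 * (?d * ?e)"
    by Groebner_Basis.algebra
  also have "\<dots> = P ^ 2 * ?a * f"
    unfolding u1 b4 q Y_def f_def by Groebner_Basis.algebra
  finally have "B2 * ?d ^ 2 = P ^ 2 * ?a * f" .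
  then show "B2 = P ^ 2 * ?a * f / ?d ^ 2"
    using nz by (simp only: eq_divide_eq power_eq_0_iff simp_thms if_True if_False)
qed

lemma half_sum_diff:
  fixes y z u v f D :: real
  assumes "y + z = u * f / D" "y - z = v * f / D"
  shows "y = (u + v) * f / (2 * D)" "z = (u - v) * f / (2 * D)"
proof -
  have "y = (u * f / D + v * f / D) / 2" "z = (u * f / D - v * f / D) / 2"
    using assms by simp_all
  then show "y = (u + v) * f / (2 * D)" "z = (u - v) * f / (2 * D)"
    by (simp_all add: distrib_right left_diff_distrib add_divide_distrib diff_divide_distrib)
qed

section \<open>Class sizes and the distribution of the excess over the whole family\<close>

context form_family
begin

text \<open>At even nullity a class comprises both signs \<epsilon>, which are equally frequent in
  the closed formulas; hence the factors 2.\<close>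

lemma class_card_values:
  defines "p \<equiv> CARD('p)"
  shows "s = 1 \<or> s = -1 \<Longrightarrow> class_card 1 (of_int s) = n_eps_1 p m s"
    and "s = 1 \<or> s = -1 \<Longrightarrow> class_card 3 (of_int s) = n_eps_3 p m s"
    and "class_card 0 0 = 2 * n_eps_0 p m"
    and "class_card 2 0 = 2 * n_eps_2 p m"
    and "class_card 4 0 = 2 * n_eps_4 p m"
proof -
  obtain l where l: "m = 2 * l + 5" by (rule m_cases)
  define R where "R = real p"
  define x where "x = R ^ l"
  have R: "R > 1" using p_gt_1 by (simp add: R_def p_def)
  have x: "x > 0" using R by (simp add: x_def)
  have x2: "x ^ 2 = R ^ (2 * l)" "x ^ 4 = R ^ (4 * l)"
    by (simp_all add: x_def mult.commute flip: power_mult)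
  have q: "real CARD('a) = x ^ 2 * R ^ 5"
    unfolding card_F x2 R_def p_def l of_nat_power by (rule power_add)
  have h: "R ^ ((m + 1) div 2) = x * R ^ 3"
  proof -
    have "(m + 1) div 2 = l + 3" by (simp add: l)
    then show ?thesis unfolding x_def by (simp only: power_add)
  qed
  have e1: "class_card 0 0 + (class_card 1 1 + class_card 1 (-1)) + class_card 2 0
      + (class_card 3 1 + class_card 3 (-1)) + class_card 4 0 = real CARD('a) ^ 3 - 1"
    using class_equations(1) by simp
  note sol = class_system_solution[OF R x q h e1 class_equations(2-7)[folded p_def, folded R_def]]
  have pf: "poly_factor p m = x ^ 4 * R ^ 10 - x ^ 4 * R ^ 8 - x ^ 4 * R ^ 7 + x ^ 2 * R ^ 3 + x ^ 2 * R ^ 2 - 1"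
    unfolding poly_factor_def R_def[symmetric] l x2 by (simp add: power_add[symmetric] add.commute)
  have dv: "(2 * l + 5 + 3) div 2 = l + 4" "(2 * l + 5 - 3) div 2 = l + 1" by auto
  show "class_card 1 (of_int s) = n_eps_1 p m s" if "s = 1 \<or> s = -1"
  proof -
    have "n_eps_1 p m s = (x ^ 2 * R ^ 6 + of_int s * (x * R ^ 4)) * poly_factor p m / (2 * (R ^ 2 - 1))"
      unfolding n_eps_1_def R_def[symmetric] l dv x2 unfolding x_def by (simp add: power_add[symmetric] add.commute)
    then show ?thesis using that half_sum_diff[OF sol(2) sol(4)] unfolding pf
      by (elim disjE) simp_all
  qed
  show "class_card 3 (of_int s) = n_eps_3 p m s" if "s = 1 \<or> s = -1"
  proof -
    have "n_eps_3 p m s = (x ^ 2 * R ^ 2 + of_int s * (x * R)) * (x ^ 2 * R ^ 4 - 1) * (x ^ 2 * R ^ 5 - 1) / (2 * (R ^ 2 - 1))"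
      unfolding n_eps_3_def R_def[symmetric] l dv x2 unfolding x_def by (simp add: power_add[symmetric] add.commute)
    then show ?thesis using that half_sum_diff[OF sol(1)[unfolded mult.assoc[of "x ^ 2 * R ^ 2"]] sol(3)[unfolded mult.assoc[of "x * R"]]]
      by (elim disjE) (simp_all add: mult.assoc)
  qed
  have n2: "n_eps_2 p m = R ^ 2 * (x ^ 2 * R ^ 4 - 1) * poly_factor p m / (2 * (R ^ 2 - 1) ^ 2)"
    unfolding n_eps_2_def R_def[symmetric] l x2 by (simp add: power_add[symmetric] add.commute)
  show v2: "class_card 2 0 = 2 * n_eps_2 p m" unfolding n2 pf sol(6) by simp
  have n4: "n_eps_4 p m = (x ^ 2 * R ^ 5 - 1) * (x ^ 2 * R ^ 4 - 1) * (x ^ 2 * R ^ 2 - 1) / (2 * (R ^ 2 - 1) * (R ^ 4 - 1))"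
    unfolding n_eps_4_def R_def[symmetric] l x2 by (simp add: power_add[symmetric] add.commute)
  show v4: "class_card 4 0 = 2 * n_eps_4 p m" unfolding n4 sol(5) by (simp add: mult.assoc del: right_diff_distrib_numeral)
  have "n_eps_0 p m = 1 / 2 * (x ^ 2 * R ^ 5 - 1) * (x ^ 4 * R ^ 10 - x ^ 4 * R ^ 9 + x ^ 4 * R ^ 6
      + x ^ 2 * R ^ 5 - x ^ 2 * R ^ 4 - x ^ 2 * R ^ 2 + 1) - n_eps_2 p m - n_eps_4 p m"
    unfolding n_eps_0_def R_def[symmetric] l x2 by (simp add: power_add[symmetric] add.commute)
  then show "class_card 0 0 = 2 * n_eps_0 p m" using sol(7) v2 v4 by (simp add: algebra_simps)
qed

text \<open>Even nullity is odd rank here. The excess is written as R z because z is then the amount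
  by which the weight falls short of (p - 1) p^(m-1).\<close>

lemma even_nullity_excess:
  fixes z :: real
  assumes "form_class c = (i, s)" "even i" "i \<le> 4"
  defines "R \<equiv> real CARD('p)"
  shows "real (card {d. fam.excess c d = R * z}) =
    of_bool (z = 0) * (R ^ m - R ^ (m - i) + R ^ (m - i - 1)) +
    of_bool (z = R ^ ((m + i - 1) div 2)) * ((R - 1) / 2 * (R ^ (m - i - 1) + R ^ ((m - i - 1) div 2))) +
    of_bool (z = - (R ^ ((m + i - 1) div 2))) * ((R - 1) / 2 * (R ^ (m - i - 1) - R ^ ((m - i - 1) div 2)))"
proof -
  have "even (m - i - 1)" "m \<ge> i + 1" using assms odd_m m_ge by auto
  then obtain r where "m - i - 1 = 2 * r" by blast
  \<comment> \<open>With this parametrization all powers become monomials in R, R^i and R^r, and the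
    common factor R^(i+1) can be cancelled.\<close>
  then have r: "m = i + 1 + 2 * r" using \<open>m \<ge> i + 1\<close> by simp
  let ?q = "R * (R ^ i * (R ^ r * R ^ r))"
  let ?h = "R ^ i * R ^ r"
  let ?n = "R ^ r * R ^ r"
  let ?u = "of_bool (z = 0) :: real"
  let ?v = "of_bool (z = ?h) :: real"
  let ?w = "of_bool (z = - ?h) :: real"
  have R: "R > 0" using p_gt_1 by (simp add: R_def)
  have n: "fam.nullity c = i" "real (card (fam.ker c)) = R ^ i"
    using form_classD[OF assms(1)] by (simp_all add: R_def kerc_def)
  have "odd (m - fam.nullity c)" using n assms odd_m m_ge by simp
  then obtain s' :: real where s': "s' = 1 \<or> s' = -1"
    "\<And>l. l \<noteq> 0 \<Longrightarrow> fam.esum c l 0 = of_real (quad_char l) * fam.esum c 1 0"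
    "fam.esum c 1 0 * gauss_sum = of_real (s' * real CARD('p) ^ ((m + fam.nullity c + 1) div 2))"
    using fam.odd_rank_esum by metis
  have ex: "(m + i + 1) div 2 = Suc (i + r)" "(m + i - 1) div 2 = i + r" "m - i - 1 = 2 * r" "(m - i - 1) div 2 = r"
    "m - i = 2 * r + 1" using r by auto
  have q: "real CARD('a) = ?q"
    by (simp add: card_F R_def r power_add mult_2 mult_2_right mult_ac)
  have Rm: "R ^ m = ?q" using q card_F by (simp add: R_def)
  have g: "R ^ Suc (i + r) = R * ?h" by (simp add: power_add)
  have eqv: "R * z = R * ?h \<longleftrightarrow> z = ?h" "R * z = - (R * ?h) \<longleftrightarrow> z = - ?h"
    "R * z = 0 \<longleftrightarrow> z = 0"
    using R by (auto simp flip: mult_minus_right)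
  define N where "N = real (card {d. fam.excess c d = R * z})"
  have main: "R * (R ^ i * N) =
    ?u * (R * (?q * R ^ i - ?q) + ?q) +
    ?v * ((R - 1) / 2 * (?q + R * ?h)) +
    ?w * ((R - 1) / 2 * (?q - R * ?h))"
    using fam.odd_rank_excess_dist[OF s'(2,3,1), of "R * z"]
    unfolding n ex(1) R_def[symmetric] g eqv q N_def .
  have "R * (R ^ i * N) = R * (R ^ i * (
    ?u * (?q - R * ?n + ?n) +
    ?v * ((R - 1) / 2 * (?n + R ^ r)) +
    ?w * ((R - 1) / 2 * (?n - R ^ r))))"
    unfolding main by (simp add: algebra_simps)
  then have "N = ?u * (?q - R * ?n + ?n) +
    ?v * ((R - 1) / 2 * (?n + R ^ r)) +
    ?w * ((R - 1) / 2 * (?n - R ^ r))"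
    using R by (simp only: mult_left_cancel power_eq_0_iff less_irrefl simp_thms) (metis mult_left_cancel less_irrefl power_not_zero)
  moreover have "R ^ (2 * r) = ?n" "R ^ (2 * r + 1) = R * ?n"
    by (simp_all add: power_add mult_2)
  ultimately show ?thesis unfolding N_def ex Rm power_add by simp
qed

lemma odd_nullity_excess:
  fixes z :: real
  assumes "form_class c = (i, s)" "odd i" "i \<le> 3" "s = 1 \<or> s = -1"
  defines "R \<equiv> real CARD('p)"
  shows "real (card {d. fam.excess c d = R * z}) =
    of_bool (z = 0) * (R ^ m - R ^ (m - i)) +
    of_bool (z = s * ((R - 1) * R ^ ((m + i - 2) div 2))) * (R ^ (m - i - 1) + s * (R - 1) * R ^ ((m - i - 2) div 2)) +
    of_bool (z = - s * R ^ ((m + i - 2) div 2)) * ((R - 1) * (R ^ (m - i - 1) - s * R ^ ((m - i - 2) div 2)))"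
proof -
  have "even (m - i - 2)" "m \<ge> i + 2" using assms odd_m m_ge by auto
  then obtain r where "m - i - 2 = 2 * r" by blast
  then have r: "m = i + 2 + 2 * r" using \<open>m \<ge> i + 2\<close> by simp
  let ?q = "R * (R ^ i * (R * (R ^ r * R ^ r)))"
  let ?h = "R ^ i * R ^ r"
  let ?n = "R * (R ^ r * R ^ r)"
  let ?u = "of_bool (z = 0) :: real"
  let ?v = "of_bool (z = s * ((R - 1) * ?h)) :: real"
  let ?w = "of_bool (z = - s * ?h) :: real"
  have R: "R > 0" using p_gt_1 by (simp add: R_def)
  have n: "fam.nullity c = i" "real (card (fam.ker c)) = R ^ i" "Gval c = s * R ^ ((m + i) div 2)"
    using form_classD[OF assms(1)] by (simp_all add: R_def kerc_def)
  have ev: "even (m - fam.nullity c)" using n assms odd_m m_ge by simp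
  have ex: "(m + i) div 2 = Suc (i + r)" "(m + i - 2) div 2 = i + r" "m - i - 1 = 2 * r + 1" "(m - i - 2) div 2 = r"
    "m - i = 2 * r + 2" using r by auto
  have q: "real CARD('a) = ?q"
    by (simp add: card_F R_def r power_add mult_2 mult_2_right mult_ac power2_eq_square)
  have Rm: "R ^ m = ?q" using q card_F by (simp add: R_def)
  have g: "R ^ Suc (i + r) = R * ?h" by (simp add: power_add)
  have G: "Gval c = R * (s * ?h)" unfolding n(3) ex(1) g by (simp only: mult_ac)
  have eqv: "R * z = (R - 1) * (R * (s * ?h)) \<longleftrightarrow> z = s * ((R - 1) * ?h)"
    "R * z = - (R * (s * ?h)) \<longleftrightarrow> z = - s * ?h" "R * z = 0 \<longleftrightarrow> z = 0"
  proof -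
    have "(R - 1) * (R * (s * ?h)) = R * (s * ((R - 1) * ?h))" by (simp only: mult_ac)
    show "R * z = (R - 1) * (R * (s * ?h)) \<longleftrightarrow> z = s * ((R - 1) * ?h)"
      unfolding \<open>(R - 1) * (R * (s * ?h)) = R * (s * ((R - 1) * ?h))\<close> using R by simp
    have "- (R * (s * ?h)) = R * (- s * ?h)" by simp
    then show "R * z = - (R * (s * ?h)) \<longleftrightarrow> z = - s * ?h" using R by (metis mult_left_cancel less_irrefl)
  qed (use R in simp)
  define N where "N = real (card {d. fam.excess c d = R * z})"
  have main: "R * (R ^ i * N) =
    ?u * (R * (?q * R ^ i - ?q)) +
    ?v * (?q + (R - 1) * (R * (s * ?h))) +
    ?w * ((R - 1) * (?q - R * (s * ?h)))"
    using fam.even_rank_excess_dist[OF Gval_even[OF ev], of "R * z"]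
    unfolding n(2) G R_def[symmetric] eqv q N_def .
  have "R * (R ^ i * N) = R * (R ^ i * (
    ?u * (?q - R * ?n) +
    ?v * (?n + s * (R - 1) * R ^ r) +
    ?w * ((R - 1) * (?n - s * R ^ r))))"
    unfolding main by (simp add: algebra_simps)
  then have "N = ?u * (?q - R * ?n) +
    ?v * (?n + s * (R - 1) * R ^ r) +
    ?w * ((R - 1) * (?n - s * R ^ r))"
    using R by (simp only: mult_left_cancel power_eq_0_iff less_irrefl simp_thms) (metis mult_left_cancel less_irrefl power_not_zero)
  moreover have pw: "R ^ (2 * r + 1) = ?n" "R ^ (2 * r + 2) = R * ?n"
    "R ^ (i + r) = ?h"
    by (simp_all add: power_add mult_2 power2_eq_square)
  ultimately show ?thesis unfolding N_def[symmetric] ex(1-4) unfolding ex(5) Rm pw by (simp only:)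
qed

text \<open>These are the words tr(d x). All d \<noteq> 0 are balanced, and d = 0 is the zero word,
  which falls short by the full (p - 1) p^(m-1).\<close>

lemma zero_form_excess:
  fixes z :: real
  shows "real (card {d. fam.excess (0, 0, 0) d = real CARD('p) * z}) =
    of_bool (z = 0) * (real CARD('p) ^ m - 1) + of_bool (z = (real CARD('p) - 1) * real CARD('p) ^ (m - 1))"
proof -
  define R where "R = real CARD('p)"
  define Q where "Q = R ^ (m - 1)"
  define N where "N = real (card {d. fam.excess (0, 0, 0) d = R * z})"
  have R: "R > 0" "Q > 0" using p_gt_1 by (simp_all add: R_def Q_def)
  have "real CARD('a) = R ^ Suc (m - 1)" using m_pos by (simp add: card_F R_def)
  then have q: "real CARD('a) = R * Q" by (simp add: Q_def)
  have k: "real (card (fam.ker (0, 0, 0))) = R * Q" using zero_form(4) q by (simp add: kerc_def)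
  have e: "fam.esum (0, 0, 0) l 0 = of_real (R * Q)" if "l \<noteq> 0" for l
    using zero_form(3)[of l] q by (metis of_real_of_nat_eq)
  have eqv: "R * z = (R - 1) * (R * Q) \<longleftrightarrow> z = (R - 1) * Q" "R * z = 0 \<longleftrightarrow> z = 0"
    using R by (simp_all add: mult.left_commute[of "R - 1"])
  have "R * (R * Q * N) = of_bool (z = 0) * (R * (R * Q * (R * Q) - R * Q)) +
     of_bool (z = (R - 1) * Q) * (R * Q + (R - 1) * (R * Q)) + of_bool (R * z = - (R * Q)) * ((R - 1) * (R * Q - R * Q))"
    using fam.even_rank_excess_dist[OF e, of "R * z"] unfolding k q R_def[symmetric] eqv N_def .
  also have "\<dots> = R * (R * Q * (of_bool (z = 0) * (R * Q - 1) + of_bool (z = (R - 1) * Q)))"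
    by (simp add: algebra_simps)
  finally have "N = of_bool (z = 0) * (R * Q - 1) + of_bool (z = (R - 1) * Q)"
    using R by simp
  moreover have "R ^ m = R * Q" using q by (simp add: card_F R_def)
  ultimately show ?thesis by (simp add: N_def R_def Q_def)
qed

text \<open>The zero form comes first, then one group of terms per class. Indicators let
  contributions from different classes to the same weight add up; for instance z = a collects
  nullity 0 and nullity 1 with negative sign.\<close>

lemma excess_frequency:
  fixes z :: real
  defines "R \<equiv> real CARD('p)" and "a \<equiv> real CARD('p) ^ ((m - 1) div 2)" and "p \<equiv> CARD('p)"
  shows "real (card {(c, d). fam.excess c d = R * z}) =
    of_bool (z = 0) * (R ^ m - 1) + of_bool (z = (R - 1) * R ^ (m - 1)) +
    2 * n_eps_0 p m * (of_bool (z = 0) * R ^ (m - 1) + of_bool (z = a) * ((R - 1) / 2 * (R ^ (m - 1) + R ^ ((m - 1) div 2)))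
      + of_bool (z = - a) * ((R - 1) / 2 * (R ^ (m - 1) - R ^ ((m - 1) div 2)))) +
    n_eps_1 p m 1 * (of_bool (z = 0) * (R ^ m - R ^ (m - 1)) + of_bool (z = (R - 1) * a) * (R ^ (m - 2) + (R - 1) * R ^ ((m - 3) div 2))
      + of_bool (z = - a) * ((R - 1) * (R ^ (m - 2) - R ^ ((m - 3) div 2)))) +
    n_eps_1 p m (-1) * (of_bool (z = 0) * (R ^ m - R ^ (m - 1)) + of_bool (z = - ((R - 1) * a)) * (R ^ (m - 2) - (R - 1) * R ^ ((m - 3) div 2))
      + of_bool (z = a) * ((R - 1) * (R ^ (m - 2) + R ^ ((m - 3) div 2)))) +
    2 * n_eps_2 p m * (of_bool (z = 0) * (R ^ m - R ^ (m - 2) + R ^ (m - 3)) + of_bool (z = R * a) * ((R - 1) / 2 * (R ^ (m - 3) + R ^ ((m - 3) div 2)))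
      + of_bool (z = - (R * a)) * ((R - 1) / 2 * (R ^ (m - 3) - R ^ ((m - 3) div 2)))) +
    n_eps_3 p m 1 * (of_bool (z = 0) * (R ^ m - R ^ (m - 3)) + of_bool (z = (R - 1) * (R * a)) * (R ^ (m - 4) + (R - 1) * R ^ ((m - 5) div 2))
      + of_bool (z = - (R * a)) * ((R - 1) * (R ^ (m - 4) - R ^ ((m - 5) div 2)))) +
    n_eps_3 p m (-1) * (of_bool (z = 0) * (R ^ m - R ^ (m - 3)) + of_bool (z = - ((R - 1) * (R * a))) * (R ^ (m - 4) - (R - 1) * R ^ ((m - 5) div 2))
      + of_bool (z = R * a) * ((R - 1) * (R ^ (m - 4) + R ^ ((m - 5) div 2)))) +
    2 * n_eps_4 p m * (of_bool (z = 0) * (R ^ m - R ^ (m - 4) + R ^ (m - 5)) + of_bool (z = R ^ 2 * a) * ((R - 1) / 2 * (R ^ (m - 5) + R ^ ((m - 5) div 2)))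
      + of_bool (z = - (R ^ 2 * a)) * ((R - 1) / 2 * (R ^ (m - 5) - R ^ ((m - 5) div 2))))"
proof -
  let ?u = "of_bool (z = 0) :: real"
  obtain l where l: "m = 2 * l + 5" by (rule m_cases)
  define g :: "nat \<Rightarrow> real \<Rightarrow> real" where "g i s = (if even i then
      ?u * (R ^ m - R ^ (m - i) + R ^ (m - i - 1)) +
      of_bool (z = R ^ ((m + i - 1) div 2)) * ((R - 1) / 2 * (R ^ (m - i - 1) + R ^ ((m - i - 1) div 2))) +
      of_bool (z = - (R ^ ((m + i - 1) div 2))) * ((R - 1) / 2 * (R ^ (m - i - 1) - R ^ ((m - i - 1) div 2)))
    else ?u * (R ^ m - R ^ (m - i)) +
      of_bool (z = s * ((R - 1) * R ^ ((m + i - 2) div 2))) * (R ^ (m - i - 1) + s * (R - 1) * R ^ ((m - i - 2) div 2)) +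
      of_bool (z = - s * R ^ ((m + i - 2) div 2)) * ((R - 1) * (R ^ (m - i - 1) - s * R ^ ((m - i - 2) div 2))))" for i s
  have g: "real (card {d. fam.excess c d = R * z}) = g i s" if c: "c \<noteq> (0, 0, 0)" "form_class c = (i, s)" for c i s
  proof -
    have mem: "(i, s) \<in> form_classes" using form_class_mem[OF c(1)] c(2) by simp
    show ?thesis
    proof (cases "even i")
      case True
      moreover have "i \<le> 4" using mem by (auto simp: form_classes_def)
      ultimately show ?thesis unfolding g_def R_def using even_nullity_excess[OF c(2)] by simp
    next
      case False
      moreover have "i \<le> 3" "s = 1 \<or> s = -1" using mem False by (auto simp: form_classes_def)
      ultimately show ?thesis unfolding g_def R_def using odd_nullity_excess[OF c(2)] by simp
    qed
  qed
  have "card {(c, d). fam.excess c d = R * z} = card (SIGMA c:UNIV. {d. fam.excess c d = R * z})"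
    by (rule arg_cong[where f = card]) auto
  also have "\<dots> = (\<Sum>c\<in>UNIV. card {d. fam.excess c d = R * z})" by (rule card_SigmaI) auto
  finally have "real (card {(c, d). fam.excess c d = R * z}) = (\<Sum>c\<in>UNIV. real (card {d. fam.excess c d = R * z}))"
    by simp
  also have "\<dots> = ?u * (R ^ m - 1) + of_bool (z = (R - 1) * R ^ (m - 1)) +
    (2 * n_eps_0 p m * g 0 0 + n_eps_1 p m 1 * g 1 1 + n_eps_1 p m (-1) * g 1 (-1)
     + 2 * n_eps_2 p m * g 2 0 + n_eps_3 p m 1 * g 3 1 + n_eps_3 p m (-1) * g 3 (-1) + 2 * n_eps_4 p m * g 4 0)"
    using sum_by_class[of "\<lambda>c. real (card {d. fam.excess c d = R * z})" g, OF g] zero_form_excess[of z]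
      class_card_values(1)[of 1] class_card_values(1)[of "-1"] class_card_values(2)[of 1] class_card_values(2)[of "-1"]
      class_card_values(3-5)
    by (simp add: R_def p_def)
  moreover have "g 0 0 = ?u * R ^ (m - 1) + of_bool (z = a) * ((R - 1) / 2 * (R ^ (m - 1) + R ^ ((m - 1) div 2)))
      + of_bool (z = - a) * ((R - 1) / 2 * (R ^ (m - 1) - R ^ ((m - 1) div 2)))"
    by (simp add: g_def a_def R_def)
  moreover have "g 1 1 = ?u * (R ^ m - R ^ (m - 1)) + of_bool (z = (R - 1) * a) * (R ^ (m - 2) + (R - 1) * R ^ ((m - 3) div 2))
      + of_bool (z = - a) * ((R - 1) * (R ^ (m - 2) - R ^ ((m - 3) div 2)))"
    by (simp add: g_def a_def R_def numeral_eq_Suc)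
  moreover have "g 1 (-1) = ?u * (R ^ m - R ^ (m - 1)) + of_bool (z = - ((R - 1) * a)) * (R ^ (m - 2) - (R - 1) * R ^ ((m - 3) div 2))
      + of_bool (z = a) * ((R - 1) * (R ^ (m - 2) + R ^ ((m - 3) div 2)))"
    by (simp add: g_def a_def R_def numeral_eq_Suc) (simp add: left_diff_distrib)
  moreover have dv: "(m + 2 - 1) div 2 = l + 3" "(m + 3 - 2) div 2 = l + 3" "(m + 4 - 1) div 2 = l + 4"
    by (simp_all add: l)
  have "(m - 1) div 2 = l + 2" by (simp add: l)
  then have pa: "R ^ (l + 3) = R * a" "R ^ (l + 4) = R ^ 2 * a"
    unfolding a_def by (simp_all add: R_def power_add numeral_eq_Suc)
  have "g 2 0 = ?u * (R ^ m - R ^ (m - 2) + R ^ (m - 3)) + of_bool (z = R * a) * ((R - 1) / 2 * (R ^ (m - 3) + R ^ ((m - 3) div 2)))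
      + of_bool (z = - (R * a)) * ((R - 1) / 2 * (R ^ (m - 3) - R ^ ((m - 3) div 2)))"
    unfolding g_def pa[symmetric] dv by simp
  moreover have "g 3 1 = ?u * (R ^ m - R ^ (m - 3)) + of_bool (z = (R - 1) * (R * a)) * (R ^ (m - 4) + (R - 1) * R ^ ((m - 5) div 2))
      + of_bool (z = - (R * a)) * ((R - 1) * (R ^ (m - 4) - R ^ ((m - 5) div 2)))"
    unfolding g_def pa[symmetric] dv by simp
  moreover have "g 3 (-1) = ?u * (R ^ m - R ^ (m - 3)) + of_bool (z = - ((R - 1) * (R * a))) * (R ^ (m - 4) - (R - 1) * R ^ ((m - 5) div 2))
      + of_bool (z = R * a) * ((R - 1) * (R ^ (m - 4) + R ^ ((m - 5) div 2)))"
    unfolding g_def pa[symmetric] dv by (simp, simp add: left_diff_distrib)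
  moreover have "g 4 0 = ?u * (R ^ m - R ^ (m - 4) + R ^ (m - 5)) + of_bool (z = R ^ 2 * a) * ((R - 1) / 2 * (R ^ (m - 5) + R ^ ((m - 5) div 2)))
      + of_bool (z = - (R ^ 2 * a)) * ((R - 1) / 2 * (R ^ (m - 5) - R ^ ((m - 5) div 2)))"
    unfolding g_def pa[symmetric] dv by simp
  ultimately show ?thesis by (simp only: add.assoc)
qed

end

subsection \<open>Codes as sets of multiples of a polynomial\<close>

lemma monom_minus_1:
  assumes "n > 0"
  shows "monom 1 n - 1 \<noteq> (0 :: 'k::comm_ring_1 poly)" "degree (monom 1 n - 1 :: 'k poly) = n"
proof -
  have c: "coeff (monom 1 n - 1 :: 'k poly) n = 1" using assms by simp
  then show "monom 1 n - 1 \<noteq> (0 :: 'k poly)" by (metis coeff_0 zero_neq_one)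
  have "degree (monom 1 n - 1 :: 'k poly) \<le> n" by (intro degree_diff_le) (simp_all add: degree_monom_le)
  then show "degree (monom 1 n - 1 :: 'k poly) = n" using c le_degree[of "monom 1 n - 1 :: 'k poly" n] by simp
qed

abbreviation vec_poly :: "'k::zero vec \<Rightarrow> 'k poly" where
  "vec_poly v \<equiv> Poly (list_of_vec v)"

lemma coeff_vec_poly: "coeff (vec_poly v) i = (if i < dim_vec v then v $ i else 0)"
  by (simp add: nth_default_def)

lemma vec_poly_degree: "vec_poly v = 0 \<or> degree (vec_poly v) < dim_vec v"
proof -
  have "degree (vec_poly v) < dim_vec v" if "vec_poly v \<noteq> 0"
  proof (rule ccontr)
    assume "\<not> ?thesis"
    then have "coeff (vec_poly v) (degree (vec_poly v)) = 0" by (simp only: coeff_vec_poly if_False)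
    then show False using that leading_coeff_0_iff by blast
  qed
  then show ?thesis by blast
qed

lemma vec_poly_inject:
  assumes "dim_vec u = dim_vec v" "vec_poly u = vec_poly v" shows "u = v"
proof (rule eq_vecI)
  fix i assume "i < dim_vec v"
  then show "u $ i = v $ i"
    using assms coeff_vec_poly[of u i] coeff_vec_poly[of v i] by metis
qed (rule assms(1))

lemma vec_poly_add:
  fixes u v :: "'k::comm_monoid_add vec"
  assumes "dim_vec u = dim_vec v" shows "vec_poly (u + v) = vec_poly u + vec_poly v"
  by (rule poly_eqI) (simp add: coeff_vec_poly assms del: coeff_Poly_eq)

lemma vec_poly_smult: "vec_poly (a \<cdot>\<^sub>v v) = smult a (vec_poly v)" for v :: "'k::comm_semiring_0 vec"
  by (rule poly_eqI) (simp add: coeff_vec_poly del: coeff_Poly_eq)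

lemma vec_poly_zero: "vec_poly (0\<^sub>v n) = 0"
  by (rule poly_eqI) (simp add: coeff_vec_poly del: coeff_Poly_eq)

lemma card_polys_bounded_degree:
  "finite {u :: 'k::{finite,zero} poly. u = 0 \<or> degree u < d} \<and>
   card {u :: 'k poly. u = 0 \<or> degree u < d} \<le> CARD('k) ^ d"
proof -
  let ?S = "{u :: 'k poly. u = 0 \<or> degree u < d}"
  let ?f = "\<lambda>u :: 'k poly. restrict (coeff u) {..<d}"
  have inj: "inj_on ?f ?S"
  proof (rule inj_onI)
    fix u v assume uv: "u \<in> ?S" "v \<in> ?S" and eq: "?f u = ?f v"
    show "u = v"
    proof (rule poly_eqI)
      fix i
      show "coeff u i = coeff v i"
      proof (cases "i < d")
        case True
        then show ?thesis using fun_cong[OF eq, of i] by simp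
      next
        case False
        then show ?thesis using uv by (auto simp: coeff_eq_0)
      qed
    qed
  qed
  have sub: "?f ` ?S \<subseteq> {..<d} \<rightarrow>\<^sub>E UNIV" by (intro image_subsetI) (simp add: restrict_PiE_iff)
  have fin: "finite ({..<d} \<rightarrow>\<^sub>E (UNIV :: 'k set))" by (simp add: finite_PiE)
  have "card ?S = card (?f ` ?S)" by (rule card_image[OF inj, symmetric])
  also have "\<dots> \<le> card ({..<d} \<rightarrow>\<^sub>E (UNIV :: 'k set))" by (rule card_mono[OF fin sub])
  also have "\<dots> = CARD('k) ^ d" by (simp add: card_PiE)
  finally show ?thesis using inj_on_finite[OF inj sub fin] by blast
qed

text \<open>Division by \<open>G\<close> is injective into the polynomials of degree below n - deg
  G. An upper bound is enough, since the number of trace words matches it from below.\<close>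

lemma card_multiples:
  fixes G :: "'k::{field,finite} poly"
  assumes "G \<noteq> 0" "degree G \<le> n"
  shows "finite {v \<in> carrier_vec n. G dvd vec_poly v} \<and>
    card {v \<in> carrier_vec n. G dvd vec_poly v} \<le> CARD('k) ^ (n - degree G)"
proof -
  let ?S = "{v \<in> carrier_vec n. G dvd vec_poly v}"
  let ?U = "{u :: 'k poly. u = 0 \<or> degree u < n - degree G}"
  let ?f = "\<lambda>v. vec_poly v div G"
  have fin: "finite ?U" and cU: "card ?U \<le> CARD('k) ^ (n - degree G)"
    using card_polys_bounded_degree by blast+
  have inj: "inj_on ?f ?S"
  proof (rule inj_onI)
    fix u v assume "u \<in> ?S" "v \<in> ?S" "?f u = ?f v"
    then have "vec_poly u = vec_poly v" by (metis (mono_tags, lifting) dvd_div_mult_self mem_Collect_eq)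
    then show "u = v" using \<open>u \<in> ?S\<close> \<open>v \<in> ?S\<close> by (intro vec_poly_inject) auto
  qed
  have sub: "?f ` ?S \<subseteq> ?U"
  proof (intro image_subsetI CollectI)
    fix v assume v: "v \<in> ?S"
    then have "G dvd vec_poly v" by simp
    then obtain u where u: "vec_poly v = G * u" by (rule dvdE)
    have "u = 0 \<or> degree u < n - degree G"
    proof (cases "u = 0")
      case False
      then have "vec_poly v \<noteq> 0" "degree (vec_poly v) = degree G + degree u"
        using u assms(1) by (simp_all add: degree_mult_eq)
      then have "degree u + degree G < n" using vec_poly_degree[of v] v by auto
      then show ?thesis by (simp only: less_diff_conv simp_thms)
    qed simp
    then show "?f v = 0 \<or> degree (?f v) < n - degree G" using u assms(1) by simp
  qed
  have "card ?S = card (?f ` ?S)" by (rule card_image[OF inj, symmetric])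
  also have "\<dots> \<le> card ?U" by (rule card_mono[OF fin sub])
  finally show ?thesis using cU inj_on_finite[OF inj sub fin] by simp
qed

lemma linear_code_multiples:
  fixes G :: "'k::field poly"
  shows "linear_code n {v \<in> carrier_vec n. G dvd vec_poly v}"
  unfolding linear_code_def subspace_def submodule_def
  using vec_vs[of n] vec_module[of n]
  by (auto simp: module_vec_simps vec_poly_add vec_poly_smult vec_poly_zero class_ring_simps dvd_smult)

text \<open>The shift is multiplication by X, corrected by a multiple of X^n - 1 that moves the top
  coefficient to the constant term.\<close>

lemma vec_poly_cyclic_shift:
  fixes v :: "'k::comm_ring_1 vec"
  assumes "dim_vec v = n" "n > 0"
  shows "vec_poly (cyclic_shift v) = monom 1 1 * vec_poly v - smult (v $ (n - 1)) (monom 1 n - 1)"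
proof (rule poly_eqI)
  fix i
  have mod: "(i + n - 1) mod n = (if i = 0 then n - 1 else i - 1)" if "i < n"
  proof (cases i)
    case (Suc j)
    then have "i + n - 1 = j + n" by simp
    then show ?thesis using Suc that by simp
  qed (use assms in simp)
  have "coeff (monom 1 1 * vec_poly v) i = (if i = 0 then 0 else coeff (vec_poly v) (i - 1))"
    by (simp add: coeff_monom_mult del: coeff_Poly_eq)
  moreover have "coeff (vec_poly (cyclic_shift v)) i = (if i < n then v $ ((i + n - 1) mod n) else 0)"
    by (simp only: coeff_vec_poly) (simp add: cyclic_shift_def assms)
  ultimately show "coeff (vec_poly (cyclic_shift v)) i
      = coeff (monom 1 1 * vec_poly v - smult (v $ (n - 1)) (monom 1 n - 1)) i"
    unfolding coeff_diff coeff_smult coeff_vec_poly assms(1) using assms(2) mod by auto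
qed

lemma cyclic_code_multiples:
  fixes G :: "'k::field poly"
  assumes "n > 0" "G dvd monom 1 n - 1"
  shows "cyclic_code n {v \<in> carrier_vec n. G dvd vec_poly v}"
  unfolding cyclic_code_def
proof (intro conjI ballI)
  fix c assume c: "c \<in> {v \<in> carrier_vec n. G dvd vec_poly v}"
  then have "dim_vec c = n" by auto
  then have "G dvd vec_poly (cyclic_shift c)"
    unfolding vec_poly_cyclic_shift[OF \<open>dim_vec c = n\<close> assms(1)]
    using c assms(2) by (intro dvd_diff[OF dvd_mult dvd_smult]) simp_all
  then show "cyclic_shift c \<in> {v \<in> carrier_vec n. G dvd vec_poly v}"
    using \<open>dim_vec c = n\<close> by (auto simp: cyclic_shift_def intro: carrier_vecI)
qed (rule linear_code_multiples)

text \<open>Coordinates with respect to a basis. It allows the dimension of a code to be read off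
  from its size.\<close>

lemma (in vectorspace) card_carrier_eq_power_dim:
  assumes "finite (carrier V)" "finite (carrier K)"
  shows "card (carrier V) = card (carrier K) ^ dim"
proof -
  have "gen_set (carrier V)"
    using in_own_span[of "carrier V"] span_is_subset2[of "carrier V"] by auto
  then have "fin_dim" unfolding fin_dim_def using assms(1) by blast
  then obtain B where B: "finite B" "basis B" using finite_basis_exists by blast
  then have Bc: "B \<subseteq> carrier V" by (simp add: basis_def)
  have "bij_betw (\<lambda>a. lincomb a B) (B \<rightarrow>\<^sub>E carrier K) (carrier V)"
    unfolding bij_betw_def
  proof (intro conjI inj_onI equalityI subsetI)
    fix v assume "v \<in> (\<lambda>a. lincomb a B) ` (B \<rightarrow>\<^sub>E carrier K)"
    then show "v \<in> carrier V" using Bc by (auto simp: PiE_def intro!: lincomb_closed)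
  next
    fix v assume "v \<in> carrier V"
    then obtain a where "a \<in> B \<rightarrow>\<^sub>E carrier K" "lincomb a B = v"
      using basis_criterion[OF B(1) Bc] B(2) by blast
    then show "v \<in> (\<lambda>a. lincomb a B) ` (B \<rightarrow>\<^sub>E carrier K)" by blast
  next
    fix a b assume ab: "a \<in> B \<rightarrow>\<^sub>E carrier K" "b \<in> B \<rightarrow>\<^sub>E carrier K" "lincomb a B = lincomb b B"
    have "lincomb a B \<in> carrier V" using ab(1) Bc by (auto simp: PiE_def intro!: lincomb_closed)
    then show "a = b" using basis_criterion[OF B(1) Bc] B(2) ab by metis
  qed
  then have "card (carrier V) = card (B \<rightarrow>\<^sub>E carrier K)" by (metis bij_betw_same_card)
  then show ?thesis using dim_basis[OF B] B(1) by (simp add: card_PiE)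
qed

lemma card_linear_code:
  fixes C :: "'k::{field,finite} vec set"
  assumes "linear_code n C" "finite C"
  shows "card C = CARD('k) ^ code_dim n C"
proof -
  interpret V: vectorspace "class_ring :: 'k ring" "module_vec TYPE('k) n" by (rule vec_vs)
  interpret W: vectorspace "class_ring :: 'k ring" "(module_vec TYPE('k) n)\<lparr>carrier := C\<rparr>"
    using V.subspace_is_vs assms(1) unfolding linear_code_def .
  show ?thesis using W.card_carrier_eq_power_dim assms(2) unfolding code_dim_def by simp
qed

text \<open>A distance is the weight of a difference, which is again a codeword; the bound is
  attained by \<open>u\<close> and the zero word.\<close>

lemma min_distance_linear:
  fixes C :: "'k::{field,finite} vec set"
  assumes lin: "linear_code n C" and fin: "finite C" and w: "u \<in> C" "hamming_weight u = w" "w > 0"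
    and min: "\<And>v. v \<in> C \<Longrightarrow> hamming_weight v = 0 \<or> w \<le> hamming_weight v"
  shows "min_distance C = w"
proof -
  have sub: "submodule class_ring C (module_vec TYPE('k) n)"
    using lin by (simp add: linear_code_def subspace_def)
  have Cn: "C \<subseteq> carrier_vec n" using submodule.subset[OF sub] by (simp add: module_vec_simps)
  have diff: "x - y \<in> C" if "x \<in> C" "y \<in> C" for x y
  proof -
    have "(-1) \<cdot>\<^sub>v y \<in> C" using submodule.smult_closed[OF sub, of "-1" y] that by (simp add: module_vec_simps)
    then have "x + (-1) \<cdot>\<^sub>v y \<in> C" using submodule.m_closed[OF sub, of x] that by (simp add: module_vec_simps)
    moreover have "x + (-1) \<cdot>\<^sub>v y = x - y" using that Cn by (intro eq_vecI) auto
    ultimately show ?thesis by simp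
  qed
  have zero: "0\<^sub>v n \<in> C" using submodule.zero_closed[OF sub] by (simp add: module_vec_simps)
  have dist: "hamming_distance x y = hamming_weight (x - y)" if "x \<in> C" "y \<in> C" for x y
  proof -
    have "dim_vec x = n" "dim_vec y = n" using that Cn by auto
    then have "{i. i < dim_vec x \<and> x $ i \<noteq> y $ i} = {i. i < dim_vec (x - y) \<and> (x - y) $ i \<noteq> 0}" by auto
    then show ?thesis by (simp add: hamming_distance_def hamming_weight_def)
  qed
  have pos: "hamming_weight (x - y) \<noteq> 0" if "x \<in> C" "y \<in> C" "x \<noteq> y" for x y
  proof
    assume "hamming_weight (x - y) = 0"
    have d: "dim_vec x = n" "dim_vec y = n" using that Cn by auto
    have "{i. i < dim_vec (x - y) \<and> (x - y) $ i \<noteq> 0} = {}"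
      using \<open>hamming_weight (x - y) = 0\<close> by (simp add: hamming_weight_def)
    then have "x = y" using d by (intro eq_vecI) auto
    then show False using that by blast
  qed
  have Dfin: "finite {hamming_distance u v | u v. u \<in> C \<and> v \<in> C \<and> u \<noteq> v}"
    by (rule finite_subset[of _ "(\<lambda>(u, v). hamming_distance u v) ` (C \<times> C)"]) (use fin in auto)
  show ?thesis
    unfolding min_distance_def
  proof (rule Min_eqI[OF Dfin])
    fix d assume "d \<in> {hamming_distance u v | u v. u \<in> C \<and> v \<in> C \<and> u \<noteq> v}"
    then obtain x y where "x \<in> C" "y \<in> C" "x \<noteq> y" "d = hamming_weight (x - y)" using dist by auto
    then show "w \<le> d" using min[OF diff] pos by metis
  next
    have "u - 0\<^sub>v n = u" using w(1) Cn by (intro eq_vecI) auto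
    then have "hamming_distance u (0\<^sub>v n) = w" using dist[OF w(1) zero] w by simp
    moreover have "hamming_weight (0\<^sub>v n :: 'k vec) = 0"
      unfolding hamming_weight_def by (rule card_eq_0_iff[THEN iffD2]) auto
    then have "u \<noteq> 0\<^sub>v n" using w by auto
    ultimately show "w \<in> {hamming_distance u v | u v. u \<in> C \<and> v \<in> C \<and> u \<noteq> v}"
      using w(1) zero by blast
  qed
qed

subsection \<open>Minimal polynomials and evaluation\<close>

context prime_field_ext
begin

definition ev :: "'a \<Rightarrow> 'p mod_ring poly \<Rightarrow> 'a" where
  "ev b f = poly (map_poly emb f) b"

lemma ev_eq_sum:
  assumes "\<And>j. j \<ge> n \<Longrightarrow> coeff f j = 0"
  shows "ev b f = (\<Sum>j<n. emb (coeff f j) * b ^ j)"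
proof -
  have "degree (map_poly emb f) = degree f"
    by (rule degree_map_poly) simp
  then have "ev b f = (\<Sum>j\<le>degree f. emb (coeff f j) * b ^ j)"
    by (simp add: ev_def poly_altdef coeff_map_poly)
  also have "\<dots> = (\<Sum>j<n. emb (coeff f j) * b ^ j)"
    by (rule sum.mono_neutral_cong) (auto simp: coeff_eq_0 assms)
  finally show ?thesis .
qed

lemma comm_ring_hom_emb: "comm_ring_hom emb"
  by unfold_locales (simp_all add: emb_add emb_mult)

lemma ev_add: "ev b (f + g) = ev b f + ev b g"
  and ev_mult: "ev b (f * g) = ev b f * ev b g"
  and ev_diff: "ev b (f - g) = ev b f - ev b g"
  and ev_monom: "ev b (monom a i) = emb a * b ^ i"
  and ev_0 [simp]: "ev b 0 = 0"
  and ev_1 [simp]: "ev b 1 = 1"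
proof -
  interpret comm_ring_hom emb by (rule comm_ring_hom_emb)
  interpret h: map_poly_comm_ring_hom emb ..
  show add: "ev b (f + g) = ev b f + ev b g" for f g by (simp add: ev_def h.hom_add)
  show "ev b (f * g) = ev b f * ev b g" by (simp add: ev_def h.hom_mult)
  show "ev b (f - g) = ev b f - ev b g" using add[of "f - g" g] by simp
  show "ev b (monom a i) = emb a * b ^ i" by (simp add: ev_def poly_monom)
  show "ev b 0 = 0" by (simp add: ev_def)
  show "ev b 1 = 1" by (simp add: ev_def)
qed

text \<open>The coefficients lie in the prime field and are fixed by Frobenius, so the conjugates of
  a root are roots.\<close>

lemma ev_frob: "ev (frob i b) f = frob i (ev b f)"
proof -
  have z: "coeff f j = 0" if "j \<ge> Suc (degree f)" for j using that by (simp add: coeff_eq_0)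
  have "ev (frob i b) f = (\<Sum>j<Suc (degree f). emb (coeff f j) * frob i b ^ j)" by (rule ev_eq_sum[OF z])
  also have "\<dots> = frob i (\<Sum>j<Suc (degree f). emb (coeff f j) * b ^ j)"
    by (simp only: frob_sum frob_mult frob_emb frob_power)
  also have "\<dots> = frob i (ev b f)" by (simp only: ev_eq_sum[OF z])
  finally show ?thesis .
qed

lemma power_card_minus_1: "b \<noteq> 0 \<Longrightarrow> b ^ (CARD('a) - 1) = 1" for b :: 'a
proof -
  assume b: "b \<noteq> 0"
  have "b ^ CARD('a) = b" using frob_m[of b] by (simp add: frob_def card_F)
  then have "b ^ (CARD('a) - 1) * b = 1 * b"
    using power_minus_mult[of "CARD('a)" b] by simp
  then show ?thesis using b by (simp only: mult_cancel_right simp_thms)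
qed

lemma card_F_gt_1: "CARD('a) > 1"
  unfolding card_F by (rule one_less_power[OF p_gt_1 m_pos])

text \<open>X^(q-1) - 1 vanishes at all nonzero elements, so the remainder of \<open>f\<close>
  vanishes at q - 1 points while its degree is smaller.\<close>

lemma dvd_if_ev_zero:
  assumes "\<And>b. b \<noteq> 0 \<Longrightarrow> ev b f = 0"
  shows "monom 1 (CARD('a) - 1) - 1 dvd f"
proof -
  define n where "n = CARD('a) - 1"
  define X where "X = monom (1 :: 'p mod_ring) n - 1"
  have n0: "n > 0" using card_F_gt_1 by (simp add: n_def)
  have X0: "X \<noteq> 0" and dX: "degree X = n" unfolding X_def by (rule monom_minus_1[OF n0])+
  define r where "r = f mod X"
  have "ev b r = 0" if "b \<noteq> 0" for b
  proof -
    have "f = X * (f div X) + r" by (simp add: r_def)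
    then have "ev b f = ev b X * ev b (f div X) + ev b r" by (metis ev_add ev_mult)
    moreover have "ev b X = 0" using power_card_minus_1[OF that] by (simp add: X_def n_def ev_diff ev_monom)
    ultimately show ?thesis using assms[OF that] by simp
  qed
  then have "UNIV - {0} \<subseteq> {b. poly (map_poly emb r) b = 0}" by (auto simp: ev_def)
  then have cr: "n \<le> card {b. poly (map_poly emb r) b = 0}"
    using card_mono[of "{b. poly (map_poly emb r) b = 0}" "UNIV - {0}"] by (simp add: n_def card_Diff_singleton)
  have "r = 0"
  proof (rule ccontr)
    assume r0: "r \<noteq> 0"
    then have dr: "degree r < n" using degree_mod_less[OF X0, of f] dX by (simp add: r_def)
    have "degree (map_poly emb r) = degree r" by (rule degree_map_poly) simp
    moreover have "map_poly emb r \<noteq> 0"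
    proof
      assume "map_poly emb r = 0"
      then have "emb (coeff r (degree r)) = 0" by (metis coeff_0 coeff_map_poly emb_0)
      then show False using r0 by simp
    qed
    ultimately have "card {b. poly (map_poly emb r) b = 0} \<le> degree r"
      using card_poly_roots_bound[of "map_poly emb r"] by simp
    then show False using cr dr by simp
  qed
  then show ?thesis by (simp add: r_def X_def n_def dvd_eq_mod_eq_0)
qed

text \<open>Pigeonhole: p^(m+1) coefficient vectors take at most p^m values at x, and the difference
  of two colliding vectors is the annihilator.\<close>

lemma ex_annihilator: "\<exists>f. f \<noteq> 0 \<and> ev x f = 0 \<and> degree f \<le> m"
proof -
  let ?D = "{..<Suc m} \<rightarrow>\<^sub>E (UNIV :: 'p mod_ring set)"
  let ?f = "\<lambda>g. \<Sum>j<Suc m. emb (g j) * x ^ j"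
  have "card ?D = CARD('p) ^ Suc m" by (simp add: card_PiE)
  moreover have "CARD('p) ^ m < CARD('p) ^ Suc m" using p_gt_1 by simp
  moreover have "card (?f ` ?D) \<le> CARD('p) ^ m"
    unfolding card_F[symmetric] by (rule card_mono) simp_all
  ultimately have "card (?f ` ?D) < card ?D" by linarith
  then have "\<not> inj_on ?f ?D" using card_image by fastforce
  then obtain g g' where g: "g \<in> ?D" "g' \<in> ?D" "?f g = ?f g'" "g \<noteq> g'" by (auto simp: inj_on_def)
  define u where "u = (\<Sum>j<Suc m. monom (g j - g' j) j)"
  have cu: "coeff u i = (if i < Suc m then g i - g' i else 0)" for i
    by (simp add: u_def coeff_sum if_distrib cong: if_cong)
  have "u \<noteq> 0"
  proof
    assume "u = 0"
    have "g = g'"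
    proof (rule PiE_ext[OF g(1,2)])
      fix i assume "i \<in> {..<Suc m}"
      then show "g i = g' i" using cu[of i] \<open>u = 0\<close> by simp
    qed
    then show False using g by simp
  qed
  moreover have "ev x u = 0"
  proof -
    have "ev x u = (\<Sum>j<Suc m. emb (coeff u j) * x ^ j)" by (rule ev_eq_sum) (simp add: cu)
    also have "\<dots> = ?f g - ?f g'"
      unfolding sum_subtractf[symmetric]
      by (rule sum.cong) (auto simp: cu emb_diff left_diff_distrib)
    finally show ?thesis using g(3) by simp
  qed
  moreover have "degree u \<le> m" by (rule degree_le) (simp add: cu)
  ultimately show ?thesis by blast
qed

text \<open>A least-degree annihilator is made monic. Two such polynomials have the same degree, so
  their difference drops in degree and must be zero; this uniqueness justifies the definite
  description.\<close>

lemma minimal_poly_correct: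
  "is_minimal_poly (minimal_poly x :: 'p mod_ring poly) (x :: 'a)"
  "degree (minimal_poly x :: 'p mod_ring poly) \<le> m"
proof -
  let ?A = "\<lambda>f. f \<noteq> 0 \<and> ev x f = 0"
  obtain f0 where f0: "?A f0" "degree f0 \<le> m" using ex_annihilator by blast
  define f where "f = arg_min degree ?A"
  have f: "?A f" "\<And>g. ?A g \<Longrightarrow> degree f \<le> degree g"
    using arg_min_nat_lemma[of ?A f0 degree] f0 unfolding f_def by auto
  define h where "h = smult (inverse (lead_coeff f)) f"
  have lc: "lead_coeff f \<noteq> 0" using f by simp
  have "h = monom (inverse (lead_coeff f)) 0 * f" by (simp add: h_def monom_0)
  then have "ev x h = 0" using f by (simp add: ev_mult)
  moreover have "lead_coeff h = 1" "degree h = degree f" using lc by (simp_all add: h_def)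
  ultimately have h: "is_minimal_poly h x" using f by (simp add: is_minimal_poly_def ev_def[symmetric])
  have uniq: "g = h" if g: "is_minimal_poly g x" for g
  proof (rule ccontr)
    assume "g \<noteq> h"
    have nz: "g \<noteq> 0" "h \<noteq> 0" using g h by (auto simp: is_minimal_poly_def)
    have e: "ev x g = 0" "ev x h = 0" using g h by (auto simp: is_minimal_poly_def ev_def)
    have dg: "degree g = degree h"
      using g h nz e unfolding is_minimal_poly_def ev_def[symmetric] by (meson le_antisym)
    have "degree g \<le> degree (g - h)"
      using g \<open>g \<noteq> h\<close> e unfolding is_minimal_poly_def ev_def[symmetric] by (simp add: ev_diff)
    moreover have "degree (g - h) \<le> degree g" using dg by (intro degree_diff_le) auto
    ultimately have "degree (g - h) = degree g" by simp
    then have "lead_coeff (g - h) = lead_coeff g - lead_coeff h" using dg by simp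
    then have "lead_coeff (g - h) = 0" using g h by (simp add: is_minimal_poly_def)
    then have "g - h = 0" by (simp only: leading_coeff_0_iff)
    then show False using \<open>g \<noteq> h\<close> by simp
  qed
  have "is_minimal_poly (minimal_poly x :: 'p mod_ring poly) x"
    unfolding minimal_poly_def by (rule theI[of _ h]) (rule h, erule uniq)
  then show "is_minimal_poly (minimal_poly x :: 'p mod_ring poly) x" .
  then have "minimal_poly x = h" by (rule uniq)
  then show "degree (minimal_poly x :: 'p mod_ring poly) \<le> m"
    using f(2)[OF f0(1)] f0(2) \<open>degree h = degree f\<close> by simp
qed

lemma ev_minimal_poly: "ev x (minimal_poly x) = 0"
  using minimal_poly_correct(1) by (simp add: is_minimal_poly_def ev_def)

lemma minimal_poly_nonzero: "(minimal_poly (x :: 'a) :: 'p mod_ring poly) \<noteq> 0"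
  using minimal_poly_correct(1)[of x] by (auto simp: is_minimal_poly_def)

text \<open>The power sum of a trace sequence at \<open>b\<close> is a combination of geometric sums with ratios \<open>b\<close> times a
  conjugate of \<open>y\<close>;
  these vanish unless \<open>b\<close> is a conjugate of \<open>y\<^sup>-\<^sup>1\<close>.\<close>

lemma minimal_poly_annihilates:
  assumes "y \<noteq> 0" "b \<noteq> 0"
  shows "ev b (minimal_poly (inverse y)) * (\<Sum>t<CARD('a) - 1. emb (tr (a * y ^ t)) * b ^ t) = 0"
proof (cases "\<exists>i. frob i y * b = 1")
  case True
  then obtain i where "frob i y * b = 1" by blast
  then have "b = 1 / frob i y" using assms by (simp add: field_simps)
  also have "\<dots> = frob i (inverse y)" by (simp add: inverse_eq_divide frob_divide)
  finally have "ev b (minimal_poly (inverse y)) = frob i (ev (inverse y) (minimal_poly (inverse y)))"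
    by (simp only: ev_frob)
  then show ?thesis by (simp add: ev_minimal_poly)
next
  case False
  have geo: "(\<Sum>t<CARD('a) - 1. (frob i y * b) ^ t) = 0" for i
  proof -
    have "(frob i y * b) ^ (CARD('a) - 1) = 1" using assms by (intro power_card_minus_1) simp
    then have "(frob i y * b - 1) * (\<Sum>t<CARD('a) - 1. (frob i y * b) ^ t) = 0"
      using power_diff_1_eq[of "frob i y * b" "CARD('a) - 1"] by simp
    moreover have "frob i y * b - 1 \<noteq> 0" using False by simp
    ultimately show ?thesis by simp
  qed
  have "(\<Sum>t<CARD('a) - 1. emb (tr (a * y ^ t)) * b ^ t)
      = (\<Sum>t<CARD('a) - 1. \<Sum>i<m. frob i a * (frob i y * b) ^ t)"
    by (rule sum.cong) (simp_all add: emb_tr sum_distrib_right frob_mult frob_power power_mult_distrib mult.assoc)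
  also have "\<dots> = (\<Sum>i<m. \<Sum>t<CARD('a) - 1. frob i a * (frob i y * b) ^ t)" by (rule sum.swap)
  also have "\<dots> = (\<Sum>i<m. frob i a * (\<Sum>t<CARD('a) - 1. (frob i y * b) ^ t))"
    by (simp only: sum_distrib_left)
  also have "\<dots> = 0" by (simp only: geo mult_zero_right sum.neutral_const)
  finally show ?thesis by simp
qed

end

subsection \<open>The cyclic code as a trace code\<close>

locale trace_code = form_family P F m k
  for P :: "'p::prime_card itself" and F :: "'a::{field,finite} itself" and m k +
  fixes \<pi> :: 'a
  assumes prim: "primitive_element \<pi>"
begin

definition len :: nat where "len = CARD('a) - 1"

definition cw :: "'a \<times> 'a \<times> 'a \<Rightarrow> 'a \<Rightarrow> 'p mod_ring vec" where
  "cw c d = vec len (\<lambda>t. Qf c (\<pi> ^ t) + tr (d * \<pi> ^ t))"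

lemma len_pos: "len > 0"
  using card_F_gt_1 by (simp add: len_def)

lemma pi_nonzero: "\<pi> \<noteq> 0"
  using prim unfolding primitive_element_def by (metis DiffD2 power_one_right rangeI singletonI)

lemma bij_powers: "bij_betw (\<lambda>t. \<pi> ^ t) {..<len} (UNIV - {0})"
proof -
  have "(\<lambda>t. \<pi> ^ t) ` {..<len} = UNIV - {0}"
  proof (intro equalityI subsetI)
    fix x :: 'a assume "x \<in> UNIV - {0}"
    then obtain i :: nat where i: "x = \<pi> ^ i" using prim unfolding primitive_element_def by blast
    have "\<pi> ^ i = \<pi> ^ (len * (i div len) + i mod len)" by simp
    also have "\<dots> = (\<pi> ^ len) ^ (i div len) * \<pi> ^ (i mod len)" by (simp only: power_add power_mult)
    also have "\<dots> = \<pi> ^ (i mod len)" using power_card_minus_1[OF pi_nonzero] by (simp add: len_def)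
    finally show "x \<in> (\<lambda>t. \<pi> ^ t) ` {..<len}" using i len_pos by auto
  qed (use pi_nonzero in auto)
  moreover from this have "inj_on (\<lambda>t. \<pi> ^ t) {..<len}"
    by (intro eq_card_imp_inj_on) (simp_all add: len_def card_Diff_singleton)
  ultimately show ?thesis by (simp add: bij_betw_def)
qed

text \<open>The coordinates run over the nonzero x only, but x = 0 always gives the value 0 and may
  be included.\<close>

lemma hamming_weight_cw: "hamming_weight (cw c d) = card {x. Qf c x + tr (d * x) \<noteq> 0}"
proof -
  let ?T = "{t. t < len \<and> Qf c (\<pi> ^ t) + tr (d * \<pi> ^ t) \<noteq> 0}"
  have "(\<lambda>t. \<pi> ^ t) ` ?T = {x. Qf c x + tr (d * x) \<noteq> 0}"
  proof (intro equalityI subsetI)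
    fix x assume x: "x \<in> {x. Qf c x + tr (d * x) \<noteq> 0}"
    then have "x \<noteq> 0" by (intro notI) simp
    then have "x \<in> (\<lambda>t. \<pi> ^ t) ` {..<len}" using bij_powers by (simp add: bij_betw_def)
    then show "x \<in> (\<lambda>t. \<pi> ^ t) ` ?T" using x by blast
  qed blast
  moreover have "inj_on (\<lambda>t. \<pi> ^ t) ?T"
    using bij_powers unfolding bij_betw_def by (auto intro: inj_on_subset)
  ultimately have bij: "bij_betw (\<lambda>t. \<pi> ^ t) ?T {x. Qf c x + tr (d * x) \<noteq> 0}" by (simp add: bij_betw_def)
  have "{i. i < dim_vec (cw c d) \<and> cw c d $ i \<noteq> 0} = ?T" by (auto simp: cw_def)
  then show ?thesis unfolding hamming_weight_def using bij_betw_same_card[OF bij] by simp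
qed

lemma weight_excess:
  "real CARD('p) * real (hamming_weight (cw c d)) = (real CARD('p) - 1) * real CARD('a) - fam.excess c d"
proof -
  have "{x. Qf c x + tr (d * x) \<noteq> 0} = UNIV - {x. Qf c x + tr (d * x) = 0}" by auto
  then have "real (hamming_weight (cw c d)) = real CARD('a) - real (card {x. Qf c x + tr (d * x) = 0})"
    unfolding hamming_weight_cw by (simp only:) (simp add: card_Diff_subset of_nat_diff card_mono)
  then have z: "real (card {x. Qf c x + tr (d * x) = 0}) = real CARD('a) - real (hamming_weight (cw c d))"
    by simp
  show ?thesis unfolding fam.excess_def z by (simp add: algebra_simps)
qed

lemma weight_eq_iff:
  "int (hamming_weight (cw c d)) = (int CARD('p) - 1) * int CARD('p) ^ (m - 1) - z
    \<longleftrightarrow> fam.excess c d = real CARD('p) * of_int z"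
proof -
  have q: "real CARD('a) = real CARD('p) * real CARD('p) ^ (m - 1)"
    using m_pos by (simp add: card_F flip: power_Suc)
  have p: "real CARD('p) > 0" using p_gt_1 by simp
  have "int (hamming_weight (cw c d)) = (int CARD('p) - 1) * int CARD('p) ^ (m - 1) - z
      \<longleftrightarrow> (of_int (int (hamming_weight (cw c d))) :: real) = of_int ((int CARD('p) - 1) * int CARD('p) ^ (m - 1) - z)"
    by (simp only: of_int_eq_iff)
  also have "\<dots> \<longleftrightarrow> real (hamming_weight (cw c d)) = (real CARD('p) - 1) * real CARD('p) ^ (m - 1) - of_int z"
    by simp
  also have "\<dots> \<longleftrightarrow> real CARD('p) * real (hamming_weight (cw c d)) = real CARD('p) * ((real CARD('p) - 1) * real CARD('p) ^ (m - 1) - of_int z)"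
    using p by simp
  also have "real CARD('p) * ((real CARD('p) - 1) * real CARD('p) ^ (m - 1) - of_int z)
      = (real CARD('p) - 1) * real CARD('a) - real CARD('p) * of_int z"
    unfolding q by (simp add: algebra_simps)
  finally show ?thesis unfolding weight_excess by auto
qed

lemma p_ge_3: "CARD('p) \<ge> 3"
proof -
  have "CARD('p) \<noteq> 2" using odd_p by auto
  then show ?thesis using p_gt_1 by linarith
qed

text \<open>The strict ordering makes the indicators in \<open>excess_frequency\<close> mutually
  exclusive. It also shows that, apart from the zero word, no word falls short by more than R^2 a.
  The steps from x to (R - 1) x use p \<ge> 3.\<close>

lemma weight_chain:
  defines "R \<equiv> real CARD('p)" and "a \<equiv> real CARD('p) ^ ((m - 1) div 2)"
  shows "0 < a" "a < (R - 1) * a" "(R - 1) * a < R * a" "R * a < (R - 1) * (R * a)"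
    "(R - 1) * (R * a) < R ^ 2 * a" "R ^ 2 * a < (R - 1) * R ^ (m - 1)"
proof -
  obtain l where l: "m = 2 * l + 5" by (rule m_cases)
  have R: "R \<ge> 3" using p_ge_3 by (simp add: R_def)
  then show a: "0 < a" by (simp add: a_def R_def)
  have "1 * a < (R - 1) * a" using R a by (intro mult_strict_right_mono) auto
  then show "a < (R - 1) * a" by simp
  show "(R - 1) * a < R * a" using a by (simp add: algebra_simps)
  have "1 * (R * a) < (R - 1) * (R * a)" using R a by (intro mult_strict_right_mono) auto
  then show "R * a < (R - 1) * (R * a)" by simp
  have "(R - 1) * (R * a) < R * (R * a)" using R a by (intro mult_strict_right_mono) auto
  then show "(R - 1) * (R * a) < R ^ 2 * a" by (simp add: power2_eq_square mult.assoc)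
  have aR: "a = R ^ (l + 2)" by (simp add: a_def R_def l)
  have "R ^ 2 * a = R ^ (l + 4)" unfolding aR power_add[symmetric] by (rule arg_cong[where f = "\<lambda>n. R ^ n"]) simp
  also have "\<dots> \<le> R ^ (m - 1)" using R by (intro power_increasing) (auto simp: l)
  also have "\<dots> < (R - 1) * R ^ (m - 1)" using R by simp
  finally show "R ^ 2 * a < (R - 1) * R ^ (m - 1)" .
qed

text \<open>Weight 0 corresponds to z = (p - 1) p^(m-1), beyond all values that nonzero forms can
  produce, so only the zero form contributes.\<close>

lemma card_weight_zero: "card {(c, d). hamming_weight (cw c d) = 0} = 1"
proof -
  define R where "R = real CARD('p)"
  define a where "a = real CARD('p) ^ ((m - 1) div 2)"
  define w where "w = (R - 1) * R ^ (m - 1)"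
  note ch = weight_chain[folded R_def a_def, folded w_def]
  have w: "w > 0" "w \<noteq> a" "w \<noteq> - a" "w \<noteq> (R - 1) * a" "w \<noteq> - ((R - 1) * a)" "w \<noteq> R * a" "w \<noteq> - (R * a)"
    "w \<noteq> (R - 1) * (R * a)" "w \<noteq> - ((R - 1) * (R * a))" "w \<noteq> R ^ 2 * a" "w \<noteq> - (R ^ 2 * a)"
    using ch by linarith+
  have "real (card {(c, d). fam.excess c d = R * w}) = 1"
    unfolding excess_frequency[folded R_def a_def, folded w_def] using w by simp
  moreover have "hamming_weight (cw c d) = 0 \<longleftrightarrow> fam.excess c d = R * w" for c d
    using weight_eq_iff[of c d "(int CARD('p) - 1) * int CARD('p) ^ (m - 1)"] by (simp add: R_def w_def)
  ultimately show ?thesis by simp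
qed

lemma Qf_diff: "Qf (al - al', be - be', ga - ga') x = Qf (al, be, ga) x - Qf (al', be', ga') x"
  by (simp add: Qf_def tr_diff[symmetric] algebra_simps)

text \<open>Words are additive in the parameters, so the difference of the parameters of two equal
  words gives a word of weight 0, and only one parameter does that.\<close>

lemma inj_cw: "inj (\<lambda>(c, d). cw c d)"
proof (rule injI)
  fix u v assume eq: "(case u of (c, d) \<Rightarrow> cw c d) = (case v of (c, d) \<Rightarrow> cw c d)"
  obtain al be ga d where u: "u = ((al, be, ga), d)" by (metis surj_pair)
  obtain al' be' ga' d' where v: "v = ((al', be', ga'), d')" by (metis surj_pair)
  have e: "Qf (al, be, ga) (\<pi> ^ t) + tr (d * \<pi> ^ t) = Qf (al', be', ga') (\<pi> ^ t) + tr (d' * \<pi> ^ t)" if "t < len" for t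
  proof -
    have "cw (al, be, ga) d $ t = cw (al', be', ga') d' $ t" using eq u v by simp
    then show ?thesis using that by (simp add: cw_def)
  qed
  let ?w = "cw (al - al', be - be', ga - ga') (d - d')"
  have "{i. i < dim_vec ?w \<and> ?w $ i \<noteq> 0} = {}"
    using e by (auto simp: cw_def Qf_diff left_diff_distrib tr_diff algebra_simps)
  then have "hamming_weight ?w = 0" by (simp add: hamming_weight_def)
  moreover have "hamming_weight (cw (0, 0, 0) 0) = 0"
  proof -
    have "{i. i < dim_vec (cw (0, 0, 0) 0) \<and> cw (0, 0, 0) 0 $ i \<noteq> 0} = {}" by (auto simp: cw_def zero_form)
    then show ?thesis by (simp add: hamming_weight_def)
  qed
  moreover obtain z where "{(c, d). hamming_weight (cw c d) = 0} = {z}"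
    using card_weight_zero by (auto simp: card_1_singleton_iff)
  then have "\<And>c d. hamming_weight (cw c d) = 0 \<Longrightarrow> (c, d) = z" by blast
  ultimately have "((al - al', be - be', ga - ga'), d - d') = ((0, 0, 0), 0)" by metis
  then show "u = v" using u v by simp
qed

definition parity_poly :: "'p mod_ring poly" where
  "parity_poly = minimal_poly (inverse \<pi>) * minimal_poly (inverse (\<pi> ^ 2))
    * minimal_poly (inverse (\<pi> ^ (CARD('p) ^ k + 1))) * minimal_poly (inverse (\<pi> ^ (CARD('p) ^ (2 * k) + 1)))"

lemma parity_poly_nonzero: "parity_poly \<noteq> 0"
  by (simp add: parity_poly_def minimal_poly_nonzero)

lemma degree_parity_poly: "degree parity_poly \<le> 4 * m"
proof -
  have "degree parity_poly = degree (minimal_poly (inverse \<pi>) :: 'p mod_ring poly)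
      + degree (minimal_poly (inverse (\<pi> ^ 2)) :: 'p mod_ring poly)
      + degree (minimal_poly (inverse (\<pi> ^ (CARD('p) ^ k + 1))) :: 'p mod_ring poly)
      + degree (minimal_poly (inverse (\<pi> ^ (CARD('p) ^ (2 * k) + 1))) :: 'p mod_ring poly)"
    unfolding parity_poly_def by (simp add: degree_mult_eq minimal_poly_nonzero)
  then show ?thesis
    using minimal_poly_correct(2)[of "inverse \<pi>"] minimal_poly_correct(2)[of "inverse (\<pi> ^ 2)"]
      minimal_poly_correct(2)[of "inverse (\<pi> ^ (CARD('p) ^ k + 1))"]
      minimal_poly_correct(2)[of "inverse (\<pi> ^ (CARD('p) ^ (2 * k) + 1))"] by linarith
qed

text \<open>A word is a sum of four trace sequences whose ratios are the powers of \<pi> inverted in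
  \<open>parity_poly\<close>. At every nonzero b each evaluated sequence is killed by its own
  factor.\<close>

lemma parity_poly_annihilates: "monom 1 len - 1 dvd parity_poly * vec_poly (cw c d)"
  unfolding len_def
proof (rule dvd_if_ev_zero)
  fix b :: 'a assume b: "b \<noteq> 0"
  let ?y3 = "\<pi> ^ (CARD('p) ^ (2 * k) + 1)"
  let ?y2 = "\<pi> ^ (CARD('p) ^ k + 1)"
  obtain al be ga where c: "c = (al, be, ga)" by (cases c)
  define S where "S y a = (\<Sum>t<CARD('a) - 1. emb (tr (a * y ^ t)) * b ^ t)" for y a
  have cwt: "cw c d $ t = tr (al * ?y3 ^ t) + tr (be * ?y2 ^ t)
      + tr (ga * (\<pi> ^ 2) ^ t) + tr (d * \<pi> ^ t)" if "t < len" for t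
  proof -
    have "frob i (\<pi> ^ t) * \<pi> ^ t = (\<pi> ^ (CARD('p) ^ i + 1)) ^ t" for i
      by (simp add: frob_def power_mult_distrib power_add mult.commute flip: power_mult)
    moreover have "(\<pi> ^ t) ^ 2 = (\<pi> ^ 2) ^ t" by (simp add: mult.commute flip: power_mult)
    ultimately show ?thesis using that by (simp only: cw_def index_vec c Qf_def prod.case tr_add)
  qed
  have z: "coeff (vec_poly (cw c d)) j = (if j < len then cw c d $ j else 0)" for j
    by (simp only: coeff_vec_poly) (simp add: cw_def)
  have "ev b (vec_poly (cw c d)) = (\<Sum>t<len. emb (coeff (vec_poly (cw c d)) t) * b ^ t)"
    by (rule ev_eq_sum) (simp only: z, simp)
  also have "\<dots> = (\<Sum>t<len. emb (tr (al * ?y3 ^ t) + tr (be * ?y2 ^ t)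
      + tr (ga * (\<pi> ^ 2) ^ t) + tr (d * \<pi> ^ t)) * b ^ t)"
    by (rule sum.cong[OF refl]) (simp only: z cwt lessThan_iff if_True)
  also have "\<dots> = S ?y3 al + S ?y2 be + S (\<pi> ^ 2) ga + S \<pi> d"
    by (simp only: S_def len_def emb_add distrib_right sum.distrib)
  finally have W: "ev b (vec_poly (cw c d)) = S ?y3 al + S ?y2 be
      + S (\<pi> ^ 2) ga + S \<pi> d" .
  have A: "ev b (minimal_poly (inverse y)) * S y a = 0" if "y \<noteq> 0" for y a
    unfolding S_def by (rule minimal_poly_annihilates[OF that b])
  have y: "\<pi> ^ n \<noteq> 0" for n using pi_nonzero by simp
  note A' = A[OF pi_nonzero, of d] A[OF y[of 2], of ga] A[OF y[of "CARD('p) ^ k + 1"], of be]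
    A[OF y[of "CARD('p) ^ (2 * k) + 1"], of al]
  show "ev b (parity_poly * vec_poly (cw c d)) = 0"
    unfolding ev_mult W parity_poly_def using A' by (auto simp del: power_add power_Suc)
qed

abbreviation trace_words :: "'p mod_ring vec set" where
  "trace_words \<equiv> range (\<lambda>(c, d). cw c d)"

lemma card_range_cw: "card (trace_words) = CARD('p) ^ (4 * m)"
proof -
  have "card (trace_words) = CARD(('a \<times> 'a \<times> 'a) \<times> 'a)"
    by (rule card_image[OF inj_cw])
  also have "\<dots> = (CARD('p) ^ m) ^ 4" by (simp add: card_F power4_eq_xxxx)
  finally show ?thesis by (simp add: mult.commute flip: power_mult)
qed

text \<open>Let \<open>h'\<close> be an annihilator of all trace words of least degree. It divides both \<open>x\<^sup>n - 1\<close> and the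
  parity-check polynomial, and counting the words annihilated by it forces \<open>deg h' \<ge> 4m\<close>. Hence the
  parity-check polynomial is \<open>h'\<close> up to a unit; in particular its four factors are distinct.\<close>

lemma parity_poly_structure:
  shows "degree parity_poly = 4 * m" and "parity_poly dvd monom 1 len - 1"
proof -
  define X where "X = monom (1 :: 'p mod_ring) len - 1"
  have X0: "X \<noteq> 0" and dX: "degree X = len" unfolding X_def by (rule monom_minus_1[OF len_pos])+
  let ?I = "\<lambda>f. f \<noteq> 0 \<and> (\<forall>c d. X dvd f * vec_poly (cw c d))"
  define h where "h = arg_min degree ?I"
  have IX: "?I X" using X0 by simp
  have IH: "?I parity_poly" using parity_poly_annihilates parity_poly_nonzero by (simp add: X_def)
  have h: "?I h" "\<And>f. ?I f \<Longrightarrow> degree h \<le> degree f"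
    using arg_min_nat_lemma[of ?I X degree] IX unfolding h_def by blast+
  \<comment> \<open>The remainder modulo \<open>h\<close> of an annihilator is again an annihilator,
    so it must be zero by minimality.\<close>
  have dvd: "h dvd f" if "?I f" for f
  proof (rule ccontr)
    assume "\<not> h dvd f"
    then have r0: "f mod h \<noteq> 0" by (simp add: dvd_eq_mod_eq_0)
    have "X dvd (f mod h) * vec_poly (cw c d)" for c d
    proof -
      have "(f mod h) * vec_poly (cw c d) = f * vec_poly (cw c d) - (f div h) * (h * vec_poly (cw c d))"
        by (simp add: minus_mult_div_eq_mod[symmetric] algebra_simps)
      moreover have "X dvd f * vec_poly (cw c d)" "X dvd h * vec_poly (cw c d)" using that h(1) by blast+
      ultimately show ?thesis by (simp only: dvd_diff dvd_mult)
    qed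
    then have "degree h \<le> degree (f mod h)" using r0 h(2) by blast
    then show False using degree_mod_less[of h f] r0 h(1) by simp
  qed
  obtain g where g: "X = h * g" using dvd[OF IX] by (rule dvdE)
  have g0: "g \<noteq> 0" using g X0 by auto
  have dg: "len = degree h + degree g" using g g0 h(1) dX by (simp add: degree_mult_eq)
  \<comment> \<open>With X = h g, divisibility of h times a word by X is divisibility of the word by
    g.\<close>
  have "trace_words \<subseteq> {v \<in> carrier_vec len. g dvd vec_poly v}"
  proof (intro subsetI)
    fix v assume "v \<in> trace_words"
    then obtain c d where v: "v = cw c d" by auto
    have "X dvd h * vec_poly (cw c d)" using h(1) by blast
    then have "h * g dvd h * vec_poly v" by (simp only: g v)
    then have "g dvd vec_poly v" using h(1) by simp
    then show "v \<in> {v \<in> carrier_vec len. g dvd vec_poly v}" using v by (simp add: cw_def)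
  qed
  note sub = this
  have "degree g \<le> len" using dg by simp
  note cm = card_multiples[OF g0 this]
  have "CARD('p) ^ (4 * m) \<le> card {v \<in> carrier_vec len. g dvd vec_poly v}"
    unfolding card_range_cw[symmetric] by (rule card_mono[OF conjunct1[OF cm] sub])
  also have "\<dots> \<le> CARD('p) ^ degree h" using conjunct2[OF cm] dg by simp
  finally have "4 * m \<le> degree h" using p_gt_1 by simp
  moreover have "h dvd parity_poly" by (rule dvd[OF IH])
  then obtain u where u: "parity_poly = h * u" by (rule dvdE)
  have u0: "u \<noteq> 0" using u parity_poly_nonzero by auto
  have "degree parity_poly = degree h + degree u" using u u0 h(1) by (simp add: degree_mult_eq)
  ultimately show "degree parity_poly = 4 * m" using degree_parity_poly by simp
  have "degree u = 0" using \<open>degree parity_poly = degree h + degree u\<close> \<open>4 * m \<le> degree h\<close> degree_parity_poly by simp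
  then have "is_unit u" using u0 by (simp add: is_unit_iff_degree)
  then have "u dvd g" by (rule unit_imp_dvd)
  then have "parity_poly dvd X" unfolding u g by (rule mult_dvd_mono[OF dvd_refl])
  then show "parity_poly dvd monom 1 len - 1" by (simp add: X_def)
qed

definition code :: "'p mod_ring vec set" where
  "code = code_of_parity_check len parity_poly"

text \<open>The trace words lie in the code and number p^(4m), while the code has at most p^(deg
  parity_poly) = p^(4m) elements.\<close>

lemma code_eq_range:
  "code = trace_words"
  "cyclic_code len code"
proof -
  define X where "X = monom (1 :: 'p mod_ring) len - 1"
  define G where "G = X div parity_poly"
  have X: "X = parity_poly * G" using parity_poly_structure(2) by (simp add: G_def X_def)
  have X0: "X \<noteq> 0" and dX: "degree X = len" unfolding X_def by (rule monom_minus_1[OF len_pos])+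
  have G0: "G \<noteq> 0" using X X0 by auto
  have dG: "len = 4 * m + degree G"
    using X G0 parity_poly_nonzero dX parity_poly_structure(1) by (simp add: degree_mult_eq)
  have C: "code = {v \<in> carrier_vec len. G dvd vec_poly v}"
    by (simp add: code_def code_of_parity_check_def G_def X_def)
  have "trace_words \<subseteq> {v \<in> carrier_vec len. G dvd vec_poly v}"
  proof (intro subsetI)
    fix v assume "v \<in> trace_words"
    then obtain c d where v: "v = cw c d" by auto
    have "parity_poly * G dvd parity_poly * vec_poly v"
      using parity_poly_annihilates[of c d] X v by (simp add: X_def)
    then have "G dvd vec_poly v" using parity_poly_nonzero by simp
    then show "v \<in> {v \<in> carrier_vec len. G dvd vec_poly v}" using v by (simp add: cw_def)
  qed
  note sub = this
  have "degree G \<le> len" using dG by simp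
  note cm = card_multiples[OF G0 this]
  have "trace_words = {v \<in> carrier_vec len. G dvd vec_poly v}"
    by (rule card_seteq[OF conjunct1[OF cm] sub]) (use conjunct2[OF cm] dG card_range_cw in simp)
  then show "code = trace_words"
    unfolding C by (rule sym)
  have "G dvd monom 1 len - 1" using X by (simp add: X_def)
  then show "cyclic_code len code"
    unfolding C by (rule cyclic_code_multiples[OF len_pos])
qed

section \<open>Dimension, weight frequencies and minimum distance of the code\<close>

lemma weight_frequency_eq:
  "real (weight_frequency code ((int CARD('p) - 1) * int CARD('p) ^ (m - 1) - z))
    = real (card {(c, d). fam.excess c d = real CARD('p) * of_int z})"
proof -
  let ?w = "(int CARD('p) - 1) * int CARD('p) ^ (m - 1) - z"
  have "{v \<in> trace_words. int (hamming_weight v) = ?w}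
      = (\<lambda>(c, d). cw c d) ` {(c, d). int (hamming_weight (cw c d)) = ?w}" by auto
  then have "card {v \<in> trace_words. int (hamming_weight v) = ?w}
      = card {(c, d). int (hamming_weight (cw c d)) = ?w}"
    using card_image[OF inj_on_subset[OF inj_cw subset_UNIV]] by simp
  then show ?thesis unfolding weight_frequency_def code_eq_range(1) weight_eq_iff by simp
qed

lemma code_dim_eq: "code_dim len code = 4 * m"
proof -
  have "linear_code len code"
    using code_eq_range(2) by (simp add: cyclic_code_def)
  moreover have "finite code" unfolding code_eq_range(1) by simp
  ultimately have "CARD('p) ^ (4 * m) = CARD('p mod_ring) ^ code_dim len code"
    using card_linear_code card_range_cw code_eq_range(1) by metis
  then show ?thesis using p_gt_1 by simp
qed

definition wt0 :: int where "wt0 = (int CARD('p) - 1) * int CARD('p) ^ (m - 1)"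

definition freq :: "real \<Rightarrow> real" where
  "freq z = real (card {(c, d). fam.excess c d = real CARD('p) * z})"

lemma weight_frequency_code: "real (weight_frequency code (wt0 - z)) = freq (of_int z)"
  by (simp only: wt0_def freq_def weight_frequency_eq)

text \<open>Contributions of even nullity at nonzero values keep an explicit sign instead of
  \<open>n_eps_val\<close>: matching that sign with \<epsilon> requires the Legendre symbol of -1,
  which enters only in the final theorem.\<close>

lemma freq_values:
  defines "R \<equiv> real CARD('p)" and "a \<equiv> real CARD('p) ^ ((m - 1) div 2)" and "p \<equiv> CARD('p)"
  shows "freq ((R - 1) * R ^ (m - 1)) = 1"
    and "freq 0 = omega p m + 2 * n_eps_val p m 1 0 0 + 2 * n_eps_val p m 1 2 0 + 2 * n_eps_val p m 1 4 0"
    and "freq a = (R - 1) * ((R ^ (m - 1) + R ^ ((m - 1) div 2)) * n_eps_0 p m) + (R - 1) * n_eps_val p m (-1) 1 1"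
    and "freq (- a) = (R - 1) * ((R ^ (m - 1) - R ^ ((m - 1) div 2)) * n_eps_0 p m) + (R - 1) * n_eps_val p m 1 1 1"
    and "freq ((R - 1) * a) = n_eps_val p m 1 1 0"
    and "freq (- ((R - 1) * a)) = n_eps_val p m (-1) 1 0"
    and "freq (R * a) = (R - 1) * ((R ^ (m - 3) + R ^ ((m - 3) div 2)) * n_eps_2 p m) + (R - 1) * n_eps_val p m (-1) 3 1"
    and "freq (- (R * a)) = (R - 1) * ((R ^ (m - 3) - R ^ ((m - 3) div 2)) * n_eps_2 p m) + (R - 1) * n_eps_val p m 1 3 1"
    and "freq ((R - 1) * (R * a)) = n_eps_val p m 1 3 0"
    and "freq (- ((R - 1) * (R * a))) = n_eps_val p m (-1) 3 0"
    and "freq (R ^ 2 * a) = (R - 1) * ((R ^ (m - 5) + R ^ ((m - 5) div 2)) * n_eps_4 p m)"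
    and "freq (- (R ^ 2 * a)) = (R - 1) * ((R ^ (m - 5) - R ^ ((m - 5) div 2)) * n_eps_4 p m)"
    and "z \<notin> {0, (R - 1) * R ^ (m - 1), a, - a, (R - 1) * a, - ((R - 1) * a), R * a, - (R * a),
      (R - 1) * (R * a), - ((R - 1) * (R * a)), R ^ 2 * a, - (R ^ 2 * a)} \<Longrightarrow> freq z = 0"
proof -
  define t2 t3 t4 t5 t6 where "t2 = (R - 1) * a" and "t3 = R * a" and "t4 = (R - 1) * (R * a)"
    and "t5 = R ^ 2 * a" and "t6 = (R - 1) * R ^ (m - 1)"
  note t = t2_def t3_def t4_def t5_def t6_def
  have ch: "0 < a" "a < t2" "t2 < t3" "t3 < t4" "t4 < t5" "t5 < t6"
    unfolding t R_def a_def by (rule weight_chain)+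
  have d: "m - 1 - 1 = m - 2" "m - 1 - 2 = m - 3" "m - 3 - 1 = m - 4" "m - 3 - 2 = m - 5"
    "m - 2 - 1 = m - 3" "m - 4 - 1 = m - 5" "m - 0 - 1 = m - 1"
    by simp_all
  have nz: "n_eps_val p m e 1 0 = (R ^ (m - 2) + of_int e * ((R - 1) * R ^ ((m - 3) div 2))) * n_eps_1 p m e"
    "n_eps_val p m e 1 1 = (R ^ (m - 2) - of_int e * R ^ ((m - 3) div 2)) * n_eps_1 p m e"
    "n_eps_val p m e 3 0 = (R ^ (m - 4) + of_int e * ((R - 1) * R ^ ((m - 5) div 2))) * n_eps_3 p m e"
    "n_eps_val p m e 3 1 = (R ^ (m - 4) - of_int e * R ^ ((m - 5) div 2)) * n_eps_3 p m e"
    "n_eps_val p m 1 0 0 = R ^ (m - 1) * n_eps_0 p m"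
    "n_eps_val p m 1 2 0 = R ^ (m - 3) * n_eps_2 p m"
    "n_eps_val p m 1 4 0 = R ^ (m - 5) * n_eps_4 p m" for e
    unfolding n_eps_val_def n_eps_def d by (simp_all add: R_def p_def)
  have om: "omega p m = R ^ m - 1 + (R ^ m - R ^ (m - 1)) * (n_eps_1 p m 1 + n_eps_1 p m (-1))
      + (R ^ m - R ^ (m - 2)) * (2 * n_eps_2 p m) + (R ^ m - R ^ (m - 3)) * (n_eps_3 p m 1 + n_eps_3 p m (-1))
      + (R ^ m - R ^ (m - 4)) * (2 * n_eps_4 p m)"
    by (simp add: omega_def n_total_def n_eps_def R_def p_def)
  note E = excess_frequency[folded R_def a_def p_def, folded freq_def[folded R_def] t]
  note A = a_def[folded R_def]
  show "freq t6 = 1" unfolding E using ch by simp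
  show "freq 0 = omega p m + 2 * n_eps_val p m 1 0 0 + 2 * n_eps_val p m 1 2 0 + 2 * n_eps_val p m 1 4 0"
    unfolding E nz om using ch by (simp add: algebra_simps)
  show "freq a = (R - 1) * ((R ^ (m - 1) + R ^ ((m - 1) div 2)) * n_eps_0 p m) + (R - 1) * n_eps_val p m (-1) 1 1"
    unfolding E nz A[symmetric] using ch by simp
  show "freq (- a) = (R - 1) * ((R ^ (m - 1) - R ^ ((m - 1) div 2)) * n_eps_0 p m) + (R - 1) * n_eps_val p m 1 1 1"
    unfolding E nz A[symmetric] using ch by simp
  show "freq t2 = n_eps_val p m 1 1 0" unfolding E nz using ch by simp
  show "freq (- t2) = n_eps_val p m (-1) 1 0" unfolding E nz using ch by simp
  show "freq t3 = (R - 1) * ((R ^ (m - 3) + R ^ ((m - 3) div 2)) * n_eps_2 p m) + (R - 1) * n_eps_val p m (-1) 3 1"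
    unfolding E nz using ch by simp
  show "freq (- t3) = (R - 1) * ((R ^ (m - 3) - R ^ ((m - 3) div 2)) * n_eps_2 p m) + (R - 1) * n_eps_val p m 1 3 1"
    unfolding E nz using ch by simp
  show "freq t4 = n_eps_val p m 1 3 0" unfolding E nz using ch by simp
  show "freq (- t4) = n_eps_val p m (-1) 3 0" unfolding E nz using ch by simp
  show "freq t5 = (R - 1) * ((R ^ (m - 5) + R ^ ((m - 5) div 2)) * n_eps_4 p m)"
    unfolding E nz using ch by simp
  show "freq (- t5) = (R - 1) * ((R ^ (m - 5) - R ^ ((m - 5) div 2)) * n_eps_4 p m)"
    unfolding E nz using ch by simp
  show "freq z = 0" if "z \<notin> {0, t6, a, - a, t2, - t2, t3, - t3, t4, - t4, t5, - t5}"
    unfolding E using that by simp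
qed

text \<open>Since m \<ge> 5, every factor of \<open>n_eps_4\<close> is positive, so forms of nullity
  4 exist and the largest shortfall is attained.\<close>

lemma freq_max_pos: "freq (real CARD('p) ^ 2 * real CARD('p) ^ ((m - 1) div 2)) > 0"
proof -
  have R: "1 < real CARD('p)" using p_gt_1 by simp
  have "real CARD('p) ^ n > 1" if "n > 0" for n using R that by (rule one_less_power)
  then have "n_eps_4 CARD('p) m > 0"
    unfolding n_eps_4_def using m_ge by (intro divide_pos_pos mult_pos_pos) simp_all
  then show ?thesis unfolding freq_values using R by (intro mult_pos_pos add_pos_pos) simp_all
qed

lemma min_distance_code:
  "int (min_distance code) = wt0 - int CARD('p) ^ 2 * int CARD('p) ^ ((m - 1) div 2)"
proof -
  define R where "R = real CARD('p)"
  define a where "a = real CARD('p) ^ ((m - 1) div 2)"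
  define z where "z = int CARD('p) ^ 2 * int CARD('p) ^ ((m - 1) div 2)"
  have rz: "real_of_int z = R ^ 2 * a" by (simp add: z_def R_def a_def)
  have fin: "finite code" unfolding code_eq_range(1) by simp
  have rw: "real_of_int wt0 = (R - 1) * R ^ (m - 1)" by (simp add: wt0_def R_def)
  define t2 t3 t4 t5 where "t2 = (R - 1) * a" and "t3 = R * a" and "t4 = (R - 1) * (R * a)" and "t5 = R ^ 2 * a"
  note t = t2_def t3_def t4_def t5_def
  have ch: "0 < a" "a < t2" "t2 < t3" "t3 < t4" "t4 < t5" "t5 < of_int wt0"
    unfolding t R_def a_def rw[unfolded R_def] by (rule weight_chain)+
  have zw: "z < wt0" using ch(6) rz unfolding t5_def by (metis of_int_less_iff)
  have "weight_frequency code (wt0 - z) \<noteq> 0"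
    using freq_max_pos[folded R_def a_def] weight_frequency_code[of z] by (simp add: rz)
  then obtain u where u: "u \<in> code" "int (hamming_weight u) = wt0 - z"
    unfolding weight_frequency_def by (metis (mono_tags, lifting) card.empty empty_Collect_eq)
  define w where "w = nat (wt0 - z)"
  have w: "int w = wt0 - z" using zw by (simp add: w_def)
  have "min_distance code = w"
  proof (rule min_distance_linear)
    show "linear_code len code" using code_eq_range(2) by (simp add: cyclic_code_def)
    show "finite code" by (rule fin)
    show "u \<in> code" by (rule u)
    show "hamming_weight u = w" using u(2) w by simp
    show "w > 0" using w zw by simp
    fix v assume v: "v \<in> code"
    define y where "y = wt0 - int (hamming_weight v)"
    have "weight_frequency code (wt0 - y) \<noteq> 0"
      unfolding weight_frequency_def using v fin by (auto simp: y_def)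
    then have "freq (of_int y) \<noteq> 0" using weight_frequency_code[of y] by simp
    then have "real_of_int y \<in> {0, of_int wt0, a, - a, t2, - t2, t3, - t3, t4, - t4, t5, - t5}"
      using freq_values(13)[folded R_def a_def, folded rw t, of "of_int y"] by blast
    \<comment> \<open>The value \<open>wt0\<close> belongs to the zero word; all remaining
      shortfalls are bounded by the largest one, \<open>t5\<close>.\<close>
    then have "real_of_int y = of_int wt0 \<or> real_of_int y \<le> t5"
      using ch(1-5) by auto
    then have "y = wt0 \<or> y \<le> z" unfolding t5_def rz[symmetric] by simp
    then show "hamming_weight v = 0 \<or> w \<le> hamming_weight v" using w by (auto simp: y_def)
  qed
  then show ?thesis using w by (simp add: z_def)
qed

end

section \<open>Translation to the Legendre symbol and assembly of the weight table\<close>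

lemma Legendre_neg_1_cases:
  assumes "prime p" "odd (p :: nat)"
  shows "Legendre (-1) (int p) = 1 \<or> Legendre (-1) (int p) = -1"
proof -
  have "\<not> [-1 = 0] (mod int p)"
    using assms by (auto simp: cong_0_iff dest: prime_gt_1_nat)
  then show ?thesis by (auto simp: Legendre_def)
qed

theorem theorem3p3:
  fixes p m k :: nat
    and \<pi> :: "'a::{field, finite}"
    and C :: "'p::prime_card mod_ring vec set"
  assumes p: "prime p" "odd p" "CARD('p) = p"
    and m: "m \<ge> 5" "odd m"
    and k: "k > 0" "gcd m k = 1"
    and field: "CARD('a) = p ^ m"
    and prim: "primitive_element \<pi>"
    and C: "C = code_pmk m k \<pi>"
  shows "cyclic_code (p ^ m - 1) C
    \<and> code_dim (p ^ m - 1) C = 4 * m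
    \<and> int (min_distance C) = (int p - 1) * int p ^ (m - 1) - int p ^ ((m + 3) div 2)
    \<and> (let n = n_eps_val p m;
           \<eta> = Legendre (- 1) (int p);
           A = (\<lambda>w. real (weight_frequency C w));
           P = int p;
           R = real p;
           w\<^sub>0 = (P - 1) * P ^ (m - 1);
           a = P ^ ((m - 1) div 2);
           b = P ^ ((m + 1) div 2);
           c = P ^ ((m + 3) div 2)
       in A 0 = 1
        \<and> A w\<^sub>0 = omega p m + 2 * n 1 0 0 + 2 * n 1 2 0 + 2 * n 1 4 0
        \<and> A (w\<^sub>0 - a) = (R - 1) * n \<eta> 0 1 + (R - 1) * n (- 1) 1 1
        \<and> A (w\<^sub>0 + a) = (R - 1) * n (- \<eta>) 0 1 + (R - 1) * n 1 1 1
        \<and> A (w\<^sub>0 - (P - 1) * a) = n 1 1 0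
        \<and> A (w\<^sub>0 + (P - 1) * a) = n (- 1) 1 0
        \<and> A (w\<^sub>0 - b) = (R - 1) * n \<eta> 2 1 + (R - 1) * n (- 1) 3 1
        \<and> A (w\<^sub>0 + b) = (R - 1) * n (- \<eta>) 2 1 + (R - 1) * n 1 3 1
        \<and> A (w\<^sub>0 - (P - 1) * b) = n 1 3 0
        \<and> A (w\<^sub>0 + (P - 1) * b) = n (- 1) 3 0
        \<and> A (w\<^sub>0 - c) = (R - 1) * n \<eta> 4 1
        \<and> A (w\<^sub>0 + c) = (R - 1) * n (- \<eta>) 4 1
        \<and> (\<forall>w. w \<notin> {0, w\<^sub>0, w\<^sub>0 - a, w\<^sub>0 + a, w\<^sub>0 - (P - 1) * a, w\<^sub>0 + (P - 1) * a,
                      w\<^sub>0 - b, w\<^sub>0 + b, w\<^sub>0 - (P - 1) * b, w\<^sub>0 + (P - 1) * b,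
                      w\<^sub>0 - c, w\<^sub>0 + c} \<longrightarrow> A w = 0))"
proof -
  interpret trace_code "TYPE('p)" "TYPE('a)" m k \<pi>
  proof unfold_locales
    show "odd CARD('p)" using p by simp
    show "CARD('a) = CARD('p) ^ m" unfolding p(3) by (rule field)
    show "m > 0" "odd m" "m \<ge> 5" using m by auto
    show "coprime m k" using k(2) by (simp only: coprime_iff_gcd_eq_1)
    show "primitive_element \<pi>" by (rule prim)
  qed
  have len: "len = p ^ m - 1" using field by (simp add: len_def)
  have C: "C = code"
    unfolding C code_pmk_def code_def Let_def parity_poly_def len p(3) ..
  define \<eta> where "\<eta> = Legendre (- 1) (int p)"
  have eta: "\<eta> = 1 \<or> \<eta> = -1" unfolding \<eta>_def by (rule Legendre_neg_1_cases[OF p(1,2)])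
  define R where "R = real p"
  define a where "a = int p ^ ((m - 1) div 2)"
  have ra: "real_of_int a = R ^ ((m - 1) div 2)" by (simp add: a_def R_def)
  have "(m + 1) div 2 = Suc ((m - 1) div 2)" "(m + 3) div 2 = Suc (Suc ((m - 1) div 2))"
    using m by (auto elim!: oddE)
  then have bc: "int p ^ ((m + 1) div 2) = int p * a" "int p ^ ((m + 3) div 2) = int p ^ 2 * a"
    by (simp_all add: a_def power2_eq_square)
  have w0: "(int p - 1) * int p ^ (m - 1) = wt0" by (simp add: wt0_def p)
  have rw: "real_of_int wt0 = (R - 1) * R ^ (m - 1)" by (simp add: wt0_def R_def p)
  note f = freq_values[unfolded p(3), folded R_def]
  have nv: "n_eps_val p m \<eta> i 1 = (R ^ (m - i - 1) + R ^ ((m - i - 1) div 2)) * n_eps p m 1 i"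
    "n_eps_val p m (- \<eta>) i 1 = (R ^ (m - i - 1) - R ^ ((m - i - 1) div 2)) * n_eps p m 1 i"
    if "even i" "i \<le> 4" for i
  proof -
    \<comment> \<open>For j = 1 the symbol in \<open>n_eps_val\<close> is \<eta> itself, so choosing
      \<epsilon> = \<eta> or \<epsilon> = -\<eta> makes the sign of the second term +1 or
      -1.\<close>
    have ee: "of_int \<eta> * of_int (Legendre (- 1) (int p)) = (1 :: real)" using eta unfolding \<eta>_def by auto
    have "n_eps p m e i = n_eps p m 1 i" for e using that by (auto simp: n_eps_def)
    then show "n_eps_val p m \<eta> i 1 = (R ^ (m - i - 1) + R ^ ((m - i - 1) div 2)) * n_eps p m 1 i"
      "n_eps_val p m (- \<eta>) i 1 = (R ^ (m - i - 1) - R ^ ((m - i - 1) div 2)) * n_eps p m 1 i"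
      using that ee unfolding n_eps_val_def by (simp_all add: R_def)
  qed
  have d: "m - 1 - 1 = m - 2" "m - 1 - 2 = m - 3" "m - 3 - 1 = m - 4" "m - 3 - 2 = m - 5"
    "m - 2 - 1 = m - 3" "m - 4 - 1 = m - 5" "m - 0 - 1 = m - 1"
    by simp_all
  have nv': "n_eps_val p m \<eta> 0 1 = (R ^ (m - 1) + R ^ ((m - 1) div 2)) * n_eps_0 p m"
    "n_eps_val p m (- \<eta>) 0 1 = (R ^ (m - 1) - R ^ ((m - 1) div 2)) * n_eps_0 p m"
    "n_eps_val p m \<eta> 2 1 = (R ^ (m - 3) + R ^ ((m - 3) div 2)) * n_eps_2 p m"
    "n_eps_val p m (- \<eta>) 2 1 = (R ^ (m - 3) - R ^ ((m - 3) div 2)) * n_eps_2 p m"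
    "n_eps_val p m \<eta> 4 1 = (R ^ (m - 5) + R ^ ((m - 5) div 2)) * n_eps_4 p m"
    "n_eps_val p m (- \<eta>) 4 1 = (R ^ (m - 5) - R ^ ((m - 5) div 2)) * n_eps_4 p m"
    using nv[of 0] nv[of 2] nv[of 4] unfolding d by (simp_all add: n_eps_def)
  define A where "A w = real (weight_frequency C w)" for w
  have A: "A (wt0 - z) = freq (of_int z)" for z
    unfolding A_def C by (rule weight_frequency_code)
  have Ap: "A (wt0 + z) = freq (- of_int z)" for z using A[of "- z"] by simp
  have zero: "A 0 = 1" using A[of wt0] f(1) by (simp add: rw)
  have A0: "A wt0 = freq 0" using A[of 0] by simp
  have rest: "A w = 0" if w: "w \<notin> {0, wt0, wt0 - a, wt0 + a, wt0 - (int p - 1) * a, wt0 + (int p - 1) * a,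
      wt0 - int p * a, wt0 + int p * a, wt0 - (int p - 1) * (int p * a), wt0 + (int p - 1) * (int p * a),
      wt0 - int p ^ 2 * a, wt0 + int p ^ 2 * a}" for w
  proof -
    define z where "z = wt0 - w"
    have wz: "w = wt0 - z" by (simp add: z_def)
    have "z \<notin> {0, wt0, a, - a, (int p - 1) * a, - ((int p - 1) * a), int p * a, - (int p * a),
      (int p - 1) * (int p * a), - ((int p - 1) * (int p * a)), int p ^ 2 * a, - (int p ^ 2 * a)}"
      using w unfolding wz by auto
    then have "real_of_int z \<notin> real_of_int ` {0, wt0, a, - a, (int p - 1) * a, - ((int p - 1) * a), int p * a, - (int p * a),
      (int p - 1) * (int p * a), - ((int p - 1) * (int p * a)), int p ^ 2 * a, - (int p ^ 2 * a)}"
      using of_int_eq_iff by blast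
    then have "freq (real_of_int z) = 0"
      by (intro f(13)) (simp add: rw R_def ra)
    then show ?thesis using A[of z] by (simp add: z_def)
  qed
  have ri: "real_of_int a = R ^ ((m - 1) div 2)" "real_of_int ((int p - 1) * a) = (R - 1) * R ^ ((m - 1) div 2)"
    "real_of_int (int p * a) = R * R ^ ((m - 1) div 2)"
    "real_of_int ((int p - 1) * (int p * a)) = (R - 1) * (R * R ^ ((m - 1) div 2))"
    "real_of_int (int p ^ 2 * a) = R ^ 2 * R ^ ((m - 1) div 2)"
    using ra by (simp_all add: R_def)
  have vals: "A (wt0 - a) = (R - 1) * n_eps_val p m \<eta> 0 1 + (R - 1) * n_eps_val p m (- 1) 1 1"
    "A (wt0 + a) = (R - 1) * n_eps_val p m (- \<eta>) 0 1 + (R - 1) * n_eps_val p m 1 1 1"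
    "A (wt0 - (int p - 1) * a) = n_eps_val p m 1 1 0"
    "A (wt0 + (int p - 1) * a) = n_eps_val p m (- 1) 1 0"
    "A (wt0 - int p * a) = (R - 1) * n_eps_val p m \<eta> 2 1 + (R - 1) * n_eps_val p m (- 1) 3 1"
    "A (wt0 + int p * a) = (R - 1) * n_eps_val p m (- \<eta>) 2 1 + (R - 1) * n_eps_val p m 1 3 1"
    "A (wt0 - (int p - 1) * (int p * a)) = n_eps_val p m 1 3 0"
    "A (wt0 + (int p - 1) * (int p * a)) = n_eps_val p m (- 1) 3 0"
    "A (wt0 - int p ^ 2 * a) = (R - 1) * n_eps_val p m \<eta> 4 1"
    "A (wt0 + int p ^ 2 * a) = (R - 1) * n_eps_val p m (- \<eta>) 4 1"
    unfolding A Ap nv' ri by (rule f)+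
  have params: "cyclic_code (p ^ m - 1) C" "code_dim (p ^ m - 1) C = 4 * m"
    "int (min_distance C) = wt0 - int p ^ 2 * a"
    using code_eq_range(2) code_dim_eq min_distance_code by (simp_all add: C len a_def p)
  show ?thesis
    unfolding Let_def bc w0 a_def[symmetric] \<eta>_def[symmetric] R_def[symmetric] A_def[symmetric]
    using params zero A0 f(2) vals rest by simp
qed

end
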